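(* Let $1\le q\le s\le p\le\infty$. For every $f\in L^0(\mu)$, $$\|f\|_{q,p}\le 4^{\frac1q}\,\|f\|_s\,\mu(B_1)^{\frac1p-\frac1s+\frac1q}.$$
   Context: Fix a real number $\kappa>-1/2$. Let $\mu$ be the measure on $\mathbb R$ given by $d\mu(x)=\left(2^{\kappa+1}\Gamma(\kappa+1)\right)^{-1}|x|^{2\kappa+1}dx$; $L^p(\mu)$ ($1\le p\le\infty$) is the corresponding Lebesgue space with norm $\|\cdot\|_p$ (taken to be $\infty$ for measurable functions outside $L^p(\mu)$), and $L^0(\mu)$ is the space of $\mu$-a.e. equivalence classes of complex-valued $\mu$-measurable functions on $\mathbb R$. Convention: $1/\infty=0$. Dunkl translation. Let $j_\kappa(z)=\Gamma(\kappa+1)\sum_{n\ge0}\frac{(-1)^nz^{2n}}{n!\,2^{2n}\Gamma(n+\kappa+1)}$ and let $\mathfrak E(z)=j_\kappa(iz)+\frac{z}{2(\kappa+1)}j_{\kappa+1}(iz)$, $z\in\mathbb C$ (the Dunkl kernel). The Dunkl transform is $\mathcal F f(\lambda)=\int_{\mathbb R}\mathfrak E(-i\lambda x)f(x)\,d\mu(x)$ for $f\in L^1(\mu)$, and it extends uniquely to an isometric isomorphism of $L^2(\mu)$. For $y\in\mathbb R$ the generalized (Dunkl) translation $\tau_y$ is defined on $L^2(\mu)$ by $\mathcal F(\tau_yf)(x)=\mathfrak E(ixy)\mathcal F(f)(x)$, and it extends to a bounded operator on every $L^p(\mu)$, $p\ge1$. Balls. $B_r=B(0,r)=(-r,r)$,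 and for $x\ne0$, $B(x,r)=\{y\in\mathbb R:\max\{0,|x|-r\}<|y|<|x|+r\}$. The function $\tau_x\chi_{B_r}$ satisfies $0\le\tau_x\chi_{B_r}\le1$ and is supported in $B(x,r)$. For a nonnegative measurable $g$, the integral $\int_{\mathbb R}(\tau_yg)\chi_{B_r}\,d\mu$ is understood as $\int_{\mathbb R}g(x)\,\tau_{-y}\chi_{B_r}(x)\,d\mu(x)\in[0,\infty]$. Norm. For $1\le q,p\le\infty$ and $f\in L^0(\mu)$, with the $L^p(\mu)$-norm taken in the variable $y$, $$\|f\|_{q,p}=\Big\|\Big[\int_{\mathbb R}(\tau_y|f|^q)(x)\chi_{B_1}(x)\,d\mu(x)\Big]^{1/q}\Big\|_p\ (q<\infty),\qquad \|f\|_{\infty,p}=\big\|\,\|f\chi_{B(y,1)}\|_\infty\big\|_p .$$ *)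

theory Defs
  imports "HOL-Analysis.Analysis" "HOL-Probability.Essential_Supremum"
begin

section \<open>Lebesgue norms with extended exponents\<close>

text \<open>Real powers on \<open>[0, \<infinity>]\<close>; the convention \<open>\<infinity> ^ a = \<infinity>\<close> is the right one only for \<open>a > 0\<close>,
  and only such exponents are used below.\<close>

definition ennreal_powr :: "ennreal \<Rightarrow> real \<Rightarrow> ennreal" where
  "ennreal_powr x a = (if x = \<infinity> then \<infinity> else ennreal (enn2real x powr a))"

text \<open>The norm takes values in \<open>[0, \<infinity>]\<close> and is defined for all \<open>[0, \<infinity>]\<close>-valued functions, since the
  mixed norms below take the norm of a function that may attain the value \<open>\<infinity>\<close>.\<close>

definition Lp_norm_nonneg :: "'a measure \<Rightarrow> ereal \<Rightarrow> ('a \<Rightarrow> ennreal) \<Rightarrow> ennreal" where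
  "Lp_norm_nonneg M p g =
    (if p = \<infinity> then esssup M g
     else ennreal_powr (\<integral>\<^sup>+x. ennreal_powr (g x) (real_of_ereal p) \<partial>M) (real_of_ereal (1 / p)))"

definition Lp_norm :: "'a measure \<Rightarrow> ereal \<Rightarrow> ('a \<Rightarrow> complex) \<Rightarrow> ennreal" where
  "Lp_norm M p f = Lp_norm_nonneg M p (\<lambda>x. ennreal (norm (f x)))"

definition Lp_space :: "'a measure \<Rightarrow> ereal \<Rightarrow> ('a \<Rightarrow> complex) set" where
  "Lp_space M p = {f \<in> borel_measurable M. Lp_norm M p f < \<infinity>}"


section \<open>The weighted measure and the Dunkl transform\<close>

text \<open>The density is taken over the completed measure \<^term>\<open>lebesgue\<close>, so that
  \<open>borel_measurable (dunkl_measure \<kappa>)\<close> consists of all functions that are measurable for the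
  completion of the weighted measure, i.e. of all representatives of elements of \<open>L\<^sup>0\<close>.\<close>

definition dunkl_measure :: "real \<Rightarrow> real measure" where
  "dunkl_measure \<kappa> =
    density lebesgue
      (\<lambda>x. ennreal (\<bar>x\<bar> powr (2 * \<kappa> + 1) / (2 powr (\<kappa> + 1) * Gamma (\<kappa> + 1))))"

definition bessel_j :: "real \<Rightarrow> complex \<Rightarrow> complex" where
  "bessel_j \<kappa> z =
    of_real (Gamma (\<kappa> + 1)) *
    (\<Sum>n. (- 1) ^ n * z ^ (2 * n) /
          of_real (fact n * 2 ^ (2 * n) * Gamma (real n + \<kappa> + 1)))"

definition dunkl_kernel :: "real \<Rightarrow> complex \<Rightarrow> complex" where
  "dunkl_kernel \<kappa> z =
    bessel_j \<kappa> (\<i> * z) + z / of_real (2 * (\<kappa> + 1)) * bessel_j (\<kappa> + 1) (\<i> * z)"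

definition dunkl_transform :: "real \<Rightarrow> (real \<Rightarrow> complex) \<Rightarrow> real \<Rightarrow> complex" where
  "dunkl_transform \<kappa> f l =
    (LINT x|dunkl_measure \<kappa>. dunkl_kernel \<kappa> (- \<i> * of_real l * of_real x) * f x)"

text \<open>The graph of the continuous extension of the transform from \<open>L\<^sup>1 \<inter> L\<^sup>2\<close> to \<open>L\<^sup>2\<close>: it is the
  \<open>L\<^sup>2\<close>-closure of the graph on \<open>L\<^sup>1 \<inter> L\<^sup>2\<close>, and \<open>g\<close> is determined by \<open>f\<close> up to null sets.\<close>

definition has_dunkl_transform_L2 ::
    "real \<Rightarrow> (real \<Rightarrow> complex) \<Rightarrow> (real \<Rightarrow> complex) \<Rightarrow> bool" where
  "has_dunkl_transform_L2 \<kappa> f g \<longleftrightarrow>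
    f \<in> Lp_space (dunkl_measure \<kappa>) 2 \<and> g \<in> Lp_space (dunkl_measure \<kappa>) 2 \<and>
    (\<exists>h :: nat \<Rightarrow> real \<Rightarrow> complex.
      (\<forall>n. h n \<in> Lp_space (dunkl_measure \<kappa>) 1 \<inter> Lp_space (dunkl_measure \<kappa>) 2) \<and>
      (\<lambda>n. Lp_norm (dunkl_measure \<kappa>) 2 (\<lambda>x. h n x - f x)) \<longlonglongrightarrow> 0 \<and>
      (\<lambda>n. Lp_norm (dunkl_measure \<kappa>) 2 (\<lambda>l. dunkl_transform \<kappa> (h n) l - g l)) \<longlonglongrightarrow> 0)"


section \<open>Dunkl translation\<close>

text \<open>For \<open>f \<in> L\<^sup>2\<close> this picks a representative of the translate, which is determined up to null sets.\<close>

definition dunkl_translation :: "real \<Rightarrow> real \<Rightarrow> (real \<Rightarrow> complex) \<Rightarrow> real \<Rightarrow> complex" where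
  "dunkl_translation \<kappa> y f =
    (SOME h. \<exists>g. has_dunkl_transform_L2 \<kappa> f g \<and>
       has_dunkl_transform_L2 \<kappa> h (\<lambda>x. dunkl_kernel \<kappa> (\<i> * of_real x * of_real y) * g x))"

definition dunkl_ball :: "real \<Rightarrow> real \<Rightarrow> real set" where
  "dunkl_ball x r =
    (if x = 0 then {- r<..<r} else {y. max 0 (\<bar>x\<bar> - r) < \<bar>y\<bar> \<and> \<bar>y\<bar> < \<bar>x\<bar> + r})"

text \<open>The integral of \<open>(\<tau>\<^sub>y g) \<chi>\<close> for nonnegative \<open>g\<close>, where \<open>\<chi>\<close> is the indicator of the ball
  \<open>B(0, r)\<close>: the translation is moved to the indicator, whose translates have values in \<open>[0, 1]\<close>
  almost everywhere, so that passing to \<^const>\<open>Re\<close> and \<^const>\<open>ennreal\<close> loses nothing.\<close>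

definition dunkl_translate_integral :: "real \<Rightarrow> real \<Rightarrow> real \<Rightarrow> (real \<Rightarrow> ennreal) \<Rightarrow> ennreal" where
  "dunkl_translate_integral \<kappa> r y g =
    (\<integral>\<^sup>+x. g x * ennreal (Re (dunkl_translation \<kappa> (- y) (indicator (dunkl_ball 0 r)) x))
       \<partial>dunkl_measure \<kappa>)"

definition dunkl_amalgam_norm :: "real \<Rightarrow> ereal \<Rightarrow> ereal \<Rightarrow> (real \<Rightarrow> complex) \<Rightarrow> ennreal" where
  "dunkl_amalgam_norm \<kappa> q p f =
    Lp_norm_nonneg (dunkl_measure \<kappa>) p
      (if q = \<infinity>
       then (\<lambda>y. Lp_norm (dunkl_measure \<kappa>) \<infinity> (\<lambda>x. f x * indicator (dunkl_ball y 1) x))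
       else (\<lambda>y. ennreal_powr
              (dunkl_translate_integral \<kappa> 1 y (\<lambda>x. ennreal (norm (f x) powr real_of_ereal q)))
              (real_of_ereal (1 / q))))"

end

theory Submission imports Defs "HOL-Probability.Probability_Measure" begin

text \<open>
  The translates \<open>\<tau>\<^sub>-\<^sub>y \<chi>\<close> of the indicator function of the unit ball form a symmetric kernel \<open>K(x, y)\<close>
  with values in \<open>[0, 1]\<close> and \<open>\<integral> K(x, y) d\<mu>(x) = \<mu>(B\<^sub>1)\<close>, so that the estimate is Young's inequality
  for integral kernels, applied to \<open>\<bar>f\<bar>\<^sup>q\<close> and the exponents \<open>s / q\<close> and \<open>p / q\<close>.

  The kernel is Roesler's: with the probability measure \<open>m\<close> on \<open>(-1, 1)\<close> that represents the Dunkl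
  kernel, \<open>E(z) = \<integral> e\<^sup>t\<^sup>z dm(t)\<close>, it is \<open>K(x, y) = m {t. x\<^sup>2 + y\<^sup>2 - 2 x y t < 1}\<close>. Replacing the
  indicator function by a Gaussian \<open>e\<^sup>-\<^sup>s\<^sup>r\<close> of \<open>r = x\<^sup>2 + y\<^sup>2 - 2 x y t\<close> gives the function
  \<open>e\<^sup>-\<^sup>s\<^sup>(\<^sup>x\<^sup>2\<^sup>+\<^sup>y\<^sup>2\<^sup>) E(2 s x y)\<close>, whose Dunkl transform is known from the Gaussian integral of a product of
  two Dunkl kernels, a consequence of the Vandermonde identity. Since Laplace transforms determine
  measures on \<open>[0, \<infinity>)\<close>, the transform of \<open>K(\<sqdot>, y)\<close> is the expected one as well. Uniqueness of the
  \<open>L\<^sup>2\<close> transform follows from the duality \<open>\<integral> Ff \<sqdot> g = \<integral> f \<sqdot> Fg\<close>, because the functions \<open>e\<^sup>-\<^sup>s\<^sup>x\<^sup>2\<close> and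
  \<open>x e\<^sup>-\<^sup>s\<^sup>x\<^sup>2\<close> are permuted by the transform up to scalars and are total in \<open>L\<^sup>2\<close>.
\<close>

section \<open>The confluent hypergeometric limit function\<close>

text \<open>\<open>dunkl_translation\<close> chooses some function satisfying a relation between L2
  limits, so it is opaque until that relation is shown to be solvable and to fix its solution up to
  null sets. Only the indicator of the ball is ever translated. A full Plancherel theorem can
  therefore be avoided: one function must be shown to have a square integrable transform, and
  pairings with Gaussians settle uniqueness.

  A sharp cutoff has no closed transform while a Gaussian has one; this is the reason for the detour
  through Laplace transforms. The quantity x^2 + y^2 - 2 x y t is the law of cosines for an angle
  with cosine t, and averaging a radial function of it over m is its translate. The density of m is
  a multiple of (1 + t) (1 - t^2)^(\<kappa> - 1/2), found by matching moments with the Taylor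
  coefficients of the Dunkl kernel. That m is a probability measure gives 0 \<le> K \<le> 1, and
  frequency 0 in the transform of K gives its mass. Young's inequality uses only these facts and the
  symmetry of K.\<close>

definition hyp_coeff :: "real \<Rightarrow> nat \<Rightarrow> real" where
  "hyp_coeff \<alpha> n = 1 / (fact n * pochhammer \<alpha> n)"

text \<open>The series 0F1(; \<alpha>; w), in which the normalised Bessel function becomes
  \<open>bessel_j \<kappa> (\<i> * z) = hyp0F1 (\<kappa> + 1) (z^2 / 4)\<close>. It is stated over a
  general Banach field because the real function at \<open>norm w\<close> serves as the majorant of
  the complex one.\<close>

definition hyp0F1 :: "real \<Rightarrow> 'a::{real_normed_field,banach} \<Rightarrow> 'a" where
  "hyp0F1 \<alpha> w = (\<Sum>n. of_real (hyp_coeff \<alpha> n) * w ^ n)"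

lemma hyp_coeff_pos: "\<alpha> > 0 \<Longrightarrow> hyp_coeff \<alpha> n > 0"
  by (simp add: hyp_coeff_def pochhammer_pos)

lemma hyp_coeff_nonneg [simp]: "\<alpha> > 0 \<Longrightarrow> hyp_coeff \<alpha> n \<ge> 0"
  using hyp_coeff_pos[of \<alpha> n] by simp

lemma hyp_coeff_0 [simp]: "hyp_coeff \<alpha> 0 = 1"
  by (simp add: hyp_coeff_def)

text \<open>Every factor \<alpha> + k is at least min \<alpha> 1. This crude bound compares
  \<open>hyp0F1\<close> with an exponential series.\<close>

lemma pochhammer_ge_power:
  fixes \<alpha> :: real
  assumes "\<alpha> > 0"
  shows "min \<alpha> 1 ^ n \<le> pochhammer \<alpha> n"
proof (induction n)
  case (Suc n)
  have "min \<alpha> 1 ^ n * min \<alpha> 1 \<le> pochhammer \<alpha> n * (\<alpha> + real n)"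
    using Suc assms by (intro mult_mono) (auto simp: pochhammer_nonneg)
  then show ?case
    by (simp add: pochhammer_Suc mult.commute)
qed simp

lemma summable_norm_hyp0F1:
  fixes w :: "'a::{real_normed_field,banach}"
  assumes "\<alpha> > 0"
  shows "summable (\<lambda>n. norm (of_real (hyp_coeff \<alpha> n) * w ^ n))"
proof (rule summable_comparison_test')
  show "summable (\<lambda>n. (norm w / min \<alpha> 1) ^ n /\<^sub>R fact n)"
    using exp_converges[of "norm w / min \<alpha> 1"] by (auto dest: sums_summable)
  fix n :: nat
  have "0 < min \<alpha> 1 ^ n" using assms by simp
  then have "hyp_coeff \<alpha> n \<le> 1 / (fact n * min \<alpha> 1 ^ n)"
    unfolding hyp_coeff_def using pochhammer_ge_power[OF assms, of n]
    by (intro divide_left_mono mult_left_mono mult_pos_pos) (auto simp: assms pochhammer_pos)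
  then have "hyp_coeff \<alpha> n * norm w ^ n \<le> 1 / (fact n * min \<alpha> 1 ^ n) * norm w ^ n"
    by (intro mult_right_mono) auto
  then show "norm (norm (of_real (hyp_coeff \<alpha> n) * w ^ n)) \<le> (norm w / min \<alpha> 1) ^ n /\<^sub>R fact n"
    using assms by (simp add: norm_mult norm_power power_divide field_simps)
qed

lemma hyp0F1_sums:
  fixes w :: "'a::{real_normed_field,banach}"
  assumes "\<alpha> > 0"
  shows "(\<lambda>n. of_real (hyp_coeff \<alpha> n) * w ^ n) sums hyp0F1 \<alpha> w"
  unfolding hyp0F1_def using summable_norm_cancel[OF summable_norm_hyp0F1[OF assms]]
  by (rule summable_sums)

lemma hyp0F1_0 [simp]: "hyp0F1 \<alpha> 0 = 1"
  unfolding hyp0F1_def by (subst powser_zero) simp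

lemma norm_hyp0F1_le:
  assumes "\<alpha> > 0"
  shows "norm (hyp0F1 \<alpha> w) \<le> hyp0F1 \<alpha> (norm w)"
  unfolding hyp0F1_def
  using summable_norm[OF summable_norm_hyp0F1[OF assms, of w]] assms
  by (simp add: norm_mult norm_power)

lemma continuous_on_hyp0F1:
  fixes S :: "'a::{real_normed_field,banach} set"
  assumes "\<alpha> > 0"
  shows "continuous_on S (hyp0F1 \<alpha>)"
proof -
  have "isCont (hyp0F1 \<alpha>) x" for x :: 'a
    unfolding hyp0F1_def
    using summable_norm_cancel[OF summable_norm_hyp0F1[OF assms, of "of_real (norm x + 1)"]]
    by (rule isCont_powser) simp
  then show ?thesis
    by (simp add: continuous_at_imp_continuous_on)
qed

text \<open>Vandermonde's identity for rising factorials, with \<open>fact l * (r choose l)\<close>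
  as the falling factorial of r. In this basis a sum over r against w^r / r! is elementary: the
  falling factorial turns the exponential series into w^l exp w.\<close>

lemma pochhammer_add_of_nat:
  fixes \<alpha> :: real
  shows "pochhammer (\<alpha> + real r) p =
    (\<Sum>l\<le>p. real (p choose l) * (fact l * real (r choose l)) * pochhammer (\<alpha> + real l) (p - l))"
proof (induction p arbitrary: \<alpha>)
  case (Suc p)
  let ?t = "\<lambda>l. fact l * real (r choose l) :: real"
  have t: "?t (Suc l) = (real r - real l) * ?t l" for l
  proof (cases "l \<le> r")
    case True
    have "Suc l * (r choose Suc l) = (r - l) * (r choose l)"
      using binomial_absorb_comp[of r l] Suc_times_binomial_eq[of "r - 1" l]
      by (cases r) (auto simp: mult.commute)
    then have "real (Suc l) * real (r choose Suc l) = (real r - real l) * real (r choose l)"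
      using True by (metis of_nat_diff of_nat_mult)
    then have "fact l * (real (Suc l) * real (r choose Suc l)) = fact l * ((real r - real l) * real (r choose l))"
      by simp
    then show ?thesis
      by (simp add: mult_ac)
  qed (simp add: binomial_eq_0)
  have "pochhammer (\<alpha> + real r) (Suc p) = (\<alpha> + real r) * pochhammer (\<alpha> + 1 + real r) p"
    by (simp add: pochhammer_rec add_ac)
  also have "\<dots> = (\<Sum>l\<le>p. (\<alpha> + real r) * (real (p choose l) * ?t l * pochhammer (\<alpha> + 1 + real l) (p - l)))"
    by (simp add: Suc.IH sum_distrib_left)
  \<comment> \<open>The split \<alpha> + r = (\<alpha> + l) + (r - l): the first summand lengthens
    the rising factorial, the second the falling one. Pascal's rule then recombines the two
    sums.\<close>
  also have "\<dots> = (\<Sum>l\<le>p. real (p choose l) * ?t l * ((\<alpha> + real l) * pochhammer (\<alpha> + real l + 1) (p - l)))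
      + (\<Sum>l\<le>p. real (p choose l) * ((real r - real l) * ?t l) * pochhammer (\<alpha> + real l + 1) (p - l))"
    unfolding sum.distrib[symmetric] by (intro sum.cong refl) (simp add: algebra_simps)
  also have "(\<Sum>l\<le>p. real (p choose l) * ?t l * ((\<alpha> + real l) * pochhammer (\<alpha> + real l + 1) (p - l)))
      = (\<Sum>l\<le>Suc p. real (p choose l) * ?t l * pochhammer (\<alpha> + real l) (Suc p - l))"
    by (simp add: pochhammer_rec[symmetric] Suc_diff_le)
  also have "\<dots> = pochhammer \<alpha> (Suc p) + (\<Sum>l\<le>p. real (p choose Suc l) * ?t (Suc l) * pochhammer (\<alpha> + real (Suc l)) (p - l))"
    by (subst sum.atMost_Suc_shift) simp
  also have "(\<Sum>l\<le>p. real (p choose l) * ((real r - real l) * ?t l) * pochhammer (\<alpha> + real l + 1) (p - l)) =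
      (\<Sum>l\<le>p. real (p choose l) * ?t (Suc l) * pochhammer (\<alpha> + real (Suc l)) (p - l))"
    unfolding t by (simp add: add_ac)
  also have "pochhammer \<alpha> (Suc p) + (\<Sum>l\<le>p. real (p choose Suc l) * ?t (Suc l) * pochhammer (\<alpha> + real (Suc l)) (p - l)) + \<dots>
     = (\<Sum>l\<le>Suc p. real (Suc p choose l) * ?t l * pochhammer (\<alpha> + real l) (Suc p - l))"
    by (subst sum.atMost_Suc_shift) (simp add: sum.distrib[symmetric] algebra_simps)
  finally show ?case .
qed simp

text \<open>In classical terms this is p! exp(w) L_p(-w) with the Laguerre polynomial of parameter
  \<alpha> - 1, or equally (\<alpha>)_p 1F1(\<alpha> + p; \<alpha>; w); Kummer's transformation
  relates the two forms.\<close>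

definition laguerre_sum :: "real \<Rightarrow> nat \<Rightarrow> 'a::{real_normed_field,banach} \<Rightarrow> 'a" where
  "laguerre_sum \<alpha> p w =
    (\<Sum>l\<le>p. of_real (real (p choose l) * pochhammer (\<alpha> + real l) (p - l)) * (w ^ l * exp w))"

text \<open>The numbers \<open>pochhammer \<alpha> (p + r)\<close> are the moments of order p + r of
  a Gamma variable X of shape \<alpha>, so the series is the termwise expectation of X^p
  0F1(\<alpha>; w X). Vandermonde's identity brings it into closed form.\<close>

lemma laguerre_sum_sums:
  fixes w :: "'a::{real_normed_field,banach}"
  assumes "\<alpha> > 0"
  shows "(\<lambda>r. of_real (hyp_coeff \<alpha> r * pochhammer \<alpha> (p + r)) * w ^ r) sums laguerre_sum \<alpha> p w"
proof -
  have A: "(\<lambda>r. of_real (fact l * real (r choose l) / fact r) * w ^ r) sums (w ^ l * exp w)" for l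
  proof -
    have "(\<lambda>n. w ^ l * (w ^ n /\<^sub>R fact n)) sums (w ^ l * exp w)"
      by (intro sums_mult exp_converges)
    moreover have "w ^ l * (w ^ n /\<^sub>R fact n)
        = of_real (fact l * real (n + l choose l) / fact (n + l)) * w ^ (n + l)" for n
      by (simp add: binomial_fact scaleR_conv_of_real power_add field_simps)
    ultimately have "(\<lambda>n. of_real (fact l * real (n + l choose l) / fact (n + l)) * w ^ (n + l))
        sums (w ^ l * exp w)" by simp
    \<comment> \<open>The shift by l loses nothing: the terms with r < l vanish with the binomial
      coefficient.\<close>
    then show ?thesis
      by (subst (asm) sums_iff_shift) (simp add: binomial_eq_0)
  qed
  have "(\<lambda>r. \<Sum>l\<le>p. of_real (real (p choose l) * pochhammer (\<alpha> + real l) (p - l)) *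
      (of_real (fact l * real (r choose l) / fact r) * w ^ r)) sums laguerre_sum \<alpha> p w"
    unfolding laguerre_sum_def by (intro sums_sum sums_mult A)
  moreover have "(\<Sum>l\<le>p. of_real (real (p choose l) * pochhammer (\<alpha> + real l) (p - l)) *
      (of_real (fact l * real (r choose l) / fact r) * w ^ r))
      = of_real (hyp_coeff \<alpha> r * pochhammer \<alpha> (p + r)) * w ^ r" for r
  proof -
    have "hyp_coeff \<alpha> r * pochhammer \<alpha> (p + r) = pochhammer (\<alpha> + real r) p / fact r"
      using pochhammer_product'[of \<alpha> r p] pochhammer_pos[OF assms, of r]
      by (simp add: hyp_coeff_def add.commute)
    also have "\<dots> = (\<Sum>l\<le>p. (real (p choose l) * pochhammer (\<alpha> + real l) (p - l)) *
      (fact l * real (r choose l) / fact r))"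
      unfolding pochhammer_add_of_nat[of \<alpha> r p] sum_divide_distrib
      by (intro sum.cong refl) simp
    finally show ?thesis
      by (simp only: of_real_sum sum_distrib_right of_real_mult mult.assoc)
  qed
  ultimately show ?thesis by simp
qed

text \<open>The generating function of the Laguerre polynomials. It is the Cauchy product of the
  series of 0F1(\<alpha>; v w) and exp v, where (\<alpha>)_p = (\<alpha>)_l (\<alpha> + l)_(p - l)
  matches the coefficients.\<close>

lemma laguerre_generating_sums:
  fixes v w :: "'a::{real_normed_field,banach}"
  assumes "\<alpha> > 0"
  shows "(\<lambda>p. of_real (hyp_coeff \<alpha> p) * v ^ p * laguerre_sum \<alpha> p w) sums (exp (v + w) * hyp0F1 \<alpha> (v * w))"
proof -
  have "(\<lambda>p. \<Sum>l\<le>p. (of_real (hyp_coeff \<alpha> l) * (v * w) ^ l) * (v ^ (p - l) /\<^sub>R fact (p - l)))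
      sums ((\<Sum>n. of_real (hyp_coeff \<alpha> n) * (v * w) ^ n) * (\<Sum>n. v ^ n /\<^sub>R fact n))"
    by (intro Cauchy_product_sums summable_norm_hyp0F1 assms summable_norm_exp)
  then have "(\<lambda>p. (\<Sum>l\<le>p. (of_real (hyp_coeff \<alpha> l) * (v * w) ^ l) * (v ^ (p - l) /\<^sub>R fact (p - l))) * exp w)
      sums (hyp0F1 \<alpha> (v * w) * exp v * exp w)"
    unfolding hyp0F1_def fun_cong[OF exp_def, of v] by (intro sums_mult2)
  moreover have "(\<Sum>l\<le>p. (of_real (hyp_coeff \<alpha> l) * (v * w) ^ l) * (v ^ (p - l) /\<^sub>R fact (p - l))) * exp w
      = of_real (hyp_coeff \<alpha> p) * v ^ p * laguerre_sum \<alpha> p w" for p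
    unfolding laguerre_sum_def sum_distrib_left sum_distrib_right
  proof (intro sum.cong refl)
    fix l assume l: "l \<in> {..p}"
    have p: "pochhammer \<alpha> p = pochhammer \<alpha> l * pochhammer (\<alpha> + real l) (p - l)"
      using pochhammer_product[of l p \<alpha>] l by simp
    have "hyp_coeff \<alpha> l * (1 / fact (p - l)) = hyp_coeff \<alpha> p * (real (p choose l) * pochhammer (\<alpha> + real l) (p - l))"
      using l pochhammer_pos[OF assms, of l] pochhammer_pos[of "\<alpha> + real l" "p - l"] assms
      unfolding hyp_coeff_def p by (simp add: binomial_fact)
    then have c: "of_real (hyp_coeff \<alpha> l) * of_real (1 / fact (p - l)) =
       (of_real (hyp_coeff \<alpha> p) * of_real (real (p choose l) * pochhammer (\<alpha> + real l) (p - l)) :: 'a)"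
      by (simp only: of_real_mult[symmetric])
    have v: "v ^ p = v ^ l * v ^ (p - l)"
      using l by (simp flip: power_add)
    have "of_real (hyp_coeff \<alpha> l) * (v * w) ^ l * (v ^ (p - l) /\<^sub>R fact (p - l)) * exp w
       = (of_real (hyp_coeff \<alpha> l) * of_real (1 / fact (p - l))) * v ^ p * (w ^ l * exp w)"
      by (simp add: v scaleR_conv_of_real power_mult_distrib divide_inverse mult_ac)
    also have "\<dots> = of_real (hyp_coeff \<alpha> p) * v ^ p * (of_real (real (p choose l) * pochhammer (\<alpha> + real l) (p - l)) * (w ^ l * exp w))"
      unfolding c by (simp add: mult_ac)
    finally show "of_real (hyp_coeff \<alpha> l) * (v * w) ^ l * (v ^ (p - l) /\<^sub>R fact (p - l)) * exp w = \<dots>" .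
  qed
  ultimately show ?thesis
    by (simp add: exp_add mult_ac)
qed

text \<open>Termwise integration controlled by the integrals \<open>J\<close> of termwise majorants,
  not by a single dominating function. In the applications to 0F1, \<open>J\<close> comes from the
  exact formula for the real series at the norms, so its summability is already known.\<close>

lemma has_bochner_integral_sums:
  fixes f :: "nat \<Rightarrow> 'a \<Rightarrow> 'b::{banach,second_countable_topology}"
  assumes f: "\<And>i. has_bochner_integral M (f i) (I i)"
    and g: "\<And>i. has_bochner_integral M (g i) (J i)"
    and le: "\<And>i x. x \<in> space M \<Longrightarrow> norm (f i x) \<le> g i x"
    and J: "summable J"
    and abs: "\<And>x. x \<in> space M \<Longrightarrow> summable (\<lambda>i. norm (f i x))"
    and sums: "\<And>x. x \<in> space M \<Longrightarrow> (\<lambda>i. f i x) sums F x"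
    and I: "I sums S"
  shows "has_bochner_integral M F S"
proof -
  have int: "integrable M (f i)" for i
    using f by (auto simp: has_bochner_integral_iff)
  have le': "(\<integral>x. norm (f i x) \<partial>M) \<le> J i" for i
  proof -
    have "(\<integral>x. norm (f i x) \<partial>M) \<le> (\<integral>x. g i x \<partial>M)"
      using g[of i] f[of i] le by (intro integral_mono) (auto simp: has_bochner_integral_iff)
    then show ?thesis
      using g[of i] by (simp add: has_bochner_integral_iff)
  qed
  have sm: "summable (\<lambda>i. \<integral>x. norm (f i x) \<partial>M)"
    by (rule summable_comparison_test'[OF J, of 0]) (simp add: le')
  have ae: "AE x in M. summable (\<lambda>i. norm (f i x))"
    using abs by (intro AE_I2)
  have eq: "F x = (\<Sum>i. f i x)" if "x \<in> space M" for x
    using sums[OF that] by (simp add: sums_iff)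
  have "has_bochner_integral M (\<lambda>x. \<Sum>i. f i x) S"
    using integrable_suminf[OF int ae sm] sums_unique2[OF sums_integral[OF int ae sm]] I f
    by (auto simp: has_bochner_integral_iff)
  then show ?thesis
    using has_bochner_integral_cong[where M = M and g = "\<lambda>x. \<Sum>i. f i x", OF refl eq refl] by blast
qed

text \<open>The hypothesis says that \<open>X\<close> has, up to the constant \<open>C\<close>, the Gamma distribution of shape \<open>\<alpha>\<close>
  with respect to the weight \<open>g\<close>.\<close>

lemma has_bochner_integral_hyp0F1_mult:
  fixes a b :: "'b::{real_normed_field,banach,second_countable_topology}" and M :: "'a measure"
  assumes \<alpha>: "\<alpha> > 0"
    and mom: "\<And>k. has_bochner_integral M (\<lambda>x. g x * X x ^ k) (C * pochhammer \<alpha> k)"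
    and pos: "\<And>x. x \<in> space M \<Longrightarrow> 0 \<le> g x" "\<And>x. x \<in> space M \<Longrightarrow> 0 \<le> X x"
  shows "has_bochner_integral M (\<lambda>x. of_real (g x) * (hyp0F1 \<alpha> (a * of_real (X x)) * hyp0F1 \<alpha> (b * of_real (X x))))
    (of_real C * (exp (a + b) * hyp0F1 \<alpha> (a * b)))"
proof -
  \<comment> \<open>Only the factor with b is expanded here; the power X^p stands for a term of the
    other factor. The claim is polymorphic in the field of b so that its real instance at
    \<open>norm b\<close> can bound the second expansion.\<close>
  have 1: "has_bochner_integral M (\<lambda>x. of_real (g x * X x ^ p) * hyp0F1 \<alpha> (b * of_real (X x)))
       (of_real C * laguerre_sum \<alpha> p b)" for p and b :: "'c::{real_normed_field,banach,second_countable_topology}"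
  proof (rule has_bochner_integral_sums)
    let ?T = "\<lambda>r x. of_real (g x * X x ^ (p + r)) * (of_real (hyp_coeff \<alpha> r) * b ^ r)"
    show "has_bochner_integral M (\<lambda>x. ?T r x)
      (of_real (C * pochhammer \<alpha> (p + r)) * (of_real (hyp_coeff \<alpha> r) * b ^ r))" for r
      by (intro has_bochner_integral_mult_left has_bochner_integral_of_real mom)
    show "has_bochner_integral M (\<lambda>x. (g x * X x ^ (p + r)) * (hyp_coeff \<alpha> r * norm b ^ r))
      ((C * pochhammer \<alpha> (p + r)) * (hyp_coeff \<alpha> r * norm b ^ r))" for r
      by (intro has_bochner_integral_mult_left mom)
    show "norm (?T r x)
        \<le> (g x * X x ^ (p + r)) * (hyp_coeff \<alpha> r * norm b ^ r)" if "x \<in> space M" for x r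
      using pos[OF that] \<alpha> by (simp add: norm_mult norm_power)
    have "(\<lambda>r. C * (hyp_coeff \<alpha> r * pochhammer \<alpha> (p + r) * norm b ^ r)) sums (C * laguerre_sum \<alpha> p (norm b))"
      using laguerre_sum_sums[OF \<alpha>, of p "norm b"] by (intro sums_mult) simp
    then show "summable (\<lambda>r. (C * pochhammer \<alpha> (p + r)) * (hyp_coeff \<alpha> r * norm b ^ r))"
      by (auto dest: sums_summable simp: mult_ac)
    have "(\<lambda>r. of_real C * (of_real (hyp_coeff \<alpha> r * pochhammer \<alpha> (p + r)) * b ^ r)) sums (of_real C * laguerre_sum \<alpha> p b)"
      using laguerre_sum_sums[OF \<alpha>, of p b] by (intro sums_mult) simp
    then show "(\<lambda>r. of_real (C * pochhammer \<alpha> (p + r)) * (of_real (hyp_coeff \<alpha> r) * b ^ r)) sums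
      (of_real C * laguerre_sum \<alpha> p b)"
      by (simp add: mult_ac)
    fix x
    have eq: "?T r x =
        of_real (g x * X x ^ p) * (of_real (hyp_coeff \<alpha> r) * (b * of_real (X x)) ^ r)" for r
      by (simp add: power_add power_mult_distrib mult_ac)
    show "(\<lambda>r. ?T r x) sums (of_real (g x * X x ^ p) * hyp0F1 \<alpha> (b * of_real (X x)))"
      unfolding eq by (intro sums_mult hyp0F1_sums \<alpha>)
    show "summable (\<lambda>r. norm (?T r x))"
      unfolding eq norm_mult[of "of_real (g x * X x ^ p)"]
      by (intro summable_mult summable_norm_hyp0F1 \<alpha>)
  qed
  show ?thesis
  proof (rule has_bochner_integral_sums)
    let ?S = "\<lambda>p x. of_real (hyp_coeff \<alpha> p) * a ^ p * (of_real (g x * X x ^ p) * hyp0F1 \<alpha> (b * of_real (X x)))"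
    let ?N = "\<lambda>p x. (hyp_coeff \<alpha> p) * norm a ^ p * (of_real (g x * X x ^ p) * hyp0F1 \<alpha> (norm b * of_real (X x)))"
    show "has_bochner_integral M (\<lambda>x. ?S p x)
      (of_real (hyp_coeff \<alpha> p) * a ^ p * (of_real C * laguerre_sum \<alpha> p b))" for p
      by (intro has_bochner_integral_mult_right 1)
    show "has_bochner_integral M (\<lambda>x. ?N p x)
      ((hyp_coeff \<alpha> p) * norm a ^ p * (of_real C * laguerre_sum \<alpha> p (norm b)))" for p
      by (intro has_bochner_integral_mult_right 1)
    show "norm (?S p x) \<le> ?N p x"
      if "x \<in> space M" for x p
      using pos[OF that] \<alpha> norm_hyp0F1_le[OF \<alpha>, of "b * of_real (X x)"]
      by (auto simp: norm_mult norm_power intro!: mult_left_mono)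
    have "(\<lambda>p. C * (hyp_coeff \<alpha> p * norm a ^ p * laguerre_sum \<alpha> p (norm b))) sums
       (C * (exp (norm a + norm b) * hyp0F1 \<alpha> (norm a * norm b)))"
      using laguerre_generating_sums[OF \<alpha>, of "norm a" "norm b"] by (intro sums_mult) simp
    then show "summable (\<lambda>p. (hyp_coeff \<alpha> p) * norm a ^ p * (of_real C * laguerre_sum \<alpha> p (norm b)))"
      by (auto dest: sums_summable simp: mult_ac)
    have "(\<lambda>p. of_real C * (of_real (hyp_coeff \<alpha> p) * a ^ p * laguerre_sum \<alpha> p b)) sums
       (of_real C * (exp (a + b) * hyp0F1 \<alpha> (a * b)))"
      by (intro sums_mult laguerre_generating_sums \<alpha>)
    then show "(\<lambda>p. of_real (hyp_coeff \<alpha> p) * a ^ p * (of_real C * laguerre_sum \<alpha> p b)) sums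
       (of_real C * (exp (a + b) * hyp0F1 \<alpha> (a * b)))"
      by (simp add: mult_ac)
    fix x
    have eq: "?S p x
       = of_real (g x) * hyp0F1 \<alpha> (b * of_real (X x)) * (of_real (hyp_coeff \<alpha> p) * (a * of_real (X x)) ^ p)" for p
      by (simp add: power_mult_distrib mult_ac)
    have "(\<lambda>p. of_real (g x) * hyp0F1 \<alpha> (b * of_real (X x)) * (of_real (hyp_coeff \<alpha> p) * (a * of_real (X x)) ^ p)) sums
        (of_real (g x) * hyp0F1 \<alpha> (b * of_real (X x)) * hyp0F1 \<alpha> (a * of_real (X x)))"
      by (intro sums_mult hyp0F1_sums \<alpha>)
    then show "(\<lambda>p. ?S p x) sums
      (of_real (g x) * (hyp0F1 \<alpha> (a * of_real (X x)) * hyp0F1 \<alpha> (b * of_real (X x))))"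
      unfolding eq by (simp add: mult_ac)
    show "summable (\<lambda>p. norm (?S p x))"
      unfolding eq norm_mult[of "of_real (g x) * hyp0F1 \<alpha> (b * of_real (X x))"]
      by (intro summable_mult summable_norm_hyp0F1 \<alpha>)
  qed
qed

section \<open>Gaussian and Beta integrals\<close>

lemma nn_integral_even:
  fixes f :: "real \<Rightarrow> ennreal"
  assumes [measurable]: "f \<in> borel_measurable borel" and even: "\<And>x. f (- x) = f x"
  shows "(\<integral>\<^sup>+x. f x \<partial>lborel) = (\<integral>\<^sup>+x. 2 * f x * indicator {0..} x \<partial>lborel)"
proof -
  have ae: "AE x in lborel. x \<noteq> (0::real)"
    by (rule AE_lborel_singleton)
  have "(\<integral>\<^sup>+x. f x \<partial>lborel) = (\<integral>\<^sup>+x. f x * indicator {0..} x + f x * indicator {..0} x \<partial>lborel)"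
    using ae by (intro nn_integral_cong_AE) (auto split: split_indicator)
  also have "\<dots> = (\<integral>\<^sup>+x. f x * indicator {0..} x \<partial>lborel) + (\<integral>\<^sup>+x. f x * indicator {..0} x \<partial>lborel)"
    by (rule nn_integral_add) auto
  also have "(\<integral>\<^sup>+x. f x * indicator {..0} x \<partial>lborel) = (\<integral>\<^sup>+x. f x * indicator {0..} x \<partial>lborel)"
    by (subst nn_integral_real_affine[where c = "-1" and t = 0])
       (auto simp: even indicator_def intro!: nn_integral_cong)
  also have "(\<integral>\<^sup>+x. f x * indicator {0..} x \<partial>lborel) + (\<integral>\<^sup>+x. f x * indicator {0..} x \<partial>lborel)
     = (\<integral>\<^sup>+x. 2 * f x * indicator {0..} x \<partial>lborel)"
    by (subst nn_integral_add[symmetric]) (auto simp: mult_2 distrib_right)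
  finally show ?thesis .
qed

text \<open>The 2 from folding the line onto the half-line is the 2 in d(x^2) = 2 x dx, so no
  constant remains. The substitution is made on compact intervals exhausting the half-line, and
  monotone convergence gives the limit.\<close>

lemma nn_integral_square_substitution:
  fixes h :: "real \<Rightarrow> ennreal"
  assumes [measurable]: "h \<in> borel_measurable borel"
  shows "(\<integral>\<^sup>+x. h (x\<^sup>2) * ennreal \<bar>x\<bar> \<partial>lborel) = (\<integral>\<^sup>+u. h u * indicator {0..} u \<partial>lborel)"
proof -
  have sup_mono: "(\<integral>\<^sup>+x. g x * indicator {0..} x \<partial>lborel) = (SUP n. \<integral>\<^sup>+x. g x * indicator {0..r n} x \<partial>lborel)"
    if g: "g \<in> borel_measurable borel" and r: "incseq r" "filterlim r at_top sequentially"
    for g :: "real \<Rightarrow> ennreal" and r :: "nat \<Rightarrow> real"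
  proof -
    have "(\<integral>\<^sup>+x. g x * indicator {0..} x \<partial>lborel) = (\<integral>\<^sup>+x. (SUP n. g x * indicator {0..r n} x) \<partial>lborel)"
    proof (intro nn_integral_cong)
      fix x :: real
      show "g x * indicator {0..} x = (SUP n. g x * indicator {0..r n} x)"
      proof (cases "x \<ge> 0")
        case True
        obtain n where "x \<le> r n"
          using r(2) by (auto simp: filterlim_at_top eventually_sequentially)
        then have "g x \<le> (SUP n. g x * indicator {0..r n} x)"
          using True by (intro SUP_upper2[of n]) auto
        moreover have "(SUP n. g x * indicator {0..r n} x) \<le> g x"
          by (intro SUP_least) (auto split: split_indicator)
        ultimately show ?thesis using True by (auto intro: antisym)
      qed (auto simp: indicator_def)
    qed
    also have "\<dots> = (SUP n. \<integral>\<^sup>+x. g x * indicator {0..r n} x \<partial>lborel)"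
      using g r(1) by (intro nn_integral_monotone_convergence_SUP)
        (auto simp: incseq_def le_fun_def indicator_def intro: order_trans)
    finally show ?thesis .
  qed
  have Suc: "filterlim (\<lambda>n. real (Suc n)) at_top sequentially"
    by (rule filterlim_compose[OF filterlim_real_sequentially filterlim_Suc])
  have "(\<integral>\<^sup>+x. h (x\<^sup>2) * ennreal \<bar>x\<bar> \<partial>lborel) = (\<integral>\<^sup>+x. 2 * (h (x\<^sup>2) * ennreal \<bar>x\<bar>) * indicator {0..} x \<partial>lborel)"
    by (rule nn_integral_even) auto
  also have "\<dots> = (\<integral>\<^sup>+x. h (x\<^sup>2) * ennreal (2 * x) * indicator {0..} x \<partial>lborel)"
    by (intro nn_integral_cong) (auto simp: ennreal_mult mult_ac split: split_indicator)
  also have "\<dots> = (SUP n. \<integral>\<^sup>+x. h (x\<^sup>2) * ennreal (2 * x) * indicator {0..real (Suc n)} x \<partial>lborel)"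
    by (rule sup_mono[OF _ _ Suc]) (auto simp: incseq_def)
  also have "\<dots> = (SUP n. \<integral>\<^sup>+u. h u * indicator {0..(real (Suc n))\<^sup>2} u \<partial>lborel)"
  proof (intro SUP_cong refl)
    fix n
    show "(\<integral>\<^sup>+x. h (x\<^sup>2) * ennreal (2 * x) * indicator {0..real (Suc n)} x \<partial>lborel)
       = (\<integral>\<^sup>+u. h u * indicator {0..(real (Suc n))\<^sup>2} u \<partial>lborel)"
    proof -
      have "(\<integral>\<^sup>+u. h u * indicator {0\<^sup>2..(real (Suc n))\<^sup>2} u \<partial>lborel) =
          (\<integral>\<^sup>+x. h (x\<^sup>2) * ennreal (2 * x) * indicator {0..real (Suc n)} x \<partial>lborel)"
        by (rule nn_integral_substitution_aux) (auto intro!: derivative_eq_intros continuous_intros)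
      then show ?thesis by simp
    qed
  qed
  also have "\<dots> = (\<integral>\<^sup>+u. h u * indicator {0..} u \<partial>lborel)"
  proof (rule sup_mono[symmetric])
    show "incseq (\<lambda>n. (real (Suc n))\<^sup>2)"
      by (auto simp: incseq_def intro!: power_mono)
    show "filterlim (\<lambda>n. (real (Suc n))\<^sup>2) at_top sequentially"
      using Suc by (intro filterlim_pow_at_top) auto
  qed auto
  finally show ?thesis .
qed

lemma powr_square_mult_abs:
  fixes x :: real
  assumes "x \<noteq> 0"
  shows "(x\<^sup>2) powr a * \<bar>x\<bar> = \<bar>x\<bar> powr (2 * a + 1)"
proof -
  have "(x\<^sup>2) powr a = \<bar>x\<bar> powr (2 * a)"
  proof -
    have "x\<^sup>2 = \<bar>x\<bar> powr 2"
      using assms by (simp add: powr_numeral)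
    then show ?thesis by (metis powr_powr)
  qed
  then show ?thesis
    using assms by (simp add: powr_add)
qed

text \<open>With u = x^2 the weighted line becomes u^\<kappa> du on the half-line, and t = s u
  produces Euler's Gamma integral. The power of s collects s^(-\<kappa>) from the weight and 1/s
  from du.\<close>

lemma nn_integral_weighted_gaussian:
  fixes \<kappa> s :: real
  assumes "\<kappa> > - 1" "s > 0"
  shows "(\<integral>\<^sup>+x. ennreal (\<bar>x\<bar> powr (2 * \<kappa> + 1) * (exp (- s * x\<^sup>2) * (s * x\<^sup>2) ^ k)) \<partial>lborel)
    = ennreal (s powr (- \<kappa> - 1) * Gamma (\<kappa> + 1 + real k))"
proof -
  let ?G = "Gamma (\<kappa> + 1 + real k)"
  let ?g = "\<lambda>t. ennreal (indicator {0..} t * t powr ((\<kappa> + 1 + real k) - 1) / exp t)"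
  let ?h = "\<lambda>u. ennreal (u powr \<kappa> * (exp (- s * u) * (s * u) ^ k))"
  have "(\<integral>\<^sup>+x. ennreal (\<bar>x\<bar> powr (2 * \<kappa> + 1) * (exp (- s * x\<^sup>2) * (s * x\<^sup>2) ^ k)) \<partial>lborel)
     = (\<integral>\<^sup>+x. ?h (x\<^sup>2) * ennreal \<bar>x\<bar> \<partial>lborel)"
    using AE_lborel_singleton[of "0::real"]
  proof (intro nn_integral_cong_AE, eventually_elim)
    fix x :: real assume "x \<noteq> 0"
    then show "ennreal (\<bar>x\<bar> powr (2 * \<kappa> + 1) * (exp (- s * x\<^sup>2) * (s * x\<^sup>2) ^ k)) = ?h (x\<^sup>2) * ennreal \<bar>x\<bar>"
      using powr_square_mult_abs[of x \<kappa>, symmetric] assms by (simp add: ennreal_mult'[symmetric] mult_ac)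
  qed
  also have "\<dots> = (\<integral>\<^sup>+u. ?h u * indicator {0..} u \<partial>lborel)"
    by (rule nn_integral_square_substitution) auto
  also have "\<dots> = (\<integral>\<^sup>+u. ennreal (s powr (- \<kappa>)) * ?g (0 + s * u) \<partial>lborel)"
    using AE_lborel_singleton[of "0::real"]
  proof (intro nn_integral_cong_AE, eventually_elim)
    fix u :: real assume u0: "u \<noteq> 0"
    show "?h u * indicator {0..} u = ennreal (s powr (- \<kappa>)) * ?g (0 + s * u)"
    proof (cases "u > 0")
      case True
      then have "u powr \<kappa> * (exp (- s * u) * (s * u) ^ k)
          = s powr (- \<kappa>) * ((s * u) powr (\<kappa> + real k) / exp (s * u))"
        using assms by (simp add: powr_add powr_mult powr_realpow powr_minus exp_minus field_simps)
      then show ?thesis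
        using True assms by (simp add: ennreal_mult'[symmetric])
    next
      case False
      then show ?thesis using u0 assms by (auto simp: indicator_def zero_le_mult_iff)
    qed
  qed
  also have "\<dots> = ennreal (s powr (- \<kappa>)) * (\<integral>\<^sup>+u. ?g (0 + s * u) \<partial>lborel)"
    by (rule nn_integral_cmult) auto
  also have "ennreal s * (\<integral>\<^sup>+u. ?g (0 + s * u) \<partial>lborel) = ennreal ?G"
    using assms nn_integral_real_affine[of ?g s 0]
    by (subst Gamma_conv_nn_integral_real) auto
  then have "(\<integral>\<^sup>+u. ?g (0 + s * u) \<partial>lborel) = ennreal (?G / s)" (is "?I = _")
  proof -
    assume *: "ennreal s * ?I = ennreal ?G"
    have "?I = ennreal (1 / s) * (ennreal s * ?I)"
      using assms by (simp add: mult.assoc[symmetric] ennreal_mult'[symmetric])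
    also have "\<dots> = ennreal (?G / s)"
      unfolding * using assms by (simp add: ennreal_mult'[symmetric])
    finally show ?thesis .
  qed
  also have "ennreal (s powr (- \<kappa>)) * ennreal (?G / s) = ennreal (s powr (- \<kappa> - 1) * ?G)"
    using assms by (simp add: ennreal_mult'[symmetric] powr_diff)
  finally show ?thesis .
qed

text \<open>Under u = t^2 this is a Beta integral on [0, 1]; the bound on \<kappa> makes its second
  parameter \<kappa> + 1/2 positive.\<close>

lemma nn_integral_symmetric_beta:
  fixes \<kappa> :: real
  assumes "\<kappa> > - 1 / 2"
  shows "(\<integral>\<^sup>+t. ennreal (indicator {-1<..<1} t * ((1 - t\<^sup>2) powr (\<kappa> - 1 / 2) * t ^ (2 * n))) \<partial>lborel)
    = ennreal (Beta (1 / 2 + real n) (\<kappa> + 1 / 2))"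
proof -
  let ?h = "\<lambda>u. ennreal (indicator {0..1} u * (u powr (1 / 2 + real n - 1) * (1 - u) powr (\<kappa> + 1 / 2 - 1)))"
  have "(\<integral>\<^sup>+t. ennreal (indicator {-1<..<1} t * ((1 - t\<^sup>2) powr (\<kappa> - 1 / 2) * t ^ (2 * n))) \<partial>lborel)
      = (\<integral>\<^sup>+t. ?h (t\<^sup>2) * ennreal \<bar>t\<bar> \<partial>lborel)"
    using AE_lborel_singleton[of "0::real"] AE_lborel_singleton[of "1::real"] AE_lborel_singleton[of "-1::real"]
  proof (intro nn_integral_cong_AE, eventually_elim)
    fix t :: real assume t: "t \<noteq> 0" "t \<noteq> 1" "t \<noteq> -1"
    have 1: "t\<^sup>2 \<le> 1 \<longleftrightarrow> -1 < t \<and> t < 1"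
      using t by (auto simp: power2_le_iff_abs_le abs_square_le_1)
    have "(t\<^sup>2) powr (real n - 1 / 2) * \<bar>t\<bar> = t ^ (2 * n)"
    proof -
      have "\<bar>t\<bar> powr real (2 * n) = \<bar>t\<bar> ^ (2 * n)"
        using t by (intro powr_realpow) auto
      then show ?thesis
        using t powr_square_mult_abs[of t "real n - 1 / 2"] by (simp add: power_even_abs)
    qed
    then show "ennreal (indicator {-1<..<1} t * ((1 - t\<^sup>2) powr (\<kappa> - 1 / 2) * t ^ (2 * n))) = ?h (t\<^sup>2) * ennreal \<bar>t\<bar>"
      using 1 by (auto simp: ennreal_mult'[symmetric] indicator_def mult.assoc[symmetric])
  qed
  also have "\<dots> = (\<integral>\<^sup>+u. ?h u * indicator {0..} u \<partial>lborel)"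
    by (rule nn_integral_square_substitution) auto
  also have "\<dots> = (\<integral>\<^sup>+u. ?h u \<partial>lborel)"
    by (intro nn_integral_cong) (auto simp: indicator_def)
  also have "\<dots> = ennreal (Beta (1 / 2 + real n) (\<kappa> + 1 / 2))"
    using assms by (intro nn_integral_has_integral_lebesgue has_integral_Beta_real) auto
  finally show ?thesis .
qed

lemma has_bochner_integral_odd:
  fixes f :: "real \<Rightarrow> 'a::{banach,second_countable_topology}"
  assumes "integrable lborel f" "\<And>x. f (- x) = - f x"
  shows "has_bochner_integral lborel f 0"
proof -
  have "integral\<^sup>L lborel f = - integral\<^sup>L lborel f"
    using lborel_integral_real_affine[of "-1" f 0] assms(2) by simp
  then have "2 *\<^sub>R integral\<^sup>L lborel f = 0"
    by (metis add.right_inverse scaleR_2)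
  then show ?thesis
    using assms(1) by (simp add: has_bochner_integral_iff)
qed

lemma Beta_half_pos:
  assumes "\<kappa> > - 1 / (2::real)"
  shows "Beta (1 / 2) (\<kappa> + 1 / 2) > 0"
  using assms by (simp add: Beta_def Gamma_real_pos)

lemma Beta_quotient:
  assumes "\<kappa> > - 1 / (2::real)"
  shows "Beta (1 / 2 + real n) (\<kappa> + 1 / 2) / Beta (1 / 2) (\<kappa> + 1 / 2) = pochhammer (1 / 2) n / pochhammer (\<kappa> + 1) n"
proof -
  have "pochhammer (1 / 2) n = Gamma (1 / 2 + real n) / Gamma (1 / 2)"
    by (rule pochhammer_Gamma) auto
  moreover have "pochhammer (\<kappa> + 1) n = Gamma (\<kappa> + 1 + real n) / Gamma (\<kappa> + 1)"
    using assms by (intro pochhammer_Gamma) (auto elim!: nonpos_Ints_cases)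
  moreover have "Gamma (1 / 2 :: real) > 0" "Gamma (\<kappa> + 1) > 0" "Gamma (\<kappa> + 1 / 2) > 0" "Gamma (\<kappa> + 1 + real n) > 0"
    using assms by (auto intro!: Gamma_real_pos)
  moreover have "1 / 2 + real n + (\<kappa> + 1 / 2) = \<kappa> + 1 + real n" "1 / 2 + (\<kappa> + 1 / 2) = \<kappa> + 1"
    by auto
  ultimately show ?thesis
    by (simp add: Beta_def add_ac mult_ac)
qed

lemma sums_even_odd:
  fixes f g :: "nat \<Rightarrow> 'a::real_normed_vector"
  assumes "f sums x" "g sums y"
  shows "(\<lambda>n. if even n then f (n div 2) else g (n div 2)) sums (x + y)"
proof -
  have 1: "(\<lambda>n. if even n then f (n div 2) else 0) sums x"
    using assms(1) by (subst sums_mono_reindex[of "\<lambda>n. 2 * n", symmetric])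
      (auto simp: strict_mono_def image_iff elim!: evenE)
  have 2: "(\<lambda>n. if even n then 0 else g (n div 2)) sums y"
    using assms(2) by (subst sums_mono_reindex[of "\<lambda>n. Suc (2 * n)", symmetric])
      (auto simp: strict_mono_def image_iff elim!: oddE)
  show ?thesis
    using sums_add[OF 1 2] by (rule back_subst[of "\<lambda>f. f sums _"]) auto
qed

lemma pochhammer_half: "fact (2 * n) = 4 ^ n * fact n * pochhammer (1 / 2 :: real) n"
  by (simp add: fact_double power_mult)

lemma bessel_j_eq_hyp0F1:
  assumes "\<kappa> > - 1"
  shows "bessel_j \<kappa> (\<i> * z) = hyp0F1 (\<kappa> + 1) (z\<^sup>2 / 4)"
proof -
  let ?G = "complex_of_real (Gamma (\<kappa> + 1))"
  have G: "Gamma (\<kappa> + 1) > 0"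
    using assms by (simp add: Gamma_real_pos)
  have "(- 1) ^ n * (\<i> * z) ^ (2 * n) / of_real (fact n * 2 ^ (2 * n) * Gamma (real n + \<kappa> + 1))
     = of_real (hyp_coeff (\<kappa> + 1) n) * (z\<^sup>2 / 4) ^ n / ?G" for n
  proof -
    have "pochhammer (\<kappa> + 1) n = Gamma (\<kappa> + 1 + real n) / Gamma (\<kappa> + 1)"
      using assms by (intro pochhammer_Gamma) (auto elim!: nonpos_Ints_cases)
    moreover have "Gamma (\<kappa> + 1 + real n) > 0"
      using assms by (auto intro!: Gamma_real_pos)
    ultimately have c: "hyp_coeff (\<kappa> + 1) n = Gamma (\<kappa> + 1) / (fact n * Gamma (real n + \<kappa> + 1))"
      using G by (simp add: hyp_coeff_def add_ac)
    have "- (\<i> * z)\<^sup>2 = z\<^sup>2"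
      by (simp add: power_mult_distrib)
    then have "(- 1) ^ n * (\<i> * z) ^ (2 * n) = (z\<^sup>2) ^ n"
      by (simp add: power_mult flip: power_mult_distrib)
    moreover have "(2 :: complex) ^ (2 * n) = 4 ^ n"
      by (simp add: power_mult)
    ultimately show ?thesis
      using G by (simp add: c power_divide mult_ac)
  qed
  then show ?thesis
    unfolding bessel_j_def hyp0F1_def
    using summable_norm_cancel[OF summable_norm_hyp0F1[of "\<kappa> + 1" "z\<^sup>2 / 4"]] assms G
    by (simp add: suminf_divide less_imp_neq[OF G, symmetric])
qed

section \<open>Uniqueness for Laplace transforms\<close>

text \<open>In v = exp(-u) the exponential sums are polynomials without constant term. Approximating
  \<phi>(-ln v) / v rather than \<phi>(-ln v) makes the exponents start at 1 and leaves a factor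
  exp(-u) in the error, which stays integrable even if the measure is infinite.\<close>

lemma laplace_approx:
  fixes \<phi> :: "real \<Rightarrow> real"
  assumes cont: "continuous_on UNIV \<phi>" and zero: "\<And>u. u \<ge> b \<Longrightarrow> \<phi> u = 0" and e: "e > 0"
  obtains a :: "nat \<Rightarrow> real" and n where
    "\<And>u. u \<ge> 0 \<Longrightarrow> \<bar>\<phi> u - (\<Sum>i\<le>n. a i * exp (- real (Suc i) * u))\<bar> \<le> e * exp (- u)"
proof -
  \<comment> \<open>Clamping v at exp(-b) removes the singularity at v = 0. The values change
    nowhere, since \<phi>(u) = 0 for u \<ge> b.\<close>
  define \<psi> where "\<psi> v = \<phi> (- ln (max v (exp (- b)))) / max v (exp (- b))" for v
  have "continuous_on {0..1} \<psi>"
    unfolding \<psi>_def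
    by (intro continuous_intros continuous_on_compose2[OF cont])
       (auto simp: max_def intro: order.strict_trans2[OF exp_gt_zero] less_imp_neq[symmetric])
  then obtain P where P: "real_polynomial_function P" "\<And>v. v \<in> {0..1} \<Longrightarrow> \<bar>\<psi> v - P v\<bar> < e"
    using Stone_Weierstrass_real_polynomial_function[of "{0..1}" \<psi> e] e by auto
  then obtain a n where P_eq: "P = (\<lambda>x. \<Sum>i\<le>n. a i * x ^ i)"
    by (auto simp: real_polynomial_function_iff_sum)
  have "\<bar>\<phi> u - (\<Sum>i\<le>n. a i * exp (- real (Suc i) * u))\<bar> \<le> e * exp (- u)" if "u \<ge> 0" for u
  proof -
    have \<phi>: "\<phi> u = exp (- u) * \<psi> (exp (- u))"
      using zero[of u] zero[of b] by (cases "u \<ge> b") (auto simp: \<psi>_def max_def)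
    have "(\<Sum>i\<le>n. a i * exp (- real (Suc i) * u)) = exp (- u) * P (exp (- u))"
      unfolding P_eq sum_distrib_left
      by (intro sum.cong refl) (simp add: exp_of_nat_mult[symmetric] exp_add[symmetric] algebra_simps)
    then have "\<bar>\<phi> u - (\<Sum>i\<le>n. a i * exp (- real (Suc i) * u))\<bar> = exp (- u) * \<bar>\<psi> (exp (- u)) - P (exp (- u))\<bar>"
      unfolding \<phi> by (simp add: right_diff_distrib[symmetric] abs_mult)
    also have "\<dots> \<le> exp (- u) * e"
      using P(2)[of "exp (- u)"] that by (intro mult_left_mono) auto
    finally show ?thesis by (simp add: mult.commute)
  qed
  then show ?thesis by (rule that)
qed

lemma integrable_laplace_test:
  fixes \<phi> :: "real \<Rightarrow> real" and w :: "'a \<Rightarrow> 'b::{banach,second_countable_topology}"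
  assumes cont: "continuous_on UNIV \<phi>" and zero: "\<And>u. u \<ge> b \<Longrightarrow> \<phi> u = 0"
    and [measurable]: "u \<in> borel_measurable M" "w \<in> borel_measurable M" and u: "AE x in M. u x \<ge> 0"
    and int: "integrable M (\<lambda>x. exp (- u x) *\<^sub>R w x)"
  shows "integrable M (\<lambda>x. \<phi> (u x) *\<^sub>R w x)"
proof -
  have [measurable]: "\<phi> \<in> borel_measurable borel"
    using cont by (rule borel_measurable_continuous_onI)
  have "compact (\<phi> ` {0..b})"
    by (intro compact_continuous_image continuous_on_subset[OF cont]) auto
  then obtain B where B: "\<And>u. u \<in> {0..b} \<Longrightarrow> \<bar>\<phi> u\<bar> \<le> B"
    by (force dest: compact_imp_bounded simp: bounded_iff)
  show ?thesis
  proof (rule Bochner_Integration.integrable_bound)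
    show "integrable M (\<lambda>x. (\<bar>B\<bar> * exp b) *\<^sub>R (exp (- u x) *\<^sub>R w x))"
      by (intro integrable_scaleR_right int)
    show "AE x in M. norm (\<phi> (u x) *\<^sub>R w x) \<le> norm ((\<bar>B\<bar> * exp b) *\<^sub>R (exp (- u x) *\<^sub>R w x))"
      using u
    proof eventually_elim
      fix x assume u: "u x \<ge> 0"
      have "\<bar>\<phi> (u x)\<bar> \<le> \<bar>B\<bar> * exp (b - u x)"
      proof (cases "u x \<le> b")
        case True
        then have "\<bar>\<phi> (u x)\<bar> \<le> \<bar>B\<bar> * 1" using B[of "u x"] u by auto
        also have "\<dots> \<le> \<bar>B\<bar> * exp (b - u x)" using True by (intro mult_left_mono) auto
        finally show ?thesis .
      qed (use zero[of "u x"] in simp)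
      then show "norm (\<phi> (u x) *\<^sub>R w x) \<le> norm ((\<bar>B\<bar> * exp b) *\<^sub>R (exp (- u x) *\<^sub>R w x))"
        using mult_right_mono[of "\<bar>\<phi> (u x)\<bar>" "\<bar>B\<bar> * exp (b - u x)" "norm (w x)"]
        by (simp add: exp_diff exp_minus divide_inverse mult_ac abs_mult)
    qed
  qed auto
qed

lemma integral_laplace_approx:
  fixes \<phi> :: "real \<Rightarrow> real" and w :: "'a \<Rightarrow> 'b::{banach,second_countable_topology}"
  assumes int: "integrable M (\<lambda>x. exp (- u x) *\<^sub>R w x)" and int\<phi>: "integrable M (\<lambda>x. \<phi> (u x) *\<^sub>R w x)"
    and [measurable]: "u \<in> borel_measurable M" "w \<in> borel_measurable M" and u: "AE x in M. u x \<ge> 0"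
    and approx: "\<And>u. u \<ge> 0 \<Longrightarrow> \<bar>\<phi> u - (\<Sum>i\<le>n. a i * exp (- real (Suc i) * u))\<bar> \<le> e * exp (- u)"
  shows "norm ((\<integral>x. \<phi> (u x) *\<^sub>R w x \<partial>M) - (\<Sum>i\<le>n. a i *\<^sub>R (\<integral>x. exp (- real (Suc i) * u x) *\<^sub>R w x \<partial>M)))
    \<le> e * (\<integral>x. norm (exp (- u x) *\<^sub>R w x) \<partial>M)"
proof -
  let ?E = "\<lambda>i x. exp (- real (Suc i) * u x) *\<^sub>R w x"
  let ?R = "\<lambda>x. \<phi> (u x) *\<^sub>R w x - (\<Sum>i\<le>n. a i *\<^sub>R (exp (- real (Suc i) * u x) *\<^sub>R w x))"
  let ?N = "\<lambda>x. norm (exp (- u x) *\<^sub>R w x)"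
  \<comment> \<open>All exponents are at least 1, so integrability against exp(-u) covers every term
    of the sum.\<close>
  have inti: "integrable M (\<lambda>x. ?E i x)" for i
  proof (rule Bochner_Integration.integrable_bound[OF int])
    have "exp (- real (Suc i) * u x) \<le> exp (- u x)" if "u x \<ge> 0" for x
      using that by (simp add: algebra_simps)
    then show "AE x in M. norm (?E i x) \<le> ?N x"
      using u by (auto elim!: eventually_mono intro!: mult_right_mono)
  qed auto
  have sumi: "integrable M (\<lambda>x. \<Sum>i\<le>n. a i *\<^sub>R (?E i x))"
    by (intro Bochner_Integration.integrable_sum integrable_scaleR_right inti)
  have "(\<integral>x. \<phi> (u x) *\<^sub>R w x \<partial>M) - (\<Sum>i\<le>n. a i *\<^sub>R (\<integral>x. ?E i x \<partial>M)) = (\<integral>x. ?R x \<partial>M)"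
    by (subst Bochner_Integration.integral_diff[OF int\<phi> sumi])
       (simp only: Bochner_Integration.integral_sum[OF integrable_scaleR_right[OF inti]] integral_scaleR_right)
  also have "norm \<dots> \<le> (\<integral>x. e * ?N x \<partial>M)"
  proof (rule order_trans[OF integral_norm_bound integral_mono_AE[OF integrable_norm]])
    show "integrable M (\<lambda>x. ?R x)"
      by (rule Bochner_Integration.integrable_diff[OF int\<phi> sumi])
    show "integrable M (\<lambda>x. e * ?N x)"
      using int by (intro integrable_mult_right integrable_norm)
    have *: "?R x = (\<phi> (u x) - (\<Sum>i\<le>n. a i * exp (- real (Suc i) * u x))) *\<^sub>R w x" for x
      by (simp only: scaleR_diff_left scaleR_sum_left scaleR_scaleR)
    show "AE x in M. norm (?R x) \<le> e * ?N x"
      using u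
    proof eventually_elim
      fix x assume "u x \<ge> 0"
      then show "norm (?R x) \<le> e * ?N x"
        unfolding * using mult_right_mono[OF approx[of "u x"], of "norm (w x)"] by (simp add: mult_ac)
    qed
  qed
  finally show ?thesis by simp
qed

text \<open>In the variable \<open>v = exp (- u)\<close> the hypothesis is that all moments agree on \<open>[0, 1]\<close>, so the
  Weierstrass theorem applies.\<close>

proposition laplace_transform_unique:
  fixes \<phi> :: "real \<Rightarrow> real" and w :: "'a \<Rightarrow> 'b::{banach,second_countable_topology}"
    and w' :: "'c \<Rightarrow> 'b"
  assumes cont: "continuous_on UNIV \<phi>" and zero: "\<And>u. u \<ge> b \<Longrightarrow> \<phi> u = 0"
    and M: "u \<in> borel_measurable M" "w \<in> borel_measurable M" "AE x in M. u x \<ge> 0"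
       "integrable M (\<lambda>x. exp (- u x) *\<^sub>R w x)"
    and N: "u' \<in> borel_measurable N" "w' \<in> borel_measurable N" "AE x in N. u' x \<ge> 0"
       "integrable N (\<lambda>x. exp (- u' x) *\<^sub>R w' x)"
    and eq: "\<And>n::nat. n > 0 \<Longrightarrow> (\<integral>x. exp (- real n * u x) *\<^sub>R w x \<partial>M) = (\<integral>x. exp (- real n * u' x) *\<^sub>R w' x \<partial>N)"
  shows "(\<integral>x. \<phi> (u x) *\<^sub>R w x \<partial>M) = (\<integral>x. \<phi> (u' x) *\<^sub>R w' x \<partial>N)"
proof -
  let ?I = "\<integral>x. \<phi> (u x) *\<^sub>R w x \<partial>M" and ?J = "\<integral>x. \<phi> (u' x) *\<^sub>R w' x \<partial>N"
  let ?C = "(\<integral>x. norm (exp (- u x) *\<^sub>R w x) \<partial>M) + (\<integral>x. norm (exp (- u' x) *\<^sub>R w' x) \<partial>N)"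
  have C: "?C \<ge> 0" by simp
  have le: "norm (?I - ?J) \<le> e * ?C" if e: "e > 0" for e
  proof -
    obtain a :: "nat \<Rightarrow> real" and n where
      approx: "\<And>u. u \<ge> 0 \<Longrightarrow> \<bar>\<phi> u - (\<Sum>i\<le>n. a i * exp (- real (Suc i) * u))\<bar> \<le> e * exp (- u)"
      using laplace_approx[of \<phi> b e, OF cont zero e] by blast
    have eq': "(\<Sum>i\<le>n. a i *\<^sub>R (\<integral>x. exp (- real (Suc i) * u x) *\<^sub>R w x \<partial>M)) =
        (\<Sum>i\<le>n. a i *\<^sub>R (\<integral>x. exp (- real (Suc i) * u' x) *\<^sub>R w' x \<partial>N))" (is "?S = ?T")
      by (intro sum.cong refl arg_cong2[of _ _ _ _ "(*\<^sub>R)"] eq) simp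
    have "norm (?I - ?S) \<le> e * (\<integral>x. norm (exp (- u x) *\<^sub>R w x) \<partial>M)"
      by (intro integral_laplace_approx integrable_laplace_test[OF cont zero] M approx)
    moreover have "norm (?J - ?T) \<le> e * (\<integral>x. norm (exp (- u' x) *\<^sub>R w' x) \<partial>N)"
      by (intro integral_laplace_approx integrable_laplace_test[OF cont zero] N approx)
    ultimately have "norm (?I - ?S) + norm (?J - ?T) \<le> e * ?C"
      by (simp add: distrib_left)
    moreover have "norm (?I - ?J) \<le> norm (?I - ?S) + norm (?J - ?T)"
      unfolding eq' using norm_triangle_ineq4[of "?I - ?T" "?J - ?T"] by simp
    ultimately show ?thesis by linarith
  qed
  have "norm (?I - ?J) \<le> 0"
  proof (rule field_le_epsilon)
    fix e :: real assume e: "e > 0"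
    \<comment> \<open>The summand 1 keeps the denominator positive when \<open>?C\<close> is
      0.\<close>
    have "norm (?I - ?J) \<le> e / (?C + 1) * ?C"
      using C e by (intro le divide_pos_pos) linarith+
    also have "e / (c + 1) * c \<le> e" if "c \<ge> 0" for c
      using e that by (simp add: field_simps)
    from this[OF C] have "e / (?C + 1) * ?C \<le> e" .
    finally show "norm (?I - ?J) \<le> 0 + e" by simp
  qed
  then show ?thesis by simp
qed

text \<open>Continuous ramps, constant 1 at distance more than 1/k below b and 0 from b on, increase
  to the indicator of the open half-line, and exp(b - u) dominates them all. Two unrelated measure
  spaces are allowed because the result later compares a product measure with one of its
  factors.\<close>

lemma laplace_transform_unique_indicator:
  fixes w :: "'a \<Rightarrow> 'b::{banach,second_countable_topology}" and w' :: "'c \<Rightarrow> 'b"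
  assumes M: "u \<in> borel_measurable M" "w \<in> borel_measurable M" "AE x in M. u x \<ge> 0"
       "integrable M (\<lambda>x. exp (- u x) *\<^sub>R w x)"
    and N: "u' \<in> borel_measurable N" "w' \<in> borel_measurable N" "AE x in N. u' x \<ge> 0"
       "integrable N (\<lambda>x. exp (- u' x) *\<^sub>R w' x)"
    and eq: "\<And>n::nat. n > 0 \<Longrightarrow> (\<integral>x. exp (- real n * u x) *\<^sub>R w x \<partial>M) = (\<integral>x. exp (- real n * u' x) *\<^sub>R w' x \<partial>N)"
  shows "(\<integral>x. indicator {..<b} (u x) *\<^sub>R w x \<partial>M) = (\<integral>x. indicator {..<b} (u' x) *\<^sub>R w' x \<partial>N)"
proof -
  define \<phi> :: "nat \<Rightarrow> real \<Rightarrow> real" where "\<phi> k v = max 0 (min 1 (real k * (b - v)))" for k v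
  have cont: "continuous_on UNIV (\<phi> k)" for k
    unfolding \<phi>_def by (intro continuous_intros)
  have zero: "\<phi> k v = 0" if "v \<ge> b" for k v
    using mult_nonneg_nonpos[of "real k" "b - v"] that by (auto simp: \<phi>_def max_def min_def)
  have lim\<phi>: "(\<lambda>k. \<phi> k v) \<longlonglongrightarrow> indicator {..<b} v" for v
  proof (cases "v < b")
    case True
    obtain k0 where "1 / (b - v) < real k0"
      using reals_Archimedean2 by blast
    then have "1 \<le> real k * (b - v)" if "k \<ge> k0" for k
    proof -
      have "1 / (b - v) \<le> real k"
        using \<open>1 / (b - v) < real k0\<close> that by linarith
      then show ?thesis using True by (simp add: field_simps)
    qed
    then have "\<phi> k v = 1" if "k \<ge> k0" for k
      using that by (auto simp: \<phi>_def)
    then have "eventually (\<lambda>k. \<phi> k v = 1) sequentially"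
      by (auto simp: eventually_sequentially)
    then show ?thesis
      using True by (simp add: tendsto_eventually)
  qed (simp add: zero)
  have lim: "(\<lambda>k. \<integral>x. \<phi> k (u x) *\<^sub>R w x \<partial>M) \<longlonglongrightarrow> (\<integral>x. indicator {..<b} (u x) *\<^sub>R w x \<partial>M)"
    if [measurable]: "u \<in> borel_measurable M" "w \<in> borel_measurable M"
      and int: "integrable M (\<lambda>x. exp (- u x) *\<^sub>R w x)"
    for M :: "'d measure" and u and w :: "'d \<Rightarrow> 'b"
  proof (rule integral_dominated_convergence[where w = "\<lambda>x. exp b * norm (exp (- u x) *\<^sub>R w x)"])
    have [measurable]: "\<phi> k \<in> borel_measurable borel" for k
      using cont by (rule borel_measurable_continuous_onI)
    show "(\<lambda>x. \<phi> k (u x) *\<^sub>R w x) \<in> borel_measurable M" for k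
      by measurable
    show "AE x in M. (\<lambda>k. \<phi> k (u x) *\<^sub>R w x) \<longlonglongrightarrow> indicator {..<b} (u x) *\<^sub>R w x"
      by (intro AE_I2 tendsto_scaleR lim\<phi> tendsto_const)
    show "integrable M (\<lambda>x. exp b * norm (exp (- u x) *\<^sub>R w x))"
      using int by (intro integrable_mult_right integrable_norm)
    show "AE x in M. norm (\<phi> k (u x) *\<^sub>R w x) \<le> exp b * norm (exp (- u x) *\<^sub>R w x)" for k
    proof (intro AE_I2)
      fix x
      have "\<bar>\<phi> k (u x)\<bar> \<le> exp (b - u x)"
      proof (cases "u x < b")
        case True
        have "\<bar>\<phi> k (u x)\<bar> \<le> 1" by (auto simp: \<phi>_def)
        also have "1 \<le> exp (b - u x)" using True by simp
        finally show ?thesis .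
      qed (simp add: zero)
      then show "norm (\<phi> k (u x) *\<^sub>R w x) \<le> exp b * norm (exp (- u x) *\<^sub>R w x)"
        using mult_right_mono[of "\<bar>\<phi> k (u x)\<bar>" "exp (b - u x)" "norm (w x)"]
        by (simp add: exp_diff exp_minus divide_inverse mult_ac)
    qed
  qed measurable
  have "(\<integral>x. \<phi> k (u x) *\<^sub>R w x \<partial>M) = (\<integral>x. \<phi> k (u' x) *\<^sub>R w' x \<partial>N)" for k
    by (rule laplace_transform_unique[OF cont zero M N eq])
  then show ?thesis
    using lim[OF M(1,2,4)] lim[OF N(1,2,4)] LIMSEQ_unique by simp
qed

section \<open>Measurability and integrability\<close>

lemma sigma_finite_lebesgue: "sigma_finite_measure (lebesgue :: 'a::euclidean_space measure)"
proof
  obtain A :: "'a set set" where A: "countable A" "A \<subseteq> sets lborel" "\<Union>A = space lborel" "\<forall>a\<in>A. emeasure lborel a \<noteq> \<infinity>"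
    using lborel.sigma_finite_countable by blast
  then show "\<exists>A. countable A \<and> A \<subseteq> sets lebesgue \<and> \<Union> A = space lebesgue \<and> (\<forall>a\<in>A. emeasure (lebesgue :: 'a measure) a \<noteq> \<infinity>)"
    by (intro exI[of _ A]) (auto simp: emeasure_completion main_part_sets)
qed

text \<open>The weighted measure lives on the completed sigma-algebra, so joint measurability on
  products is obtained for Borel functions and pulled back along the identity maps.\<close>

lemma measurable_pair_borelI:
  assumes M: "(\<lambda>x. x) \<in> measurable M borel" and N: "(\<lambda>x. x) \<in> measurable N borel"
    and f: "f \<in> measurable (borel \<Otimes>\<^sub>M borel) L"
  shows "f \<in> measurable (M \<Otimes>\<^sub>M N) L"
proof -
  have "(\<lambda>z. (fst z, snd z)) \<in> measurable (M \<Otimes>\<^sub>M N) (borel \<Otimes>\<^sub>M borel)"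
    by (intro measurable_Pair measurable_compose[OF measurable_fst M] measurable_compose[OF measurable_snd N])
  from measurable_compose[OF this f] show ?thesis by simp
qed

lemma
  assumes h: "(\<lambda>(x, y). h x y) \<in> measurable (M \<Otimes>\<^sub>M N) L"
  shows measurable_section1: "x \<in> space M \<Longrightarrow> h x \<in> measurable N L"
    and measurable_section2: "y \<in> space N \<Longrightarrow> (\<lambda>x. h x y) \<in> measurable M L"
  using measurable_compose[OF measurable_Pair1' h] measurable_compose[OF measurable_Pair2' h] by simp_all

text \<open>The essential supremum is at most c exactly when the set where H exceeds c is null, and
  the measure of that set depends measurably on the parameter by Tonelli.\<close>

lemma measurable_esssup:
  fixes H :: "'a \<Rightarrow> 'b \<Rightarrow> ennreal"
  assumes "sigma_finite_measure M" and H: "(\<lambda>(y, x). H y x) \<in> borel_measurable (N \<Otimes>\<^sub>M M)"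
  shows "(\<lambda>y. esssup M (H y)) \<in> borel_measurable N"
proof (rule borel_measurableI_le)
  interpret sigma_finite_measure M by fact
  fix c :: ennreal
  note Hy = measurable_section1[OF H]
  have "esssup M (H y) \<le> c \<longleftrightarrow> (\<integral>\<^sup>+x. indicator {c<..} (H y x) \<partial>M) = 0" if y: "y \<in> space N" for y
  proof -
    have "esssup M (H y) \<le> c \<longleftrightarrow> (AE x in M. H y x \<le> c)"
      using esssup_I[OF Hy[OF y]] esssup_AE[where M = M and f = "H y"] by (auto elim!: eventually_mono)
    also have "\<dots> \<longleftrightarrow> (AE x in M. indicator {c<..} (H y x) = (0 :: ennreal))"
      by (simp add: indicator_def not_less)
    also have "\<dots> \<longleftrightarrow> (\<integral>\<^sup>+x. indicator {c<..} (H y x) \<partial>M) = 0"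
      using Hy[OF y] by (subst nn_integral_0_iff_AE) auto
    finally show ?thesis .
  qed
  then have "{y \<in> space N. esssup M (H y) \<le> c} = {y \<in> space N. (\<integral>\<^sup>+x. indicator {c<..} (H y x) \<partial>M) = 0}"
    by auto
  also have "\<dots> \<in> sets N"
  proof -
    have "(\<lambda>(y, x). indicator {c<..} (H y x) :: ennreal) \<in> borel_measurable (N \<Otimes>\<^sub>M M)"
      using H unfolding case_prod_unfold by measurable
    then have [measurable]: "(\<lambda>y. \<integral>\<^sup>+x. indicator {c<..} (H y x) \<partial>M) \<in> borel_measurable N"
      by (rule borel_measurable_nn_integral)
    show ?thesis by measurable
  qed
  finally show "{y \<in> space N. esssup M (H y) \<le> c} \<in> sets N" .
qed

section \<open>Square integrable functions\<close>

lemma ennreal_powr_eq_power: "x \<noteq> \<infinity> \<Longrightarrow> ennreal_powr x 2 = x ^ 2"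
  by (cases x) (auto simp: ennreal_powr_def ennreal_power powr_numeral)

lemma ennreal_powr_half_power: "(ennreal_powr x (1 / 2)) ^ 2 = x"
  by (cases x) (auto simp: ennreal_powr_def ennreal_power powr_half_sqrt top_power_ennreal)

lemma ennreal_power2_less_top_iff: "(x :: ennreal) ^ 2 < \<infinity> \<longleftrightarrow> x < \<infinity>"
  by (cases x) (auto simp: ennreal_power top_power_ennreal)

lemma ennreal_power2_le_imp_le:
  fixes x y :: ennreal
  assumes "x ^ 2 \<le> y ^ 2"
  shows "x \<le> y"
  using assms
  by (cases x; cases y) (auto simp: ennreal_power top_power_ennreal top_unique power_mono_iff)

lemma Lp_norm_2_power2: "(Lp_norm M 2 f) ^ 2 = (\<integral>\<^sup>+x. ennreal (norm (f x)) ^ 2 \<partial>M)"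
proof -
  have 1: "real_of_ereal (1 / 2) = 1 / 2" "real_of_ereal 2 = 2" "(2 :: ereal) = \<infinity> \<longleftrightarrow> False"
    by (simp_all add: one_ereal_def)
  have 2: "ennreal_powr (ennreal (norm (f x))) 2 = ennreal (norm (f x)) ^ 2" for x
    by (rule ennreal_powr_eq_power) simp
  show ?thesis
    unfolding Lp_norm_def Lp_norm_nonneg_def 1 2 if_False ennreal_powr_half_power ..
qed

lemma Lp_space_2_iff:
  "f \<in> Lp_space M 2 \<longleftrightarrow> f \<in> borel_measurable M \<and> (\<integral>\<^sup>+x. ennreal (norm (f x)) ^ 2 \<partial>M) < \<infinity>"
  unfolding Lp_space_def Lp_norm_2_power2[symmetric] ennreal_power2_less_top_iff by simp

lemma Lp_space_1_iff: "f \<in> Lp_space M 1 \<longleftrightarrow> integrable M f"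
proof -
  have "ennreal_powr x 1 = x" for x
    by (cases x) (auto simp: ennreal_powr_def)
  moreover have "real_of_ereal (1 / 1) = 1" "(1::ereal) / 1 = 1"
    by (simp_all add: divide_ereal_def one_ereal_def)
  ultimately show ?thesis
    by (simp add: Lp_space_def Lp_norm_def Lp_norm_nonneg_def integrable_iff_bounded)
qed

lemma L2_mult:
  fixes f g :: "'a \<Rightarrow> complex"
  assumes [measurable]: "f \<in> borel_measurable M" "g \<in> borel_measurable M"
  shows "(\<integral>\<^sup>+x. ennreal (norm (f x * g x)) \<partial>M) ^ 2
    \<le> (\<integral>\<^sup>+x. ennreal (norm (f x)) ^ 2 \<partial>M) * (\<integral>\<^sup>+x. ennreal (norm (g x)) ^ 2 \<partial>M)"
  unfolding norm_mult ennreal_mult[OF norm_ge_zero norm_ge_zero]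
  by (rule Cauchy_Schwarz_nn_integral) auto

lemma integrable_L2_mult:
  assumes f: "f \<in> Lp_space M 2" and g: "g \<in> Lp_space M 2"
  shows "integrable M (\<lambda>x. f x * g x)"
proof -
  have "(\<integral>\<^sup>+x. ennreal (norm (f x * g x)) \<partial>M) ^ 2 < \<infinity>"
    using L2_mult[of f M g] f g unfolding Lp_space_2_iff
    by (auto simp: ennreal_mult_less_top elim!: le_less_trans)
  then show ?thesis
    using f g unfolding integrable_iff_bounded Lp_space_2_iff ennreal_power2_less_top_iff by auto
qed

lemma Lp_space_2_diff:
  assumes f: "f \<in> Lp_space M 2" and g: "g \<in> Lp_space M 2"
  shows "(\<lambda>x. f x - g x) \<in> Lp_space M 2"
proof -
  have [measurable]: "f \<in> borel_measurable M" "g \<in> borel_measurable M"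
    using f g unfolding Lp_space_2_iff by auto
  have "ennreal (norm (f x - g x)) ^ 2 \<le> 2 * ennreal (norm (f x)) ^ 2 + 2 * ennreal (norm (g x)) ^ 2" for x
  proof -
    have "(norm (f x - g x))\<^sup>2 \<le> (norm (f x) + norm (g x))\<^sup>2"
      by (intro power_mono norm_triangle_ineq4) auto
    also have "\<dots> \<le> 2 * (norm (f x))\<^sup>2 + 2 * (norm (g x))\<^sup>2"
      using sum_squares_bound[of "norm (f x)" "norm (g x)"] by (simp add: power2_sum)
    finally have "ennreal ((norm (f x - g x))\<^sup>2) \<le> ennreal (2 * (norm (f x))\<^sup>2 + 2 * (norm (g x))\<^sup>2)"
      by (rule ennreal_leI)
    then show ?thesis
      by (simp add: ennreal_power ennreal_mult)
  qed
  then have "(\<integral>\<^sup>+x. ennreal (norm (f x - g x)) ^ 2 \<partial>M)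
      \<le> (\<integral>\<^sup>+x. 2 * ennreal (norm (f x)) ^ 2 + 2 * ennreal (norm (g x)) ^ 2 \<partial>M)"
    by (intro nn_integral_mono) auto
  also have "\<dots> < \<infinity>"
    using f g unfolding Lp_space_2_iff by (simp add: nn_integral_add nn_integral_cmult ennreal_mult_less_top)
  finally show ?thesis
    unfolding Lp_space_2_iff by simp
qed

text \<open>Cauchy-Schwarz for the difference. Integrability of the products is assumed, instead of
  square integrability of each h n, because the sequence will also consist of transforms of
  integrable functions: these are bounded, but their L2 norms are not known to be finite.\<close>

lemma tendsto_L2_mult:
  assumes h: "\<And>n. h n \<in> borel_measurable M" "\<And>n. integrable M (\<lambda>x. h n x * \<psi> x)"
    and f: "f \<in> Lp_space M 2" and \<psi>: "\<psi> \<in> Lp_space M 2"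
    and lim: "(\<lambda>n. Lp_norm M 2 (\<lambda>x. h n x - f x)) \<longlonglongrightarrow> 0"
  shows "(\<lambda>n. \<integral>x. h n x * \<psi> x \<partial>M) \<longlonglongrightarrow> (\<integral>x. f x * \<psi> x \<partial>M)"
proof -
  let ?C = "Lp_norm M 2 \<psi>"
  have C: "?C < \<infinity>" using \<psi> by (simp add: Lp_space_def)
  have [measurable]: "h n \<in> borel_measurable M" "f \<in> borel_measurable M" "\<psi> \<in> borel_measurable M" for n
    using h f \<psi> by (auto simp: Lp_space_def)
  have le: "ennreal (norm ((\<integral>x. h n x * \<psi> x \<partial>M) - (\<integral>x. f x * \<psi> x \<partial>M)))
      \<le> Lp_norm M 2 (\<lambda>x. h n x - f x) * ?C" for n
  proof -
    have "(\<integral>x. h n x * \<psi> x \<partial>M) - (\<integral>x. f x * \<psi> x \<partial>M) = (\<integral>x. (h n x - f x) * \<psi> x \<partial>M)"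
      using h(2)[of n] integrable_L2_mult[OF f \<psi>] by (simp add: left_diff_distrib)
    then have "ennreal (norm ((\<integral>x. h n x * \<psi> x \<partial>M) - (\<integral>x. f x * \<psi> x \<partial>M)))
       \<le> (\<integral>\<^sup>+x. ennreal (norm ((h n x - f x) * \<psi> x)) \<partial>M)"
      using h(2)[of n] integrable_L2_mult[OF f \<psi>]
      by (simp only:) (rule integral_norm_bound_ennreal, simp add: left_diff_distrib)
    also have "\<dots> \<le> Lp_norm M 2 (\<lambda>x. h n x - f x) * ?C"
    proof -
      have "(\<integral>\<^sup>+x. ennreal (norm ((h n x - f x) * \<psi> x)) \<partial>M) ^ 2 \<le> (Lp_norm M 2 (\<lambda>x. h n x - f x) * ?C) ^ 2"
        unfolding power_mult_distrib Lp_norm_2_power2 by (rule L2_mult) measurable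
      then show ?thesis
        by (rule ennreal_power2_le_imp_le)
    qed
    finally show ?thesis .
  qed
  have "(\<lambda>n. Lp_norm M 2 (\<lambda>x. h n x - f x) * ?C) \<longlonglongrightarrow> 0 * ?C"
    using C by (intro tendsto_mult_ennreal lim tendsto_const) auto
  then have "(\<lambda>n. Lp_norm M 2 (\<lambda>x. h n x - f x) * ?C) \<longlonglongrightarrow> 0"
    unfolding mult_zero_left .
  then have "(\<lambda>n. ennreal (norm ((\<integral>x. h n x * \<psi> x \<partial>M) - (\<integral>x. f x * \<psi> x \<partial>M)))) \<longlonglongrightarrow> 0"
    by (rule tendsto_sandwich[OF always_eventually[OF allI[OF zero_le]] always_eventually[OF allI[OF le]] tendsto_const])
  then have "(\<lambda>n. norm ((\<integral>x. h n x * \<psi> x \<partial>M) - (\<integral>x. f x * \<psi> x \<partial>M))) \<longlonglongrightarrow> 0"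
    by (rule tendsto_ennrealD[where x = 0, unfolded ennreal_0]) simp_all
  then show ?thesis
    by (simp add: LIM_zero_iff tendsto_norm_zero_iff)
qed

lemma Lp_space_2_cmult:
  assumes "f \<in> Lp_space M 2"
  shows "(\<lambda>x. c * f x) \<in> Lp_space M 2"
proof -
  have [measurable]: "f \<in> borel_measurable M"
    using assms unfolding Lp_space_2_iff by auto
  have "(\<integral>\<^sup>+x. ennreal (norm (c * f x)) ^ 2 \<partial>M) = (\<integral>\<^sup>+x. ennreal (norm c) ^ 2 * ennreal (norm (f x)) ^ 2 \<partial>M)"
    by (intro nn_integral_cong) (simp add: norm_mult ennreal_mult power_mult_distrib)
  also have "\<dots> < \<infinity>"
    using assms unfolding Lp_space_2_iff by (simp add: nn_integral_cmult ennreal_mult_less_top ennreal_power)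
  finally show ?thesis unfolding Lp_space_2_iff by simp
qed

lemma Lp_space_2_mult_bounded:
  assumes g: "g \<in> Lp_space M 2" and e: "e \<in> borel_measurable M" "\<And>x. norm (e x) \<le> 1"
  shows "(\<lambda>x. e x * g x) \<in> Lp_space M 2"
proof -
  have "g \<in> borel_measurable M" using g unfolding Lp_space_2_iff by simp
  then have "(\<lambda>x. e x * g x) \<in> borel_measurable M"
    by (rule borel_measurable_times[OF e(1)])
  moreover have "(\<integral>\<^sup>+x. ennreal (norm (e x * g x)) ^ 2 \<partial>M) \<le> (\<integral>\<^sup>+x. ennreal (norm (g x)) ^ 2 \<partial>M)"
    using e(2) by (intro nn_integral_mono power_mono ennreal_leI) (auto simp: norm_mult intro!: mult_left_le_one_le)
  moreover have "\<dots> < \<infinity>" using g unfolding Lp_space_2_iff by simp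
  ultimately show ?thesis
    unfolding Lp_space_2_iff by (auto intro: le_less_trans)
qed

section \<open>Young's inequality for integral kernels\<close>

lemma ennreal_powr_ennreal: "r \<ge> 0 \<Longrightarrow> ennreal_powr (ennreal r) a = ennreal (r powr a)"
  by (simp add: ennreal_powr_def)

lemma ennreal_powr_top [simp]: "ennreal_powr \<infinity> a = \<infinity>"
  by (simp add: ennreal_powr_def)

lemma ennreal_powr_mono: "a > 0 \<Longrightarrow> x \<le> y \<Longrightarrow> ennreal_powr x a \<le> ennreal_powr y a"
  by (cases x; cases y) (auto simp: ennreal_powr_def top_unique intro!: ennreal_leI powr_mono2)

lemma ennreal_powr_mult:
  assumes "a > 0"
  shows "ennreal_powr (x * y) a = ennreal_powr x a * ennreal_powr y a"
proof -
  have 0: "ennreal_powr 0 a = 0"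
    by (simp add: ennreal_powr_def)
  have "ennreal_powr (ennreal r) a \<noteq> 0" if "r > 0" for r
    using that by (simp add: ennreal_powr_ennreal ennreal_eq_0_iff)
  then show ?thesis
    using 0 assms
    by (cases x; cases y)
       (auto simp: ennreal_powr_ennreal ennreal_mult[symmetric] powr_mult ennreal_top_mult ennreal_mult_top
         ennreal_powr_top[unfolded infinity_ennreal_def] less_le)
qed

lemma ennreal_powr_powr: "ennreal_powr (ennreal_powr x a) b = ennreal_powr x (a * b)"
  by (cases x) (auto simp: ennreal_powr_def powr_powr)

lemma ennreal_powr_1 [simp]: "ennreal_powr x 1 = x"
  by (cases x) (auto simp: ennreal_powr_def)

lemma ennreal_powr_add: "ennreal_powr x (a + b) = ennreal_powr x a * ennreal_powr x b"
  by (cases x) (auto simp: ennreal_powr_def powr_add ennreal_mult ennreal_top_mult)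

lemma measurable_ennreal_powr [measurable (raw)]:
  assumes [measurable]: "g \<in> borel_measurable M"
  shows "(\<lambda>x. ennreal_powr (g x) a) \<in> borel_measurable M"
  unfolding ennreal_powr_def by measurable

text \<open>The numerical Young inequality for t and c^(a-1), divided by c^(a-1); equality holds at
  t = c. The right side is affine in t^a, so it can be integrated against a kernel before c is
  chosen.\<close>

lemma ennreal_powr_young:
  assumes a: "a > 1" and c: "c > 0"
  shows "t \<le> ennreal_powr t a * ennreal (1 / (a * c powr (a - 1))) + ennreal ((1 - 1 / a) * c)"
proof (cases t)
  case (real r)
  let ?C = "c powr (a - 1)"
  have C: "?C > 0" using c by simp
  have conj: "a / (a - 1) > 1" "1 / a + 1 / (a / (a - 1)) = 1"
    using a by (auto simp: field_simps)
  have "r * ?C \<le> r powr a / a + ?C powr (a / (a - 1)) / (a / (a - 1))"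
    using a conj real by (intro Youngs_inequality) auto
  also have "?C powr (a / (a - 1)) = c * ?C"
    using a c powr_add[of c 1 "a - 1"] by (simp add: powr_powr)
  finally have "r \<le> (r powr a / a + c * ?C / (a / (a - 1))) / ?C"
    using C by (simp add: pos_le_divide_eq)
  also have "\<dots> = r powr a * (1 / (a * ?C)) + (1 - 1 / a) * c"
    using C a by (simp add: field_simps)
  finally have "ennreal r \<le> ennreal (r powr a * (1 / (a * ?C)) + (1 - 1 / a) * c)"
    by (rule ennreal_leI)
  also have "\<dots> = ennreal (r powr a * (1 / (a * ?C))) + ennreal ((1 - 1 / a) * c)"
    using a c C by (intro ennreal_plus) auto
  also have "ennreal (r powr a * (1 / (a * ?C))) = ennreal (r powr a) * ennreal (1 / (a * ?C))"
    using a C by (intro ennreal_mult) auto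
  finally show ?thesis
    unfolding real(2) ennreal_powr_ennreal[OF real(1)] .
next
  case top
  then show ?thesis
    using a c by (simp add: ennreal_powr_top[unfolded infinity_ennreal_def] ennreal_top_mult)
qed

text \<open>Jensen's inequality for the measure k dM of mass at most m, obtained by integrating the
  pointwise inequality and optimising in c. The optimal c is a positive real only if the integral of
  F^a is neither 0 nor infinite; hence the cases.\<close>

lemma nn_integral_kernel_jensen:
  assumes F: "F \<in> borel_measurable M" and k: "k \<in> borel_measurable M"
    and m: "m > 0" "(\<integral>\<^sup>+x. k x \<partial>M) \<le> ennreal m" and a: "a \<ge> 1"
  shows "(\<integral>\<^sup>+x. F x * k x \<partial>M) \<le> ennreal_powr (\<integral>\<^sup>+x. ennreal_powr (F x) a * k x \<partial>M) (1 / a) * ennreal (m powr (1 - 1 / a))"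
proof (cases "a = 1")
  case False
  note [measurable] = F k
  let ?I = "\<integral>\<^sup>+x. ennreal_powr (F x) a * k x \<partial>M"
  have a1: "a > 1" using a False by simp
  consider "?I = \<infinity>" | "?I = 0" | i where "?I = ennreal i" "i > 0"
    by (cases ?I) (auto simp: less_le)
  then show ?thesis
  proof cases
    case 1
    have "\<infinity> * ennreal (m powr (1 - 1 / a)) = \<infinity>"
      using m by (simp add: ennreal_top_mult ennreal_eq_0_iff)
    then show ?thesis unfolding 1 ennreal_powr_top by simp
  next
    case 2
    then have "AE x in M. ennreal_powr (F x) a * k x = 0"
      by (subst (asm) nn_integral_0_iff_AE) auto
    then have "AE x in M. F x * k x = 0"
    proof eventually_elim
      case (elim x)
      then show ?case
        using a1 by (cases "F x") (auto simp: ennreal_powr_def ennreal_eq_0_iff)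
    qed
    then have "(\<integral>\<^sup>+x. F x * k x \<partial>M) = 0"
      by (subst nn_integral_0_iff_AE) auto
    then show ?thesis by simp
  next
    case 3
    \<comment> \<open>The minimiser: it satisfies i = m c^a, so the two integrated terms, of weights
      1/a and 1 - 1/a, are multiples of the same quantity c m.\<close>
    define c where "c = (i / m) powr (1 / a)"
    have c: "c > 0" using 3 m by (simp add: c_def)
    have ca: "i = m * (c * c powr (a - 1))"
    proof -
      have "c * c powr (a - 1) = c powr a"
        using c powr_add[of c 1 "a - 1"] by simp
      also have "\<dots> = i / m"
        using a1 m 3 by (simp add: c_def powr_powr)
      finally show ?thesis using m by simp
    qed
    have "(\<integral>\<^sup>+x. F x * k x \<partial>M)
       \<le> (\<integral>\<^sup>+x. ennreal (1 / (a * c powr (a - 1))) * (ennreal_powr (F x) a * k x) + ennreal ((1 - 1 / a) * c) * k x \<partial>M)"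
    proof (rule nn_integral_mono)
      fix x
      have "F x * k x \<le> (ennreal_powr (F x) a * ennreal (1 / (a * c powr (a - 1))) + ennreal ((1 - 1 / a) * c)) * k x"
        by (intro mult_right_mono ennreal_powr_young a1 c) simp
      then show "F x * k x \<le> ennreal (1 / (a * c powr (a - 1))) * (ennreal_powr (F x) a * k x) + ennreal ((1 - 1 / a) * c) * k x"
        by (simp only: distrib_right distrib_left mult_ac)
    qed
    also have "\<dots> = ennreal (1 / (a * c powr (a - 1))) * ?I + ennreal ((1 - 1 / a) * c) * (\<integral>\<^sup>+x. k x \<partial>M)"
      by (simp add: nn_integral_add nn_integral_cmult)
    also have "\<dots> \<le> ennreal (1 / (a * c powr (a - 1))) * ennreal i + ennreal ((1 - 1 / a) * c) * ennreal m"
      unfolding 3(1) by (intro add_left_mono mult_left_mono m) simp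
    also have "\<dots> = ennreal (1 / (a * c powr (a - 1)) * i + (1 - 1 / a) * c * m)"
      using a1 c m 3 by (simp add: ennreal_mult[symmetric] flip: ennreal_plus)
    also have "1 / (a * c powr (a - 1)) * i + (1 - 1 / a) * c * m = c * m"
      unfolding ca using a1 c m by (simp add: field_simps)
    also have "c * m = i powr (1 / a) * m powr (1 - 1 / a)"
      using m 3 by (simp add: c_def powr_divide powr_diff)
    finally show ?thesis
      using 3 by (simp add: ennreal_powr_ennreal ennreal_mult)
  qed
qed (use m in simp)

text \<open>Interpolation between two bounds for J(y), the integral of F^a against k(x, y): it is at
  most N, the integral of F^a, because k \<le> 1, and its own integral is at most N m by Tonelli. So
  J^(b/a) has integral at most N^(b/a) m, while Jensen bounds the inner integral by J^(1/a) m^(1 -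
  1/a).\<close>

proposition nn_integral_kernel_young:
  fixes M :: "'a measure" and k :: "'a \<Rightarrow> 'a \<Rightarrow> ennreal"
  assumes "sigma_finite_measure M"
    and F: "F \<in> borel_measurable M" and k: "(\<lambda>(x, y). k x y) \<in> borel_measurable (M \<Otimes>\<^sub>M M)"
    and k1: "\<And>x y. k x y \<le> 1"
    and m: "m > 0" "\<And>y. (\<integral>\<^sup>+x. k x y \<partial>M) \<le> ennreal m" "\<And>x. (\<integral>\<^sup>+y. k x y \<partial>M) \<le> ennreal m"
    and a: "a \<ge> 1" and b: "b \<ge> a"
  shows "ennreal_powr (\<integral>\<^sup>+y. ennreal_powr (\<integral>\<^sup>+x. F x * k x y \<partial>M) b \<partial>M) (1 / b)
    \<le> ennreal_powr (\<integral>\<^sup>+x. ennreal_powr (F x) a \<partial>M) (1 / a) * ennreal (m powr (1 - 1 / a + 1 / b))"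
proof -
  interpret sigma_finite_measure M by fact
  interpret P: pair_sigma_finite M M ..
  note [measurable] = F
  have ab: "a > 0" "b > 0" using a b by auto
  note km = measurable_section2[OF k]
  let ?N = "\<integral>\<^sup>+x. ennreal_powr (F x) a \<partial>M"
  define J where "J y = (\<integral>\<^sup>+x. ennreal_powr (F x) a * k x y \<partial>M)" for y
  have J_le: "J y \<le> ?N" for y
    unfolding J_def using mult_left_mono[OF k1] by (intro nn_integral_mono) fastforce
  have pair: "(\<lambda>(x, y). ennreal_powr (F x) a * k x y) \<in> borel_measurable (M \<Otimes>\<^sub>M M)"
    using k unfolding case_prod_unfold by measurable
  have "(\<integral>\<^sup>+y. J y \<partial>M) = (\<integral>\<^sup>+x. (\<integral>\<^sup>+y. ennreal_powr (F x) a * k x y \<partial>M) \<partial>M)"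
    unfolding J_def by (rule P.Fubini'[OF pair])
  also have "\<dots> = (\<integral>\<^sup>+x. ennreal_powr (F x) a * (\<integral>\<^sup>+y. k x y \<partial>M) \<partial>M)"
  proof (rule nn_integral_cong)
    fix x assume "x \<in> space M"
    then have "(\<lambda>y. k x y) \<in> borel_measurable M"
      by (rule measurable_section1[OF k])
    then show "(\<integral>\<^sup>+y. ennreal_powr (F x) a * k x y \<partial>M) = ennreal_powr (F x) a * (\<integral>\<^sup>+y. k x y \<partial>M)"
      by (rule nn_integral_cmult)
  qed
  also have "\<dots> \<le> (\<integral>\<^sup>+x. ennreal_powr (F x) a * ennreal m \<partial>M)"
    by (intro nn_integral_mono mult_left_mono m) simp
  also have "\<dots> = ?N * ennreal m"
    by (rule nn_integral_multc) measurable
  finally have intJ: "(\<integral>\<^sup>+y. J y \<partial>M) \<le> ?N * ennreal m" .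
  have measJ: "J \<in> borel_measurable M"
    using measurable_pair_swap[OF pair] unfolding J_def[abs_def]
    by (intro borel_measurable_nn_integral) (simp add: case_prod_unfold)
  \<comment> \<open>The case a = b is separate since \<open>ennreal_powr\<close> with exponent 0 is
    not constantly 1: it gives 0 at 0 and \<infinity> at \<infinity>.\<close>
  define R where "R = (if a = b then 1 else ennreal_powr ?N (b / a - 1))"
  have RJ: "ennreal_powr (J y) (b / a) \<le> R * J y" for y
  proof (cases "a = b")
    case False
    then have "b / a - 1 > 0" using a b by (simp add: field_simps)
    then have "ennreal_powr (J y) (b / a - 1) * J y \<le> ennreal_powr ?N (b / a - 1) * J y"
      by (intro mult_right_mono ennreal_powr_mono J_le) auto
    then show ?thesis
      using False ennreal_powr_add[of "J y" "b / a - 1" 1] by (simp add: R_def)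
  qed (use ab in \<open>simp add: R_def\<close>)
  have RN: "R * ?N = ennreal_powr ?N (b / a)"
    using ennreal_powr_add[of ?N "b / a - 1" 1] ab by (auto simp: R_def)
  have "(\<integral>\<^sup>+y. ennreal_powr (\<integral>\<^sup>+x. F x * k x y \<partial>M) b \<partial>M) \<le> (\<integral>\<^sup>+y. (R * ennreal (m powr (b * (1 - 1 / a)))) * J y \<partial>M)"
  proof (rule nn_integral_mono)
    fix y assume y: "y \<in> space M"
    have "ennreal_powr (\<integral>\<^sup>+x. F x * k x y \<partial>M) b \<le> ennreal_powr (ennreal_powr (J y) (1 / a) * ennreal (m powr (1 - 1 / a))) b"
      unfolding J_def by (intro ennreal_powr_mono ab nn_integral_kernel_jensen F km y m a)
    also have "\<dots> = ennreal_powr (J y) (b / a) * ennreal (m powr (b * (1 - 1 / a)))"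
      using ab by (simp add: ennreal_powr_mult ennreal_powr_powr ennreal_powr_ennreal powr_powr mult.commute)
    also have "\<dots> \<le> (R * J y) * ennreal (m powr (b * (1 - 1 / a)))"
      by (intro mult_right_mono RJ) simp
    finally show "ennreal_powr (\<integral>\<^sup>+x. F x * k x y \<partial>M) b \<le> (R * ennreal (m powr (b * (1 - 1 / a)))) * J y"
      by (simp only: mult_ac)
  qed
  also have "\<dots> = (R * ennreal (m powr (b * (1 - 1 / a)))) * (\<integral>\<^sup>+y. J y \<partial>M)"
    by (rule nn_integral_cmult[OF measJ])
  also have "\<dots> \<le> (R * ennreal (m powr (b * (1 - 1 / a)))) * (?N * ennreal m)"
    by (intro mult_left_mono intJ) simp
  also have "\<dots> = (R * ?N) * (ennreal (m powr (b * (1 - 1 / a))) * ennreal m)"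
    by (simp only: mult_ac)
  also have "\<dots> = ennreal_powr ?N (b / a) * ennreal (m powr (b * (1 - 1 / a) + 1))"
    unfolding RN using m by (simp add: powr_add ennreal_mult)
  finally have "ennreal_powr (\<integral>\<^sup>+y. ennreal_powr (\<integral>\<^sup>+x. F x * k x y \<partial>M) b \<partial>M) (1 / b)
      \<le> ennreal_powr (ennreal_powr ?N (b / a) * ennreal (m powr (b * (1 - 1 / a) + 1))) (1 / b)"
    using ab by (intro ennreal_powr_mono) auto
  also have "\<dots> = ennreal_powr ?N (1 / a) * ennreal (m powr ((b * (1 - 1 / a) + 1) * (1 / b)))"
    using ab by (simp add: ennreal_powr_mult ennreal_powr_powr ennreal_powr_ennreal powr_powr)
  also have "(b * (1 - 1 / a) + 1) * (1 / b) = 1 - 1 / a + 1 / b"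
    using ab by (simp add: field_simps)
  finally show ?thesis .
qed

section \<open>Gaussians and quadratic forms\<close>

definition gauss :: "real \<Rightarrow> real \<Rightarrow> complex" where
  "gauss s x = of_real (exp (- s * x\<^sup>2))"

definition xgauss :: "real \<Rightarrow> real \<Rightarrow> complex" where
  "xgauss s x = of_real (x * exp (- s * x\<^sup>2))"

text \<open>This one bound gives the nonnegativity required for Laplace uniqueness, the Gaussian
  decay in x for fixed y, and the vanishing of the translated ball once |x| \<ge> |y| + 1.\<close>

lemma quadratic_form_ge:
  fixes x y t :: real
  assumes "\<bar>t\<bar> \<le> 1"
  shows "(\<bar>x\<bar> - \<bar>y\<bar>)\<^sup>2 \<le> x\<^sup>2 + y\<^sup>2 - 2 * x * y * t"
proof -
  have "x * y * t \<le> \<bar>x\<bar> * \<bar>y\<bar> * \<bar>t\<bar>"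
    by (simp flip: abs_mult)
  also have "\<dots> \<le> \<bar>x\<bar> * \<bar>y\<bar> * 1"
    using assms by (intro mult_left_mono) auto
  finally show ?thesis by (simp add: power2_diff)
qed

lemma dunkl_ball_0: "dunkl_ball 0 1 = {-1<..<1}"
  by (simp add: dunkl_ball_def)

lemma indicator_dunkl_ball_0: "indicator (dunkl_ball 0 1) x = of_real (indicator {..<1} (x\<^sup>2))"
  by (auto simp: dunkl_ball_0 indicator_def abs_square_less_1)

locale dunkl =
  fixes \<kappa> :: real
  assumes \<kappa>: "\<kappa> > - 1 / 2"
begin

lemma \<kappa>1: "\<kappa> > - 1" "\<kappa> + 1 > 0" "\<kappa> + 2 > 0"
  using \<kappa> by auto

abbreviation "\<mu> \<equiv> dunkl_measure \<kappa>"
abbreviation "\<E> \<equiv> dunkl_kernel \<kappa>"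
abbreviation "\<F> \<equiv> dunkl_transform \<kappa>"
abbreviation "dunkl_character l x \<equiv> \<E> (- \<i> * of_real (l :: real) * of_real (x :: real))"
abbreviation "\<omega> \<equiv> (indicator (dunkl_ball 0 1) :: real \<Rightarrow> complex)"

section \<open>The Mehler measure of the Dunkl kernel\<close>

text \<open>The even part of the density represents the Bessel part of the Dunkl kernel. The factor
  1 + t adds to it the odd density that represents the term with
  \<open>bessel_j (\<kappa> + 1)\<close>.\<close>

definition mehler_density :: "real \<Rightarrow> real" where
  "mehler_density t =
    indicator {-1<..<1} t * ((1 + t) * (1 - t\<^sup>2) powr (\<kappa> - 1 / 2)) / Beta (1 / 2) (\<kappa> + 1 / 2)"

definition mehler :: "real measure" where
  "mehler = density lborel (\<lambda>t. ennreal (mehler_density t))"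

lemma measurable_mehler_density [measurable]: "mehler_density \<in> borel_measurable borel"
  unfolding mehler_density_def by measurable

lemma sets_mehler [simp, measurable_cong]: "sets mehler = sets borel"
  and space_mehler [simp]: "space mehler = UNIV"
  by (simp_all add: mehler_def)

lemma mehler_density_nonneg: "mehler_density t \<ge> 0"
  using Beta_half_pos[OF \<kappa>] by (auto simp: mehler_density_def indicator_def)

lemma has_bochner_integral_mehler_aux:
  defines "w \<equiv> \<lambda>t::real. indicator {-1<..<1} t * (1 - t\<^sup>2) powr (\<kappa> - 1 / 2) / Beta (1 / 2) (\<kappa> + 1 / 2)"
  shows "has_bochner_integral lborel (\<lambda>t. w t * t ^ (2 * n)) (pochhammer (1 / 2) n / pochhammer (\<kappa> + 1) n)" (is ?even)
    and "has_bochner_integral lborel (\<lambda>t. w t * t ^ Suc (2 * n)) 0" (is ?odd)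
proof -
  let ?B = "Beta (1 / 2) (\<kappa> + 1 / 2)"
  let ?g = "\<lambda>t::real. indicator {-1<..<1} t * ((1 - t\<^sup>2) powr (\<kappa> - 1 / 2) * t ^ (2 * n))"
  have "has_bochner_integral lborel ?g (Beta (1 / 2 + real n) (\<kappa> + 1 / 2))"
    using \<kappa> by (intro has_bochner_integral_nn_integral nn_integral_symmetric_beta)
      (auto simp: Beta_def Gamma_real_nonneg)
  then have "has_bochner_integral lborel (\<lambda>t. ?g t / ?B) (Beta (1 / 2 + real n) (\<kappa> + 1 / 2) / ?B)"
    by (rule has_bochner_integral_divide_zero)
  also have "(\<lambda>t. ?g t / ?B) = (\<lambda>t. w t * t ^ (2 * n))"
    by (simp add: w_def fun_eq_iff)
  finally show ev: ?even
    by (simp add: Beta_quotient[OF \<kappa>])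
  show ?odd
  proof (rule has_bochner_integral_odd)
    show "integrable lborel (\<lambda>t. w t * t ^ Suc (2 * n))"
    proof (rule Bochner_Integration.integrable_bound)
      show "integrable lborel (\<lambda>t. w t * t ^ (2 * n))"
        using ev by (simp add: has_bochner_integral_iff)
      show "AE t in lborel. norm (w t * t ^ Suc (2 * n)) \<le> norm (w t * t ^ (2 * n))"
      proof (intro AE_I2)
        fix t :: real
        show "norm (w t * t ^ Suc (2 * n)) \<le> norm (w t * t ^ (2 * n))"
        proof (cases "t \<in> {-1<..<1}")
          case True
          then have "\<bar>t\<bar> \<le> 1" by auto
          then have "\<bar>t\<bar> ^ Suc (2 * n) \<le> \<bar>t\<bar> ^ (2 * n)"
            by (intro power_decreasing) auto
          then show ?thesis
            by (auto simp: abs_mult power_abs intro!: mult_left_mono)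
        qed (simp add: w_def)
      qed
    qed (simp add: w_def)
    show "w (- t) * (- t) ^ Suc (2 * n) = - (w t * t ^ Suc (2 * n))" for t
      by (auto simp: w_def indicator_def)
  qed
qed

text \<open>Because of the factor 1 + t, an odd moment equals the next even one, so only symmetric
  Beta moments occur. The index \<open>Suc n div 2\<close> is n/2 rounded up.\<close>

lemma has_bochner_integral_mehler_power: "has_bochner_integral mehler (\<lambda>t. t ^ n)
    (pochhammer (1 / 2) (Suc n div 2) / pochhammer (\<kappa> + 1) (Suc n div 2))"
proof -
  let ?w = "\<lambda>t::real. indicator {-1<..<1} t * (1 - t\<^sup>2) powr (\<kappa> - 1 / 2) / Beta (1 / 2) (\<kappa> + 1 / 2)"
  note aux = has_bochner_integral_mehler_aux
  have "has_bochner_integral lborel (\<lambda>t. ?w t * t ^ n + ?w t * t ^ Suc n)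
     (pochhammer (1 / 2) (Suc n div 2) / pochhammer (\<kappa> + 1) (Suc n div 2))"
  proof (cases "even n")
    case True
    then obtain m where "n = 2 * m" by (auto elim: evenE)
    then show ?thesis
      using has_bochner_integral_add[OF aux(1)[of m] aux(2)[of m]] by simp
  next
    case False
    then obtain m where "n = Suc (2 * m)" by (auto elim: oddE)
    then show ?thesis
      using has_bochner_integral_add[OF aux(2)[of m] aux(1)[of "Suc m"]] by simp
  qed
  also have "(\<lambda>t. ?w t * t ^ n + ?w t * t ^ Suc n) = (\<lambda>t. mehler_density t *\<^sub>R t ^ n)"
    by (auto simp: mehler_density_def fun_eq_iff algebra_simps add_divide_distrib)
  finally show ?thesis
    unfolding mehler_def using mehler_density_nonneg
    by (intro has_bochner_integral_density) auto
qed

lemma prob_space_mehler: "prob_space mehler"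
proof -
  have *: "has_bochner_integral mehler (\<lambda>t. 1) (1::real)"
    using has_bochner_integral_mehler_power[of 0] by simp
  have "emeasure mehler (space mehler) = (\<integral>\<^sup>+t. ennreal 1 \<partial>mehler)"
    by (simp del: space_mehler)
  also have "\<dots> = ennreal 1"
    using * by (subst nn_integral_eq_integral) (auto simp: has_bochner_integral_iff)
  finally show ?thesis
    by (intro prob_spaceI) simp
qed

lemma AE_mehler: "AE t in mehler. \<bar>t\<bar> < 1"
  unfolding mehler_def
  by (subst AE_density) (auto simp: mehler_density_def indicator_def intro!: AE_I2 split: if_splits)

section \<open>The Dunkl kernel\<close>

lemma dunkl_kernel_eq_hyp0F1: "\<E> z = hyp0F1 (\<kappa> + 1) (z\<^sup>2 / 4) + z / of_real (2 * (\<kappa> + 1)) * hyp0F1 (\<kappa> + 2) (z\<^sup>2 / 4)"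
  using \<kappa> bessel_j_eq_hyp0F1[of \<kappa> z] bessel_j_eq_hyp0F1[of "\<kappa> + 1" z]
  by (simp add: dunkl_kernel_def add.assoc)

lemma dunkl_kernel_0 [simp]: "\<E> 0 = 1"
  by (simp add: dunkl_kernel_eq_hyp0F1)

lemma continuous_on_dunkl_kernel: "continuous_on S \<E>"
  unfolding dunkl_kernel_eq_hyp0F1 divide_inverse
  by (intro continuous_intros continuous_on_compose2[OF continuous_on_hyp0F1[of _ UNIV]])
     (use \<kappa> in auto)

lemma measurable_dunkl_kernel:
  "\<E> \<in> borel_measurable borel"
  by (intro borel_measurable_continuous_onI continuous_on_dunkl_kernel)

text \<open>Written against z^n / n!, the Taylor coefficients of the Dunkl kernel are exactly the
  moments of \<open>mehler\<close>; for even n this is (2m)! = 4^m m! (1/2)_m, and for odd n the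
  same with one more factor.\<close>

lemma dunkl_kernel_sums: "(\<lambda>n. of_real (pochhammer (1 / 2) (Suc n div 2) / pochhammer (\<kappa> + 1) (Suc n div 2)) * (z ^ n /\<^sub>R fact n))
     sums \<E> z"
proof -
  have scale: "of_real (c / d) * y = of_real c * (y /\<^sub>R d)" for c d and y :: complex
    by (simp add: scaleR_conv_of_real divide_inverse)
  have "(\<lambda>n. if even n then of_real (hyp_coeff (\<kappa> + 1) (n div 2)) * (z\<^sup>2 / 4) ^ (n div 2)
      else z / of_real (2 * (\<kappa> + 1)) * (of_real (hyp_coeff (\<kappa> + 2) (n div 2)) * (z\<^sup>2 / 4) ^ (n div 2)))
     sums \<E> z"
    unfolding dunkl_kernel_eq_hyp0F1
    by (intro sums_even_odd hyp0F1_sums \<kappa>1 sums_mult)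
  also have "(\<lambda>n. if even n then of_real (hyp_coeff (\<kappa> + 1) (n div 2)) * (z\<^sup>2 / 4) ^ (n div 2)
      else z / of_real (2 * (\<kappa> + 1)) * (of_real (hyp_coeff (\<kappa> + 2) (n div 2)) * (z\<^sup>2 / 4) ^ (n div 2)))
    = (\<lambda>n. of_real (pochhammer (1 / 2) (Suc n div 2) / pochhammer (\<kappa> + 1) (Suc n div 2)) * (z ^ n /\<^sub>R fact n))"
  proof (rule ext, goal_cases)
    case (1 n)
    show ?case
    proof (cases "even n")
      case True
      then obtain m where n: "n = 2 * m" by (auto elim: evenE)
      have "pochhammer (1 / 2 :: real) m > 0" by (simp add: pochhammer_pos)
      then have "hyp_coeff (\<kappa> + 1) m / 4 ^ m = pochhammer (1 / 2) m / pochhammer (\<kappa> + 1) m / fact n"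
        unfolding n pochhammer_half hyp_coeff_def by (simp add: field_simps)
      then have c: "of_real (hyp_coeff (\<kappa> + 1) m / 4 ^ m) * z ^ n = of_real (pochhammer (1 / 2) m / pochhammer (\<kappa> + 1) m / fact n) * z ^ n"
        by simp
      have "z ^ n = (z\<^sup>2) ^ m"
        by (simp add: n power_mult)
      then have "of_real (hyp_coeff (\<kappa> + 1) m) * (z\<^sup>2 / 4) ^ m = of_real (hyp_coeff (\<kappa> + 1) m / 4 ^ m) * z ^ n"
        by (simp add: power_divide)
      also note c
      also have "of_real (pochhammer (1 / 2) m / pochhammer (\<kappa> + 1) m / fact n) * z ^ n
         = of_real (pochhammer (1 / 2) m / pochhammer (\<kappa> + 1) m) * (z ^ n /\<^sub>R fact n)"
        by (rule scale)
      finally show ?thesis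
        using n by simp
    next
      case False
      then obtain m where n: "n = Suc (2 * m)" by (auto elim: oddE)
      have p: "pochhammer (1 / 2 :: real) m > 0" by (simp add: pochhammer_pos)
      have f: "fact n = (2 * real m + 1) * (4 ^ m * fact m * pochhammer (1 / 2 :: real) m)"
        unfolding n fact_Suc pochhammer_half by simp
      have ph: "pochhammer (1 / 2 :: real) (Suc m) = pochhammer (1 / 2) m * (2 * real m + 1) / 2"
        by (simp add: pochhammer_Suc field_simps)
      have pk: "pochhammer (\<kappa> + 1) (Suc m) = (\<kappa> + 1) * pochhammer (\<kappa> + 2) m"
        by (simp add: pochhammer_rec add.assoc)
      have "1 / (2 * k) * (1 / (F * Q)) / W = P * L / 2 / (k * Q) / (L * (W * F * P))"
        if "P > 0" "L > 0" for k F Q W P L :: real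
        using that by (simp add: field_simps)
      from this[OF p, of "2 * real m + 1" "\<kappa> + 1" "fact m" "pochhammer (\<kappa> + 2) m" "4 ^ m"]
      have "1 / (2 * (\<kappa> + 1)) * hyp_coeff (\<kappa> + 2) m / 4 ^ m = pochhammer (1 / 2) (Suc m) / pochhammer (\<kappa> + 1) (Suc m) / fact n"
        unfolding hyp_coeff_def f ph pk by simp
      then have c: "of_real (1 / (2 * (\<kappa> + 1)) * hyp_coeff (\<kappa> + 2) m / 4 ^ m) * z ^ n = of_real (pochhammer (1 / 2) (Suc m) / pochhammer (\<kappa> + 1) (Suc m) / fact n) * z ^ n"
        by simp
      have "z ^ n = z * (z\<^sup>2) ^ m"
        by (simp add: n power_mult)
      then have "z / of_real (2 * (\<kappa> + 1)) * (of_real (hyp_coeff (\<kappa> + 2) m) * (z\<^sup>2 / 4) ^ m)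
          = of_real (1 / (2 * (\<kappa> + 1)) * hyp_coeff (\<kappa> + 2) m / 4 ^ m) * z ^ n"
        by (simp add: power_divide)
      also note c
      also have "of_real (pochhammer (1 / 2) (Suc m) / pochhammer (\<kappa> + 1) (Suc m) / fact n) * z ^ n
         = of_real (pochhammer (1 / 2) (Suc m) / pochhammer (\<kappa> + 1) (Suc m)) * (z ^ n /\<^sub>R fact n)"
        by (rule scale)
      finally show ?thesis
        using n by simp
    qed
  qed
  finally show ?thesis .
qed

text \<open>The exponential series is integrated term by term; since |t| < 1 almost everywhere, the
  absolute moments are at most 1 and the series of exp |z| dominates.\<close>

lemma has_bochner_integral_mehler_exp: "has_bochner_integral mehler (\<lambda>t. exp (of_real t * z)) (\<E> z)"
proof (rule has_bochner_integral_sums)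
  interpret prob_space "mehler" by (rule prob_space_mehler)
  have int: "integrable mehler (\<lambda>t. t ^ n)" for n
    using has_bochner_integral_mehler_power[of n] by (simp add: has_bochner_integral_iff)
  have int': "integrable mehler (\<lambda>t. \<bar>t\<bar> ^ n)" for n
    using integrable_abs[OF int[of n]] by (simp add: power_abs)
  have le: "(\<integral>t. \<bar>t\<bar> ^ n \<partial>mehler) \<le> 1" for n
  proof -
    have "(\<integral>t. \<bar>t\<bar> ^ n \<partial>mehler) \<le> (\<integral>t. 1 \<partial>mehler)"
      using AE_mehler by (intro integral_mono_AE int') (auto elim!: eventually_mono intro!: power_le_one)
    then show ?thesis by (simp add: prob_space del: space_mehler)
  qed
  show "has_bochner_integral mehler (\<lambda>t. of_real (t ^ n) * (z ^ n /\<^sub>R fact n))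
     (of_real (pochhammer (1 / 2) (Suc n div 2) / pochhammer (\<kappa> + 1) (Suc n div 2)) * (z ^ n /\<^sub>R fact n))" for n
    by (intro has_bochner_integral_mult_left has_bochner_integral_of_real has_bochner_integral_mehler_power \<kappa>)
  show "has_bochner_integral mehler (\<lambda>t. \<bar>t\<bar> ^ n * (norm z ^ n /\<^sub>R fact n))
     ((\<integral>t. \<bar>t\<bar> ^ n \<partial>mehler) * (norm z ^ n /\<^sub>R fact n))" for n
    by (intro has_bochner_integral_mult_left has_bochner_integral_integrable int')
  show "norm (of_real (t ^ n) * (z ^ n /\<^sub>R fact n)) \<le> \<bar>t\<bar> ^ n * (norm z ^ n /\<^sub>R fact n)" for t :: real and n
    by (simp add: norm_mult norm_power power_abs)
  show "summable (\<lambda>n. (\<integral>t. \<bar>t\<bar> ^ n \<partial>mehler) * (norm z ^ n /\<^sub>R fact n))"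
  proof (rule summable_comparison_test')
    show "summable (\<lambda>n. norm z ^ n /\<^sub>R fact n)"
      using exp_converges[of "norm z"] by (rule sums_summable)
    show "norm ((\<integral>t. \<bar>t\<bar> ^ n \<partial>mehler) * (norm z ^ n /\<^sub>R fact n)) \<le> norm z ^ n /\<^sub>R fact n" for n
      using mult_right_mono[OF le[of n], of "norm z ^ n /\<^sub>R fact n"]
      by (simp add: abs_mult)
  qed
  fix t :: real
  have eq: "of_real (t ^ n) * (z ^ n /\<^sub>R fact n) = (of_real t * z) ^ n /\<^sub>R fact n" for n
    by (simp add: power_mult_distrib)
  show "summable (\<lambda>n. norm (of_real (t ^ n) * (z ^ n /\<^sub>R fact n)))"
    unfolding eq by (rule summable_norm_exp)
  show "(\<lambda>n. of_real (t ^ n) * (z ^ n /\<^sub>R fact n)) sums exp (of_real t * z)"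
    unfolding eq by (rule exp_converges)
qed (rule dunkl_kernel_sums)

lemma norm_dunkl_kernel_le: "norm (\<E> z) \<le> exp \<bar>Re z\<bar>"
proof -
  interpret prob_space "mehler" by (rule prob_space_mehler)
  note E = has_bochner_integral_mehler_exp[of z]
  have "norm (\<E> z) \<le> (\<integral>t. norm (exp (of_real t * z)) \<partial>mehler)"
    using E integral_norm_bound[of "mehler" "\<lambda>t. exp (of_real t * z)"] by (simp add: has_bochner_integral_iff)
  also have "\<dots> \<le> (\<integral>t. exp \<bar>Re z\<bar> \<partial>mehler)"
  proof (rule integral_mono_AE)
    show "integrable mehler (\<lambda>t. norm (exp (of_real t * z)))"
      by (rule integrable_norm) (use E in \<open>simp add: has_bochner_integral_iff\<close>)
    show "AE t in mehler. norm (exp (of_real t * z)) \<le> exp \<bar>Re z\<bar>"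
      using AE_mehler
    proof eventually_elim
      case (elim t)
      have "t * Re z \<le> \<bar>t\<bar> * \<bar>Re z\<bar>"
        by (simp flip: abs_mult)
      also have "\<dots> \<le> 1 * \<bar>Re z\<bar>"
        using elim by (intro mult_right_mono) auto
      finally have "t * Re z \<le> 1 * \<bar>Re z\<bar>" .
      then show ?case by (simp add: norm_exp_eq_Re)
    qed
  qed simp
  finally show ?thesis by (simp add: prob_space del: space_mehler)
qed

lemma norm_dunkl_kernel_imaginary_le:
  assumes "Re z = 0"
  shows "norm (\<E> z) \<le> 1"
  using norm_dunkl_kernel_le[of z] assms by simp

section \<open>The weighted measure\<close>

definition dunkl_weight :: "real \<Rightarrow> real" where
  "dunkl_weight x = \<bar>x\<bar> powr (2 * \<kappa> + 1) / (2 powr (\<kappa> + 1) * Gamma (\<kappa> + 1))"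

lemma measurable_dunkl_weight [measurable]: "dunkl_weight \<in> borel_measurable borel"
  unfolding dunkl_weight_def by measurable

lemma dunkl_weight_nonneg: "dunkl_weight x \<ge> 0"
  using \<kappa>1 by (simp add: dunkl_weight_def Gamma_real_nonneg)

lemma dunkl_measure_eq: "\<mu> = density lebesgue (\<lambda>x. ennreal (dunkl_weight x))"
  by (simp add: dunkl_measure_def dunkl_weight_def)

lemma sets_dunkl_measure [measurable_cong]: "sets \<mu> = sets lebesgue"
  and space_dunkl_measure [simp]: "space \<mu> = UNIV"
  by (simp_all add: dunkl_measure_def)

lemma measurable_ident_dunkl: "(\<lambda>x. x) \<in> borel_measurable \<mu>"
  by (simp add: measurable_def sets_dunkl_measure)

lemma measurable_dunkl_measureI: "f \<in> measurable borel M \<Longrightarrow> f \<in> measurable \<mu> M"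
  using measurable_compose[OF measurable_ident_dunkl] by blast

lemma measurable_lebesgue_dunkl_weight: "dunkl_weight \<in> borel_measurable lebesgue"
  by (rule measurable_completion) simp

lemma nn_integral_dunkl_measure:
  assumes [measurable]: "f \<in> borel_measurable borel"
  shows "(\<integral>\<^sup>+x. f x \<partial>\<mu>) = (\<integral>\<^sup>+x. ennreal (dunkl_weight x) * f x \<partial>lborel)"
  unfolding dunkl_measure_eq
  by (subst nn_integral_density)
    (auto simp: nn_integral_completion intro!: measurable_completion[of _ lborel] measurable_lebesgue_dunkl_weight)

lemma integral_dunkl_measure:
  fixes f :: "real \<Rightarrow> 'a::{banach,second_countable_topology}"
  assumes [measurable]: "f \<in> borel_measurable borel"
  shows "(\<integral>x. f x \<partial>\<mu>) = (\<integral>x. dunkl_weight x *\<^sub>R f x \<partial>lborel)"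
  unfolding dunkl_measure_eq
  by (subst integral_density)
     (auto simp: integral_completion dunkl_weight_nonneg
       intro!: measurable_completion[of _ lborel] measurable_lebesgue_dunkl_weight)

lemma integral_dunkl_measure_reflect:
  fixes f :: "real \<Rightarrow> 'a::{banach,second_countable_topology}"
  assumes [measurable]: "f \<in> borel_measurable borel"
  shows "(\<integral>x. f (- x) \<partial>\<mu>) = (\<integral>x. f x \<partial>\<mu>)"
  using lborel_integral_real_affine[of "-1" "\<lambda>x. dunkl_weight x *\<^sub>R f x" 0] \<kappa>
  by (simp add: integral_dunkl_measure) (simp add: dunkl_weight_def)

lemma AE_dunkl_measure:
  assumes "AE x in lebesgue. P x"
  shows "AE x in \<mu>. P x"
  unfolding dunkl_measure_eq using assms
  by (subst AE_density) (auto intro!: measurable_compose[OF measurable_lebesgue_dunkl_weight])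

lemma AE_dunkl_measure_nonzero: "AE x in \<mu>. x \<noteq> 0"
  by (intro AE_dunkl_measure AE_completion AE_lborel_singleton)

lemma sigma_finite_dunkl_measure: "sigma_finite_measure \<mu>"
proof -
  interpret sigma_finite_measure "lebesgue :: real measure" by (rule sigma_finite_lebesgue)
  show ?thesis
    unfolding dunkl_measure_eq
    by (subst sigma_finite_iff_density_finite) (auto intro!: measurable_compose[OF measurable_lebesgue_dunkl_weight])
qed

text \<open>Under exp(-s x^2) d\<mu> the variable s x^2 has Gamma moments of shape \<kappa> + 1. The
  normalisation of the measure is the one that gives exp(-x^2 / 2) mass 1.\<close>

lemma has_bochner_integral_gaussian_moment:
  assumes "s > 0"
  shows "has_bochner_integral \<mu> (\<lambda>x. exp (- s * x\<^sup>2) * (s * x\<^sup>2) ^ k)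
    ((2 * s) powr (- \<kappa> - 1) * pochhammer (\<kappa> + 1) k)"
proof (rule has_bochner_integral_nn_integral)
  let ?C = "2 powr (\<kappa> + 1) * Gamma (\<kappa> + 1)"
  have G: "Gamma (\<kappa> + 1) > 0"
    using \<kappa> assms by (simp add: Gamma_real_pos)
  have ph: "pochhammer (\<kappa> + 1) k = Gamma (\<kappa> + 1 + real k) / Gamma (\<kappa> + 1)"
    using \<kappa> assms by (intro pochhammer_Gamma) (auto elim!: nonpos_Ints_cases)
  have "(\<integral>\<^sup>+x. ennreal (exp (- s * x\<^sup>2) * (s * x\<^sup>2) ^ k) \<partial>\<mu>)
     = (\<integral>\<^sup>+x. ennreal (1 / ?C) * ennreal (\<bar>x\<bar> powr (2 * \<kappa> + 1) * (exp (- s * x\<^sup>2) * (s * x\<^sup>2) ^ k)) \<partial>lborel)"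
    using \<kappa> assms G by (subst nn_integral_dunkl_measure)
      (auto simp: dunkl_weight_def ennreal_mult'[symmetric] intro!: nn_integral_cong)
  also have "\<dots> = ennreal (1 / ?C) * ennreal (s powr (- \<kappa> - 1) * Gamma (\<kappa> + 1 + real k))"
    by (subst nn_integral_cmult) (simp_all only: nn_integral_weighted_gaussian[OF \<kappa>1(1) assms] refl, measurable)
  also have "\<dots> = ennreal ((2 * s) powr (- \<kappa> - 1) * pochhammer (\<kappa> + 1) k)"
  proof -
    have "(2 * s) powr (- \<kappa> - 1) = s powr (- \<kappa> - 1) / 2 powr (\<kappa> + 1)"
      using \<kappa> assms powr_minus_divide[of 2 "\<kappa> + 1"] by (simp add: powr_mult)
    moreover have "1 / ?C \<ge> 0"
      using G by (intro divide_nonneg_nonneg) auto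
    ultimately show ?thesis
      by (simp only: ennreal_mult'[symmetric]) (simp add: ph mult_ac)
  qed
  finally show "(\<integral>\<^sup>+x. ennreal (exp (- s * x\<^sup>2) * (s * x\<^sup>2) ^ k) \<partial>\<mu>) = \<dots>" .
qed (use \<kappa> assms in \<open>auto intro!: measurable_dunkl_measureI mult_nonneg_nonneg pochhammer_nonneg AE_I2\<close>)

text \<open>Completing the square gives c |x| \<le> c^2 / (2 s) + s x^2 / 2, so half of the Gaussian
  absorbs the exponential.\<close>

lemma integrable_dunkl_exp_gaussian:
  assumes "s > 0"
  shows "integrable \<mu> (\<lambda>x. exp (c * \<bar>x\<bar>) * exp (- s * x\<^sup>2))"
proof (rule Bochner_Integration.integrable_bound)
  show "integrable \<mu> (\<lambda>x. exp (c\<^sup>2 / (2 * s)) * (exp (- (s / 2) * x\<^sup>2) * (s / 2 * x\<^sup>2) ^ 0))"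
    using has_bochner_integral_gaussian_moment[of "s / 2" 0] assms
    by (intro integrable_mult_right) (simp add: has_bochner_integral_iff)
  show "AE x in \<mu>. norm (exp (c * \<bar>x\<bar>) * exp (- s * x\<^sup>2))
      \<le> norm (exp (c\<^sup>2 / (2 * s)) * (exp (- (s / 2) * x\<^sup>2) * (s / 2 * x\<^sup>2) ^ 0))"
  proof (intro AE_I2)
    fix x :: real
    have "0 \<le> (s * \<bar>x\<bar> - c)\<^sup>2 / (2 * s)"
      using \<kappa> assms by simp
    also have "(s * \<bar>x\<bar> - c)\<^sup>2 / (2 * s) = c\<^sup>2 / (2 * s) + (s / 2) * x\<^sup>2 - c * \<bar>x\<bar>"
      using \<kappa> assms by (simp add: power2_diff field_simps power2_eq_square abs_mult_self_eq)
    finally show "norm (exp (c * \<bar>x\<bar>) * exp (- s * x\<^sup>2))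
      \<le> norm (exp (c\<^sup>2 / (2 * s)) * (exp (- (s / 2) * x\<^sup>2) * (s / 2 * x\<^sup>2) ^ 0))"
      by (simp add: exp_add[symmetric])
  qed
qed (auto intro!: measurable_dunkl_measureI)

text \<open>The weight is even, so F may be replaced by its even part G. This discards the mixed
  even-odd products of two Dunkl kernels without integrating them.\<close>

lemma has_bochner_integral_dunkl_symmetrize:
  fixes F G :: "real \<Rightarrow> 'a::{banach,second_countable_topology}"
  assumes meas: "F \<in> borel_measurable borel" and int: "integrable \<mu> F"
    and G: "has_bochner_integral \<mu> G I" and sum: "\<And>x. F x + F (- x) = 2 *\<^sub>R G x"
  shows "has_bochner_integral \<mu> F I"
proof -
  have "integrable \<mu> (\<lambda>x. 2 *\<^sub>R G x - F x)"
    by (intro Bochner_Integration.integrable_diff integrable_scaleR_right integrable.intros[OF G] int)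
  then have int': "integrable \<mu> (\<lambda>x. F (- x))"
    by (simp flip: sum)
  have "2 *\<^sub>R (\<integral>x. F x \<partial>\<mu>) = (\<integral>x. F x \<partial>\<mu>) + (\<integral>x. F (- x) \<partial>\<mu>)"
    unfolding integral_dunkl_measure_reflect[OF meas] by (simp add: scaleR_2)
  also have "\<dots> = (\<integral>x. F x + F (- x) \<partial>\<mu>)"
    by (rule Bochner_Integration.integral_add[OF int int', symmetric])
  also have "\<dots> = 2 *\<^sub>R I"
    using G by (simp add: sum has_bochner_integral_iff)
  finally show ?thesis
    using int by (simp add: has_bochner_integral_iff)
qed

text \<open>The additional x^2 raises the Gamma shape to \<kappa> + 2, by (\<kappa> + 1)_(k+1) =
  (\<kappa> + 1) (\<kappa> + 2)_k. This is the weight met by a product of two odd parts.\<close>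

lemma has_bochner_integral_gaussian_moment_square:
  assumes "s > 0"
  shows "has_bochner_integral \<mu> (\<lambda>x. exp (- s * x\<^sup>2) * x\<^sup>2 * (s * x\<^sup>2) ^ k)
     ((2 * s) powr (- \<kappa> - 1) * (\<kappa> + 1) / s * pochhammer (\<kappa> + 2) k)"
  using has_bochner_integral_divide_zero[OF has_bochner_integral_gaussian_moment[OF assms, of "Suc k"], of s] assms
  by (simp add: pochhammer_rec add.assoc mult_ac)

lemma norm_dunkl_kernel_mult_le: "norm (\<E> (c * of_real x)) \<le> exp (norm c * \<bar>x\<bar>)"
  using norm_dunkl_kernel_le[of "c * of_real x"] abs_Re_le_cmod[of "c * of_real x"]
  by (simp add: norm_mult) (meson exp_le_cancel_iff order_trans)

text \<open>A Dunkl form of Weber's second exponential integral. The product of the even parts is a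
  Gamma expectation of shape \<kappa> + 1, that of the odd parts one of shape \<kappa> + 2; the two
  values are the even and the odd part of the Dunkl kernel at a b / (2 s).\<close>

lemma has_bochner_integral_dunkl_kernel_gaussian:
  fixes a b :: complex
  assumes s: "s > 0"
  shows "has_bochner_integral \<mu>
    (\<lambda>x. of_real (exp (- s * x\<^sup>2)) * (\<E> (a * of_real x) * \<E> (b * of_real x)))
    (of_real ((2 * s) powr (- \<kappa> - 1)) * (exp ((a\<^sup>2 + b\<^sup>2) / of_real (4 * s)) * \<E> (a * b / of_real (2 * s))))"
proof -
  let ?F = "\<lambda>x. of_real (exp (- s * x\<^sup>2)) * (\<E> (a * of_real x) * \<E> (b * of_real x))"
  let ?C = "(2 * s) powr (- \<kappa> - 1)"
  let ?e = "exp ((a\<^sup>2 + b\<^sup>2) / of_real (4 * s))"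
  let ?A = "\<lambda>x. of_real (exp (- s * x\<^sup>2)) * (hyp0F1 (\<kappa> + 1) ((a * of_real x)\<^sup>2 / 4) * hyp0F1 (\<kappa> + 1) ((b * of_real x)\<^sup>2 / 4))"
  let ?B = "\<lambda>x. of_real (exp (- s * x\<^sup>2) * x\<^sup>2) * (hyp0F1 (\<kappa> + 2) ((a * of_real x)\<^sup>2 / 4) * hyp0F1 (\<kappa> + 2) ((b * of_real x)\<^sup>2 / 4))"
  let ?c = "a * b / (of_real (2 * (\<kappa> + 1)))\<^sup>2"
  let ?P = "of_real ?C * (?e * hyp0F1 (\<kappa> + 1) ((a * b / of_real (2 * s))\<^sup>2 / 4))"
  let ?Q = "of_real (?C * (\<kappa> + 1) / s) * (?e * hyp0F1 (\<kappa> + 2) ((a * b / of_real (2 * s))\<^sup>2 / 4))"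
  note [measurable] = measurable_dunkl_kernel
  have meas [measurable]: "?F \<in> borel_measurable borel"
    by measurable
  have int: "integrable \<mu> ?F"
  proof (rule Bochner_Integration.integrable_bound)
    show "integrable \<mu> (\<lambda>x. exp ((norm a + norm b) * \<bar>x\<bar>) * exp (- s * x\<^sup>2))"
      by (rule integrable_dunkl_exp_gaussian[OF s])
    show "AE x in \<mu>. norm (?F x) \<le> norm (exp ((norm a + norm b) * \<bar>x\<bar>) * exp (- s * x\<^sup>2))"
    proof (intro AE_I2)
      fix x :: real
      have "norm (\<E> (a * of_real x)) * norm (\<E> (b * of_real x))
         \<le> exp (norm a * \<bar>x\<bar>) * exp (norm b * \<bar>x\<bar>)"
        by (intro mult_mono norm_dunkl_kernel_mult_le) auto
      then show "norm (?F x) \<le> norm (exp ((norm a + norm b) * \<bar>x\<bar>) * exp (- s * x\<^sup>2))"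
        by (simp add: norm_mult distrib_left exp_add mult.commute)
    qed
  qed (rule measurable_dunkl_measureI[OF meas])
  have scale: "c\<^sup>2 / of_real (4 * s) * of_real (s * x\<^sup>2) = (c * of_real x)\<^sup>2 / 4" for c :: complex and x
    using s by (simp add: power_mult_distrib)
  have prod: "a\<^sup>2 / of_real (4 * s) * (b\<^sup>2 / of_real (4 * s)) = (a * b / of_real (2 * s))\<^sup>2 / 4"
    by (simp add: power_divide power_mult_distrib power2_eq_square)
  have even: "has_bochner_integral \<mu> ?A ?P"
    using has_bochner_integral_hyp0F1_mult[OF \<kappa>1(2) has_bochner_integral_gaussian_moment[OF s],
        of "a\<^sup>2 / of_real (4 * s)" "b\<^sup>2 / of_real (4 * s)"] s
    unfolding scale prod add_divide_distrib[symmetric] by simp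
  have "has_bochner_integral \<mu> ?B ?Q"
    using has_bochner_integral_hyp0F1_mult[OF \<kappa>1(3) has_bochner_integral_gaussian_moment_square[OF s],
        of "a\<^sup>2 / of_real (4 * s)" "b\<^sup>2 / of_real (4 * s)"] s
    unfolding scale prod add_divide_distrib[symmetric] by simp
  then have odd: "has_bochner_integral \<mu> (\<lambda>x. ?c * ?B x) (?c * ?Q)"
    by (rule has_bochner_integral_mult_right)
  have sum: "2 * (?A x + ?c * ?B x) = ?F x + ?F (- x)" for x
  proof -
    have "2 * (g * (A * B) + a * b / q\<^sup>2 * (g * X\<^sup>2 * (A' * B')))
       = g * ((A + a * X / q * A') * (B + b * X / q * B')) + g * ((A + - (a * X) / q * A') * (B + - (b * X) / q * B'))"
      for g A A' B B' X q :: complex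
      by (simp add: divide_inverse power2_eq_square algebra_simps)
    then show ?thesis
      unfolding dunkl_kernel_eq_hyp0F1 by simp
  qed
  have "has_bochner_integral \<mu> ?F (?P + ?c * ?Q)"
    by (rule has_bochner_integral_dunkl_symmetrize[OF meas int has_bochner_integral_add[OF even odd]])
       (simp only: sum[symmetric] scaleR_2 mult_2)
  also have "?P + ?c * ?Q = of_real ?C * (?e * \<E> (a * b / of_real (2 * s)))"
  proof -
    have "?c * of_real (?C * (\<kappa> + 1) / s)
       = of_real ?C * (a * b / of_real (2 * s) / of_real (2 * (\<kappa> + 1)))"
    proof -
      have "(\<kappa> + 1) / s / (2 * (\<kappa> + 1))\<^sup>2 = 1 / (2 * s) / (2 * (\<kappa> + 1))"
      proof -
        have "k / s / (2 * k)\<^sup>2 = 1 / (2 * s) / (2 * k)" if "k > 0" for k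
          using that s by (simp add: field_simps power2_eq_square)
        then show ?thesis using \<kappa>1 by blast
      qed
      then have "complex_of_real ((\<kappa> + 1) / s / (2 * (\<kappa> + 1))\<^sup>2) = of_real (1 / (2 * s) / (2 * (\<kappa> + 1)))"
        by simp
      then have "a * b * of_real ?C * complex_of_real ((\<kappa> + 1) / s / (2 * (\<kappa> + 1))\<^sup>2) = a * b * of_real ?C * of_real (1 / (2 * s) / (2 * (\<kappa> + 1)))"
        by simp
      then show ?thesis
        unfolding of_real_divide of_real_mult of_real_power by (simp only: divide_inverse mult_ac of_real_1 mult_1_left)
    qed
    then show ?thesis
      unfolding dunkl_kernel_eq_hyp0F1
      by (simp only: distrib_left mult.assoc[symmetric]) (simp only: mult_ac)
  qed
  finally show ?thesis .
qed

text \<open>Only the odd part of the kernel survives against the odd Gaussian. It is the shape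
  \<kappa> + 2 integral with the second argument 0, so no Bessel function remains in the
  value.\<close>

lemma has_bochner_integral_dunkl_kernel_odd_gaussian:
  fixes a :: complex
  assumes s: "s > 0"
  shows "has_bochner_integral \<mu> (\<lambda>x. of_real (x * exp (- s * x\<^sup>2)) * \<E> (a * of_real x))
    (a * of_real ((2 * s) powr (- \<kappa> - 2)) * exp (a\<^sup>2 / of_real (4 * s)))"
proof -
  let ?F = "\<lambda>x. of_real (x * exp (- s * x\<^sup>2)) * \<E> (a * of_real x)"
  let ?C = "(2 * s) powr (- \<kappa> - 1)"
  note [measurable] = measurable_dunkl_kernel
  have meas [measurable]: "?F \<in> borel_measurable borel"
    by measurable
  have int: "integrable \<mu> ?F"
  proof (rule Bochner_Integration.integrable_bound)
    show "integrable \<mu> (\<lambda>x. exp ((norm a + 1) * \<bar>x\<bar>) * exp (- s * x\<^sup>2))"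
      by (rule integrable_dunkl_exp_gaussian[OF s])
    show "AE x in \<mu>. norm (?F x) \<le> norm (exp ((norm a + 1) * \<bar>x\<bar>) * exp (- s * x\<^sup>2))"
    proof (intro AE_I2)
      fix x :: real
      have "\<bar>x\<bar> \<le> exp \<bar>x\<bar>"
        using exp_ge_add_one_self[of "\<bar>x\<bar>"] by linarith
      then have "\<bar>x\<bar> * norm (\<E> (a * of_real x)) \<le> exp \<bar>x\<bar> * exp (norm a * \<bar>x\<bar>)"
        by (intro mult_mono norm_dunkl_kernel_mult_le) auto
      then show "norm (?F x) \<le> norm (exp ((norm a + 1) * \<bar>x\<bar>) * exp (- s * x\<^sup>2))"
        by (simp add: norm_mult abs_mult distrib_left exp_add mult_ac)
    qed
  qed (rule measurable_dunkl_measureI[OF meas])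
  have scale: "c\<^sup>2 / of_real (4 * s) * of_real (s * x\<^sup>2) = (c * of_real x)\<^sup>2 / 4" for c :: complex and x
    using s by (simp add: power_mult_distrib)
  have "has_bochner_integral \<mu>
     (\<lambda>x. of_real (exp (- s * x\<^sup>2) * x\<^sup>2) * hyp0F1 (\<kappa> + 2) ((a * of_real x)\<^sup>2 / 4))
     (of_real (?C * (\<kappa> + 1) / s) * exp (a\<^sup>2 / of_real (4 * s)))"
    using has_bochner_integral_hyp0F1_mult[OF \<kappa>1(3) has_bochner_integral_gaussian_moment_square[OF s],
        of "a\<^sup>2 / of_real (4 * s)" 0] s
    unfolding scale by simp
  then have odd: "has_bochner_integral \<mu>
     (\<lambda>x. a / of_real (2 * (\<kappa> + 1)) * (of_real (exp (- s * x\<^sup>2) * x\<^sup>2) * hyp0F1 (\<kappa> + 2) ((a * of_real x)\<^sup>2 / 4)))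
     (a / of_real (2 * (\<kappa> + 1)) * (of_real (?C * (\<kappa> + 1) / s) * exp (a\<^sup>2 / of_real (4 * s))))"
    by (rule has_bochner_integral_mult_right)
  have "has_bochner_integral \<mu> ?F
     (a / of_real (2 * (\<kappa> + 1)) * (of_real (?C * (\<kappa> + 1) / s) * exp (a\<^sup>2 / of_real (4 * s))))"
  proof (rule has_bochner_integral_dunkl_symmetrize[OF meas int odd])
    fix x
    have "X * g * (A + a * X / q * A') + - X * g * (A + - (a * X) / q * A') = 2 * (a / q * (g * X\<^sup>2 * A'))"
      for X g A A' q :: complex
      by (simp add: divide_inverse power2_eq_square algebra_simps)
    then show "?F x + ?F (- x) = 2 *\<^sub>R (a / of_real (2 * (\<kappa> + 1)) * (of_real (exp (- s * x\<^sup>2) * x\<^sup>2) * hyp0F1 (\<kappa> + 2) ((a * of_real x)\<^sup>2 / 4)))"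
      unfolding dunkl_kernel_eq_hyp0F1 by (simp add: scaleR_conv_of_real)
  qed
  also have "a / of_real (2 * (\<kappa> + 1)) * (of_real (?C * (\<kappa> + 1) / s) * exp (a\<^sup>2 / of_real (4 * s)))
     = a * of_real (?C / (2 * s)) * exp (a\<^sup>2 / of_real (4 * s))"
  proof -
    have "C * k / s / (2 * k) = C / (2 * s)" if "k > 0" for C k
      using that s by (simp add: field_simps)
    from this[OF \<kappa>1(2)] have "complex_of_real (?C * (\<kappa> + 1) / s / (2 * (\<kappa> + 1))) = of_real (?C / (2 * s))"
      by simp
    then have "of_real (?C * (\<kappa> + 1) / s) / of_real (2 * (\<kappa> + 1)) = complex_of_real (?C / (2 * s))"
      by (simp only: of_real_divide)
    moreover have "a / q * (c * d) = a * (c / q) * d" for q c d :: complex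
      by simp
    ultimately show ?thesis by metis
  qed
  also have "?C / (2 * s) = (2 * s) powr (- \<kappa> - 2)"
    using s powr_diff[of "2 * s" "- \<kappa> - 1" 1] by (simp add: algebra_simps)
  finally show ?thesis .
qed

text \<open>The sign of \<open>h\<close> is an almost everywhere limit of continuous functions, and the even and the odd
  part of a continuous function vanishing near \<open>0\<close> and \<open>\<infinity>\<close> have the form \<open>\<phi> (x\<^sup>2)\<close> and \<open>x * \<phi> (x\<^sup>2)\<close>.\<close>

lemma gaussian_total_real:
  fixes h :: "real \<Rightarrow> real"
  assumes meas: "h \<in> borel_measurable \<mu>"
    and int0: "integrable \<mu> (\<lambda>x. exp (- x\<^sup>2) * h x)"
    and int1: "integrable \<mu> (\<lambda>x. exp (- x\<^sup>2) * (x * h x))"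
    and zero0: "\<And>s. s > 0 \<Longrightarrow> (\<integral>x. exp (- s * x\<^sup>2) * h x \<partial>\<mu>) = 0"
    and zero1: "\<And>s. s > 0 \<Longrightarrow> (\<integral>x. exp (- s * x\<^sup>2) * (x * h x) \<partial>\<mu>) = 0"
  shows "AE x in \<mu>. h x = 0"
proof -
  have measM: "f \<in> borel_measurable \<mu>" if "f \<in> borel_measurable borel" for f :: "real \<Rightarrow> real"
    using that by (rule measurable_dunkl_measureI)
  have meas1: "(\<lambda>x. x * h x) \<in> borel_measurable \<mu>"
    by (intro borel_measurable_times measurable_ident_dunkl meas)
  have sq: "(\<lambda>x. x\<^sup>2) \<in> borel_measurable \<mu>"
    by (intro borel_measurable_power measurable_ident_dunkl)
  have lap: "integrable \<mu> (\<lambda>x. \<phi> (x\<^sup>2) * w x) \<and> (\<integral>x. \<phi> (x\<^sup>2) * w x \<partial>\<mu>) = 0"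
    if c: "continuous_on UNIV \<phi>" and z: "\<And>u. u \<ge> b \<Longrightarrow> \<phi> u = 0" and w: "w \<in> borel_measurable \<mu>"
      and int: "integrable \<mu> (\<lambda>x. exp (- x\<^sup>2) * w x)"
      and zero: "\<And>s. s > 0 \<Longrightarrow> (\<integral>x. exp (- s * x\<^sup>2) * w x \<partial>\<mu>) = 0"
    for \<phi> w :: "real \<Rightarrow> real" and b
  proof
    show "integrable \<mu> (\<lambda>x. \<phi> (x\<^sup>2) * w x)"
      using integrable_laplace_test[OF c z sq w] int by simp
    have "(\<integral>x. \<phi> (x\<^sup>2) *\<^sub>R w x \<partial>\<mu>) = (\<integral>x. \<phi> (x\<^sup>2) *\<^sub>R (0::real) \<partial>\<mu>)"
    proof (rule laplace_transform_unique[where b = b and M = \<mu> and N = \<mu> and w = w and w' = "\<lambda>_. 0"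
          and u = "\<lambda>x. x\<^sup>2" and u' = "\<lambda>x. x\<^sup>2"])
      show "(\<integral>x. exp (- real n * x\<^sup>2) *\<^sub>R w x \<partial>\<mu>) = (\<integral>x. exp (- real n * x\<^sup>2) *\<^sub>R 0 \<partial>\<mu>)"
        if "n > 0" for n
        using zero[of "real n"] that by simp
    qed (use c z sq w int in auto)
    then show "(\<integral>x. \<phi> (x\<^sup>2) * w x \<partial>\<mu>) = 0"
      by simp
  qed
  have test: "(\<integral>x. \<theta> x * h x \<partial>\<mu>) = 0"
    if cont: "continuous_on UNIV \<theta>" and a: "a > 0" and b: "b > 0"
      and near: "\<And>x. \<bar>x\<bar> \<le> a \<Longrightarrow> \<theta> x = 0" and far: "\<And>x. \<bar>x\<bar> \<ge> b \<Longrightarrow> \<theta> x = 0"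
    for \<theta> :: "real \<Rightarrow> real" and a b
  proof -
    define \<phi>0 where "\<phi>0 u = (\<theta> (sqrt u) + \<theta> (- sqrt u)) / 2" for u
    \<comment> \<open>Bounding the denominator below by a keeps \<open>\<phi>1\<close> continuous at
      0; where the maximum takes effect, \<theta> vanishes anyway.\<close>
    define \<phi>1 where "\<phi>1 u = (\<theta> (sqrt u) - \<theta> (- sqrt u)) / (2 * max (sqrt u) a)" for u
    have c: "continuous_on UNIV \<phi>0" "continuous_on UNIV \<phi>1"
    proof -
      have "max (sqrt u) a \<noteq> 0" for u
        using a by linarith
      then show "continuous_on UNIV \<phi>0" "continuous_on UNIV \<phi>1"
        unfolding \<phi>0_def \<phi>1_def
        by (auto intro!: continuous_intros continuous_on_compose2[OF cont])
    qed
    have z: "\<phi>0 u = 0" "\<phi>1 u = 0" if "u \<ge> b\<^sup>2" for u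
    proof -
      have "sqrt u \<ge> b" using that b by (simp add: real_le_rsqrt)
      then show "\<phi>0 u = 0" "\<phi>1 u = 0" using far[of "sqrt u"] far[of "- sqrt u"] b
        by (auto simp: \<phi>0_def \<phi>1_def)
    qed
    note \<phi>0 = lap[OF c(1) z(1) meas int0 zero0] and \<phi>1 = lap[OF c(2) z(2) meas1 int1 zero1]
    have dec: "\<theta> x = \<phi>0 (x\<^sup>2) + \<phi>1 (x\<^sup>2) * x" for x
    proof (cases "\<bar>x\<bar> \<le> a")
      case True
      then show ?thesis using near[of x] near[of "- x"] near[of "\<bar>x\<bar>"] near[of "- \<bar>x\<bar>"] by (simp add: \<phi>0_def \<phi>1_def)
    next
      case False
      then show ?thesis using a by (cases "x \<ge> 0") (auto simp: \<phi>0_def \<phi>1_def max_def field_simps)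
    qed
    have "(\<integral>x. \<theta> x * h x \<partial>\<mu>) = (\<integral>x. \<phi>0 (x\<^sup>2) * h x + \<phi>1 (x\<^sup>2) * (x * h x) \<partial>\<mu>)"
      by (simp add: dec distrib_right mult.assoc)
    also have "\<dots> = 0"
      using \<phi>0 \<phi>1 by simp
    finally show ?thesis .
  qed
  have "(\<lambda>x. sgn (h x)) \<in> borel_measurable lebesgue"
    using meas by (auto simp: measurable_cong_sets[OF sets_dunkl_measure refl])
  then have "(\<lambda>x. sgn (h x)) measurable_on UNIV"
    by (intro lebesgue_measurable_imp_measurable_on) auto
  then obtain N g where N: "negligible N" and g: "\<And>n. continuous_on UNIV (g n)"
      "\<And>x. x \<notin> N \<Longrightarrow> (\<lambda>n. g n x) \<longlonglongrightarrow> sgn (h x)"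
    unfolding measurable_on_def by auto
  have AE_N: "AE x in \<mu>. x \<notin> N"
    using N by (intro AE_dunkl_measure AE_not_in) (simp add: negligible_iff_null_sets)
  \<comment> \<open>Continuous cutoffs that are positive exactly for 1/(m+1) < |x| < m+1. They
    exhaust the nonzero reals and allow division by x in the odd part.\<close>
  define c where "c m x = max 0 (min (\<bar>x\<bar> - 1 / real (Suc m)) (real (Suc m) - \<bar>x\<bar>))" for m x
  have c_le: "c m x \<le> real (Suc m) * exp ((real (Suc m))\<^sup>2) * exp (- x\<^sup>2)" for m x
  proof (cases "\<bar>x\<bar> \<le> real (Suc m)")
    case True
    then have "x\<^sup>2 \<le> (real (Suc m))\<^sup>2"
      by (metis abs_ge_zero power2_abs power_mono)
    then have "1 \<le> exp ((real (Suc m))\<^sup>2) * exp (- x\<^sup>2)"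
      by (simp flip: exp_add)
    then have "real (Suc m) * 1 \<le> real (Suc m) * (exp ((real (Suc m))\<^sup>2) * exp (- x\<^sup>2))"
      by (rule mult_left_mono) simp
    moreover have "c m x \<le> real (Suc m)" by (auto simp: c_def)
    ultimately show ?thesis by (simp only: mult.assoc mult_1_right)
  next
    case False
    then have "c m x = 0" by (auto simp: c_def)
    then show ?thesis by simp
  qed
  have c_nn: "c m x \<ge> 0" for m x by (simp add: c_def)
  have measc: "c m \<in> borel_measurable \<mu>" for m
    by (rule measM) (simp add: c_def[abs_def])
  have intc: "integrable \<mu> (\<lambda>x. c m x * \<bar>h x\<bar>)" for m
  proof (rule Bochner_Integration.integrable_bound)
    show "integrable \<mu> (\<lambda>x. (real (Suc m) * exp ((real (Suc m))\<^sup>2)) * norm (exp (- x\<^sup>2) * h x))"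
      using int0 by (intro integrable_mult_right integrable_norm)
    show "AE x in \<mu>. norm (c m x * \<bar>h x\<bar>) \<le> norm (real (Suc m) * exp ((real (Suc m))\<^sup>2) * norm (exp (- x\<^sup>2) * h x))"
    proof (intro AE_I2)
      fix x
      show "norm (c m x * \<bar>h x\<bar>) \<le> norm (real (Suc m) * exp ((real (Suc m))\<^sup>2) * norm (exp (- x\<^sup>2) * h x))"
        using mult_right_mono[OF c_le[of m x], of "\<bar>h x\<bar>"] c_nn[of m x] by (simp add: abs_mult mult.assoc)
    qed
  qed (intro borel_measurable_times borel_measurable_abs measc meas)
  have "AE x in \<mu>. c m x * \<bar>h x\<bar> = 0" for m
  proof -
    \<comment> \<open>Clipping to [-1, 1] supplies the dominating function and does not affect the
      limit, since sgn already takes values there.\<close>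
    define \<theta> where "\<theta> n x = max (- 1) (min 1 (g n x)) * c m x" for n x
    have "(\<integral>x. \<theta> n x * h x \<partial>\<mu>) = 0" for n
    proof (rule test[where a = "1 / real (Suc m)" and b = "real (Suc m)"])
      show "continuous_on UNIV (\<theta> n)"
        unfolding \<theta>_def c_def by (intro continuous_intros g)
    qed (auto simp: \<theta>_def c_def)
    moreover have "(\<lambda>n. \<integral>x. \<theta> n x * h x \<partial>\<mu>) \<longlonglongrightarrow> (\<integral>x. c m x * \<bar>h x\<bar> \<partial>\<mu>)"
    proof (rule integral_dominated_convergence[where w = "\<lambda>x. c m x * \<bar>h x\<bar>"])
      show "(\<lambda>x. \<theta> n x * h x) \<in> borel_measurable \<mu>" for n
        unfolding \<theta>_def
        by (intro borel_measurable_times borel_measurable_max borel_measurable_min borel_measurable_const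
            measM[OF borel_measurable_continuous_onI[OF g(1)]] measc meas)
      show "AE x in \<mu>. (\<lambda>n. \<theta> n x * h x) \<longlonglongrightarrow> c m x * \<bar>h x\<bar>"
        using AE_N
      proof eventually_elim
        fix x assume "x \<notin> N"
        then have "(\<lambda>n. \<theta> n x * h x) \<longlonglongrightarrow> max (- 1) (min 1 (sgn (h x))) * c m x * h x"
          unfolding \<theta>_def by (intro tendsto_intros g)
        also have "max (- 1) (min 1 (sgn (h x))) * c m x * h x = c m x * \<bar>h x\<bar>"
          by (auto simp: sgn_if)
        finally show "(\<lambda>n. \<theta> n x * h x) \<longlonglongrightarrow> c m x * \<bar>h x\<bar>" .
      qed
      show "AE x in \<mu>. norm (\<theta> n x * h x) \<le> c m x * \<bar>h x\<bar>" for n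
      proof (intro AE_I2)
        fix x
        have "\<bar>max (- 1) (min 1 (g n x))\<bar> * (c m x * \<bar>h x\<bar>) \<le> 1 * (c m x * \<bar>h x\<bar>)"
          using c_nn[of m x] by (intro mult_right_mono) auto
        then show "norm (\<theta> n x * h x) \<le> c m x * \<bar>h x\<bar>"
          using c_nn[of m x] by (simp only: \<theta>_def real_norm_def abs_mult mult.assoc abs_of_nonneg mult_1)
      qed
    qed (rule intc borel_measurable_integrable[OF intc])+
    ultimately have "(\<integral>x. c m x * \<bar>h x\<bar> \<partial>\<mu>) = 0"
      by (simp add: LIMSEQ_const_iff)
    then show ?thesis
      using intc[of m] c_nn by (subst (asm) integral_nonneg_eq_0_iff_AE) auto
  qed
  then have "AE x in \<mu>. \<forall>m. c m x * \<bar>h x\<bar> = 0"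
    unfolding AE_all_countable by blast
  then show ?thesis
    using AE_dunkl_measure_nonzero
  proof eventually_elim
    fix x :: real assume c0: "\<forall>m. c m x * \<bar>h x\<bar> = 0" and x: "x \<noteq> 0"
    obtain m where "max \<bar>x\<bar> (1 / \<bar>x\<bar>) < real m"
      using reals_Archimedean2 by blast
    then have m: "\<bar>x\<bar> < real m" "1 / \<bar>x\<bar> < real m" by auto
    then have "1 < real m * \<bar>x\<bar>"
      using x by (simp add: pos_divide_less_eq)
    also have "\<dots> \<le> real (Suc m) * \<bar>x\<bar>"
      by (intro mult_right_mono) auto
    finally have "1 / real (Suc m) < \<bar>x\<bar>"
      by (simp add: pos_divide_less_eq mult.commute)
    then have "c m x \<noteq> 0" using m(1) by (simp add: c_def)
    then show "h x = 0" using c0[rule_format, of m] by simp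
  qed
qed

section \<open>The Dunkl transform\<close>

lemma measurable_dunkl_character: "(\<lambda>(x, l). dunkl_character l x) \<in> borel_measurable (borel \<Otimes>\<^sub>M borel)"
proof -
  note [measurable] = measurable_dunkl_kernel
  show ?thesis by measurable
qed

lemma norm_dunkl_character_le: "norm (dunkl_character l x) \<le> 1"
  using \<kappa> by (intro norm_dunkl_kernel_imaginary_le) auto

lemma measurable_dunkl_character_fst: "(\<lambda>x. dunkl_character l x) \<in> borel_measurable \<mu>"
proof (rule measurable_dunkl_measureI)
  note [measurable] = measurable_dunkl_kernel
  show "(\<lambda>x. dunkl_character l x) \<in> borel_measurable borel" by measurable
qed

lemma integrable_dunkl_character_mult:
  assumes f: "integrable \<mu> f"
  shows "integrable \<mu> (\<lambda>x. dunkl_character l x * f x)"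
proof (rule Bochner_Integration.integrable_bound[OF f])
  show "(\<lambda>x. dunkl_character l x * f x) \<in> borel_measurable \<mu>"
    using \<kappa> f by (intro borel_measurable_times measurable_dunkl_character_fst) auto
  show "AE x in \<mu>. norm (dunkl_character l x * f x) \<le> norm (f x)"
    using norm_dunkl_character_le[of l] by (intro AE_I2) (auto simp: norm_mult intro!: mult_left_le_one_le)
qed

lemma norm_dunkl_transform_le:
  assumes f: "integrable \<mu> f"
  shows "norm (\<F> f l) \<le> (\<integral>x. norm (f x) \<partial>\<mu>)"
  unfolding dunkl_transform_def
proof (rule order_trans[OF integral_norm_bound integral_mono])
  show "integrable \<mu> (\<lambda>x. norm (dunkl_character l x * f x))"
    by (intro integrable_norm integrable_dunkl_character_mult \<kappa> f)
  show "norm (dunkl_character l x * f x) \<le> norm (f x)" for x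
    using norm_dunkl_character_le[of l x] by (auto simp: norm_mult intro!: mult_left_le_one_le)
qed (use f in auto)

lemma measurable_dunkl_transform:
  assumes f: "f \<in> borel_measurable \<mu>"
  shows "\<F> f \<in> borel_measurable borel"
proof -
  interpret sigma_finite_measure \<mu> by (rule sigma_finite_dunkl_measure)
  note [measurable] = measurable_dunkl_kernel
  have "(\<lambda>(l, x). dunkl_character l x) \<in> borel_measurable (borel \<Otimes>\<^sub>M \<mu>)"
    by (rule measurable_pair_borelI[OF _ measurable_ident_dunkl]) measurable
  moreover have "(\<lambda>(l, x). f x) \<in> borel_measurable (borel \<Otimes>\<^sub>M \<mu>)"
    using measurable_compose[OF measurable_snd f] by (simp add: case_prod_unfold)
  ultimately have "(\<lambda>(l, x). dunkl_character l x * f x) \<in> borel_measurable (borel \<Otimes>\<^sub>M \<mu>)"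
    unfolding case_prod_unfold by (rule borel_measurable_times)
  then show ?thesis
    unfolding dunkl_transform_def[abs_def] by (rule borel_measurable_lebesgue_integral)
qed

lemma integrable_dunkl_transform_mult:
  assumes f: "integrable \<mu> f" and g: "integrable \<mu> g"
  shows "integrable \<mu> (\<lambda>l. \<F> f l * g l)"
proof (rule Bochner_Integration.integrable_bound)
  show "integrable \<mu> (\<lambda>l. of_real (\<integral>x. norm (f x) \<partial>\<mu>) * g l)"
    by (intro integrable_mult_right g)
  show "(\<lambda>l. \<F> f l * g l) \<in> borel_measurable \<mu>"
    using f g by (intro borel_measurable_times measurable_dunkl_measureI[OF measurable_dunkl_transform]) auto
  show "AE l in \<mu>. norm (\<F> f l * g l) \<le> norm (complex_of_real (\<integral>x. norm (f x) \<partial>\<mu>) * g l)"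
    using norm_dunkl_transform_le[OF f] by (intro AE_I2) (auto simp: norm_mult intro!: mult_right_mono)
qed

text \<open>Fubini's theorem: the character is symmetric in its two variables and bounded by 1, so
  |f(x)| |g(l)| dominates.\<close>

lemma dunkl_transform_duality:
  assumes f: "integrable \<mu> f" and g: "integrable \<mu> g"
  shows "(\<integral>l. \<F> f l * g l \<partial>\<mu>) = (\<integral>x. f x * \<F> g x \<partial>\<mu>)"
proof -
  interpret sigma_finite_measure \<mu> by (rule sigma_finite_dunkl_measure)
  interpret pair_sigma_finite \<mu> \<mu> ..
  let ?F = "\<lambda>x l. dunkl_character l x * (f x * g l)"
  have int: "integrable (\<mu> \<Otimes>\<^sub>M \<mu>) (\<lambda>(x, l). ?F x l)"
  proof (rule Fubini_integrable)
    have "(\<lambda>(x, l). f x * g l) \<in> borel_measurable (\<mu> \<Otimes>\<^sub>M \<mu>)"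
      using f g unfolding case_prod_unfold
      by (intro borel_measurable_times measurable_compose[OF measurable_fst] measurable_compose[OF measurable_snd]) auto
    then show "(\<lambda>(x, l). ?F x l) \<in> borel_measurable (\<mu> \<Otimes>\<^sub>M \<mu>)"
      using measurable_pair_borelI[OF measurable_ident_dunkl measurable_ident_dunkl measurable_dunkl_character]
      unfolding case_prod_unfold by (rule borel_measurable_times[rotated])
    have le: "norm (?F x l) \<le> norm (f x) * norm (g l)" for x l
      using norm_dunkl_character_le[of l x] by (auto simp: norm_mult intro!: mult_left_le_one_le)
    have F: "integrable \<mu> (?F x)" for x
    proof -
      have "integrable \<mu> (\<lambda>l. dunkl_character x l * (f x * g l))"
        by (intro integrable_dunkl_character_mult \<kappa> integrable_mult_right g)
      then show ?thesis by (simp add: mult_ac)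
    qed
    then show "AE x in \<mu>. integrable \<mu> (\<lambda>l. case (x, l) of (x, l) \<Rightarrow> ?F x l)"
      by simp
    have "integrable \<mu> (\<lambda>x. \<integral>l. norm (?F x l) \<partial>\<mu>)"
    proof (rule Bochner_Integration.integrable_bound)
      show "integrable \<mu> (\<lambda>x. norm (f x) * (\<integral>l. norm (g l) \<partial>\<mu>))"
        by (intro integrable_mult_left integrable_norm f)
      show "(\<lambda>x. \<integral>l. norm (?F x l) \<partial>\<mu>) \<in> borel_measurable \<mu>"
        using \<open>(\<lambda>(x, l). ?F x l) \<in> borel_measurable (\<mu> \<Otimes>\<^sub>M \<mu>)\<close>
        by (intro sigma_finite_measure.borel_measurable_lebesgue_integral[OF sigma_finite_dunkl_measure])
          (simp add: case_prod_unfold)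
      show "AE x in \<mu>. norm (\<integral>l. norm (?F x l) \<partial>\<mu>) \<le> norm (norm (f x) * (\<integral>l. norm (g l) \<partial>\<mu>))"
      proof (intro AE_I2)
        fix x
        have "(\<integral>l. norm (?F x l) \<partial>\<mu>) \<le> (\<integral>l. norm (f x) * norm (g l) \<partial>\<mu>)"
          by (intro integral_mono integrable_norm F le integrable_mult_right g)
        then show "norm (\<integral>l. norm (?F x l) \<partial>\<mu>) \<le> norm (norm (f x) * (\<integral>l. norm (g l) \<partial>\<mu>))"
          by simp
      qed
    qed
    then show "integrable \<mu> (\<lambda>x. \<integral>l. norm (case (x, l) of (x, l) \<Rightarrow> ?F x l) \<partial>\<mu>)"
      by simp
  qed
  have "(\<integral>l. \<F> f l * g l \<partial>\<mu>) = (\<integral>l. (\<integral>x. ?F x l \<partial>\<mu>) \<partial>\<mu>)"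
    unfolding dunkl_transform_def by (simp flip: integral_mult_left_zero add: mult.assoc)
  also have "\<dots> = (\<integral>x. (\<integral>l. ?F x l \<partial>\<mu>) \<partial>\<mu>)"
    by (rule Fubini_integral[OF int])
  also have "\<dots> = (\<integral>x. f x * \<F> g x \<partial>\<mu>)"
    unfolding dunkl_transform_def by (simp flip: integral_mult_right_zero add: mult_ac)
  finally show ?thesis .
qed

section \<open>Gaussians under the transform and uniqueness in L2\<close>

lemma integrable_xgauss_square:
  assumes "s > 0"
  shows "integrable \<mu> (\<lambda>x. exp (- s * x\<^sup>2) * x\<^sup>2)"
  using integrable.intros[OF has_bochner_integral_gaussian_moment_square[OF assms, of 0]] by simp

lemma integrable_exp_gauss:
  assumes "s > 0"
  shows "integrable \<mu> (\<lambda>x. exp (- s * x\<^sup>2))"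
  using integrable.intros[OF has_bochner_integral_gaussian_moment[OF assms, of 0]] by simp

lemma
  assumes "s > 0"
  shows integrable_gauss: "integrable \<mu> (gauss s)"
    and gauss_L2: "gauss s \<in> Lp_space \<mu> 2"
    and integrable_xgauss: "integrable \<mu> (xgauss s)"
    and xgauss_L2: "xgauss s \<in> Lp_space \<mu> 2"
proof -
  have borel: "gauss s \<in> borel_measurable borel" "xgauss s \<in> borel_measurable borel"
    unfolding gauss_def[abs_def] xgauss_def[abs_def] by measurable
  have meas: "gauss s \<in> borel_measurable \<mu>" "xgauss s \<in> borel_measurable \<mu>"
    using borel by (auto intro: measurable_dunkl_measureI)
  show 1: "integrable \<mu> (gauss s)"
    unfolding gauss_def[abs_def] by (intro integrable_of_real integrable_exp_gauss assms)
  show "integrable \<mu> (xgauss s)"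
  proof (rule Bochner_Integration.integrable_bound[OF _ meas(2)])
    show "integrable \<mu> (\<lambda>x. exp (- s * x\<^sup>2) + exp (- s * x\<^sup>2) * x\<^sup>2)"
      by (intro Bochner_Integration.integrable_add integrable_exp_gauss integrable_xgauss_square assms)
    show "AE x in \<mu>. norm (xgauss s x) \<le> norm (exp (- s * x\<^sup>2) + exp (- s * x\<^sup>2) * x\<^sup>2)"
    proof (intro AE_I2)
      fix x :: real
      have "\<bar>x\<bar> \<le> 1 + x\<^sup>2"
        using sum_squares_bound[of "\<bar>x\<bar>" 1] by simp
      then have "\<bar>x\<bar> * exp (- s * x\<^sup>2) \<le> (1 + x\<^sup>2) * exp (- s * x\<^sup>2)"
        by (intro mult_right_mono) auto
      then show "norm (xgauss s x) \<le> norm (exp (- s * x\<^sup>2) + exp (- s * x\<^sup>2) * x\<^sup>2)"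
        by (simp add: xgauss_def norm_mult abs_mult algebra_simps)
    qed
  qed
  have sq: "exp (- (s * x\<^sup>2)) ^ 2 = exp (- (2 * s * x\<^sup>2))" for x :: real
    by (simp add: power2_eq_square exp_add[symmetric])
  have "(\<integral>\<^sup>+x. ennreal (norm (gauss s x)) ^ 2 \<partial>\<mu>) = (\<integral>\<^sup>+x. ennreal (exp (- (2 * s) * x\<^sup>2)) \<partial>\<mu>)"
    by (intro nn_integral_cong) (simp add: gauss_def ennreal_power sq)
  also have "\<dots> < \<infinity>"
    using integrable_exp_gauss[of "2 * s"] assms by (subst nn_integral_eq_integral) auto
  finally show "gauss s \<in> Lp_space \<mu> 2"
    unfolding Lp_space_2_iff using meas by simp
  have "(\<integral>\<^sup>+x. ennreal (norm (xgauss s x)) ^ 2 \<partial>\<mu>) = (\<integral>\<^sup>+x. ennreal (exp (- (2 * s) * x\<^sup>2) * x\<^sup>2) \<partial>\<mu>)"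
    by (intro nn_integral_cong) (simp add: xgauss_def ennreal_power norm_mult abs_mult power_mult_distrib mult.commute sq)
  also have "\<dots> < \<infinity>"
    using integrable_xgauss_square[of "2 * s"] assms by (subst nn_integral_eq_integral) auto
  finally show "xgauss s \<in> Lp_space \<mu> 2"
    unfolding Lp_space_2_iff using meas by simp
qed

lemma dunkl_transform_gauss:
  assumes s: "s > 0"
  shows "\<F> (gauss s) = (\<lambda>l. of_real ((2 * s) powr (- \<kappa> - 1)) * gauss (1 / (4 * s)) l)"
proof
  fix l
  have "(- (\<i> * of_real l))\<^sup>2 / of_real (4 * s) = complex_of_real (- (1 / (4 * s)) * l\<^sup>2)"
    by (simp add: power_mult_distrib)
  then have "exp ((- (\<i> * of_real l))\<^sup>2 / of_real (4 * s)) = gauss (1 / (4 * s)) l"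
    by (simp only: gauss_def exp_of_real)
  then show "\<F> (gauss s) l = of_real ((2 * s) powr (- \<kappa> - 1)) * gauss (1 / (4 * s)) l"
    using has_bochner_integral_integral_eq[OF has_bochner_integral_dunkl_kernel_gaussian[OF s, of "- (\<i> * of_real l)" 0]] \<kappa>1
    by (simp add: dunkl_transform_def gauss_def[of s] mult.commute)
qed

lemma dunkl_transform_xgauss:
  assumes s: "s > 0"
  shows "\<F> (xgauss s) = (\<lambda>l. - \<i> * of_real ((2 * s) powr (- \<kappa> - 2)) * xgauss (1 / (4 * s)) l)"
proof
  fix l
  have "(- (\<i> * of_real l))\<^sup>2 / of_real (4 * s) = complex_of_real (- (1 / (4 * s)) * l\<^sup>2)"
    by (simp add: power_mult_distrib)
  then have "of_real l * exp ((- (\<i> * of_real l))\<^sup>2 / of_real (4 * s)) = xgauss (1 / (4 * s)) l"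
    by (simp only: xgauss_def exp_of_real of_real_mult[of l])
  then show "\<F> (xgauss s) l = - \<i> * of_real ((2 * s) powr (- \<kappa> - 2)) * xgauss (1 / (4 * s)) l"
    using has_bochner_integral_integral_eq[OF has_bochner_integral_dunkl_kernel_odd_gaussian[OF s, of "- (\<i> * of_real l)"]]
    by (simp add: dunkl_transform_def xgauss_def[of s] mult_ac)
qed

text \<open>Duality for the approximating L1 functions is carried to the limit on both sides. The
  definition by sequences thereby becomes a weak identity between f and g alone.\<close>

lemma has_dunkl_transform_L2_duality:
  assumes fg: "has_dunkl_transform_L2 \<kappa> f g"
    and \<phi>: "integrable \<mu> \<phi>" "\<phi> \<in> Lp_space \<mu> 2"
    and \<psi>: "\<F> \<phi> \<in> Lp_space \<mu> 2"
  shows "(\<integral>x. g x * \<phi> x \<partial>\<mu>) = (\<integral>x. f x * \<F> \<phi> x \<partial>\<mu>)"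
proof -
  obtain h where f: "f \<in> Lp_space \<mu> 2" and g: "g \<in> Lp_space \<mu> 2"
    and h: "\<And>n. h n \<in> Lp_space \<mu> 1" "\<And>n. h n \<in> Lp_space \<mu> 2"
    and lim: "(\<lambda>n. Lp_norm \<mu> 2 (\<lambda>x. h n x - f x)) \<longlonglongrightarrow> 0"
      "(\<lambda>n. Lp_norm \<mu> 2 (\<lambda>l. \<F> (h n) l - g l)) \<longlonglongrightarrow> 0"
    using fg unfolding has_dunkl_transform_L2_def by blast
  have hi: "integrable \<mu> (h n)" for n
    using h(1) unfolding Lp_space_1_iff .
  have "(\<lambda>n. \<integral>x. h n x * \<F> \<phi> x \<partial>\<mu>) \<longlonglongrightarrow> (\<integral>x. f x * \<F> \<phi> x \<partial>\<mu>)"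
    by (intro tendsto_L2_mult f \<psi> lim integrable_L2_mult h borel_measurable_integrable hi)
  moreover have "(\<lambda>n. \<integral>x. \<F> (h n) x * \<phi> x \<partial>\<mu>) \<longlonglongrightarrow> (\<integral>x. g x * \<phi> x \<partial>\<mu>)"
    by (intro tendsto_L2_mult g \<phi> lim integrable_dunkl_transform_mult \<kappa> hi
        measurable_dunkl_measureI[OF measurable_dunkl_transform] borel_measurable_integrable)
  ultimately show ?thesis
    using LIMSEQ_unique by (simp add: dunkl_transform_duality[OF hi \<phi>(1)])
qed

lemma gaussian_total:
  assumes d: "d \<in> Lp_space \<mu> 2"
    and zero: "\<And>s. s > 0 \<Longrightarrow> (\<integral>x. d x * gauss s x \<partial>\<mu>) = 0"
      "\<And>s. s > 0 \<Longrightarrow> (\<integral>x. d x * xgauss s x \<partial>\<mu>) = 0"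
  shows "AE x in \<mu>. d x = 0"
proof -
  have meas: "d \<in> borel_measurable \<mu>" using d unfolding Lp_space_2_iff by simp
  have int: "integrable \<mu> (\<lambda>x. d x * gauss s x)" "integrable \<mu> (\<lambda>x. d x * xgauss s x)" if "s > 0" for s
    by (intro integrable_L2_mult d gauss_L2 xgauss_L2 \<kappa>1 that)+
  \<comment> \<open>The map p stands for the real or the imaginary part; it commutes with the test
    functions because they are real.\<close>
  have "AE x in \<mu>. p (d x) = 0" if p: "bounded_linear p" and pr: "\<And>z r. p (z * of_real r) = r * p z"
    for p :: "complex \<Rightarrow> real"
  proof (rule gaussian_total_real)
    show "(\<lambda>x. p (d x)) \<in> borel_measurable \<mu>"
      using borel_measurable_continuous_onI[OF linear_continuous_on[OF p]] meas by (rule measurable_compose[rotated])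
    have eq: "p (d x * gauss s x) = exp (- s * x\<^sup>2) * p (d x)" "p (d x * xgauss s x) = exp (- s * x\<^sup>2) * (x * p (d x))" for s x
      unfolding gauss_def xgauss_def pr by simp_all
    show "integrable \<mu> (\<lambda>x. exp (- x\<^sup>2) * p (d x))" "integrable \<mu> (\<lambda>x. exp (- x\<^sup>2) * (x * p (d x)))"
      using integrable_bounded_linear[OF p int(1)[of 1]] integrable_bounded_linear[OF p int(2)[of 1]]
      unfolding eq by simp_all
    show "(\<integral>x. exp (- s * x\<^sup>2) * p (d x) \<partial>\<mu>) = 0" "(\<integral>x. exp (- s * x\<^sup>2) * (x * p (d x)) \<partial>\<mu>) = 0" if "s > 0" for s
      using integral_bounded_linear[OF p int(1)[OF that]] integral_bounded_linear[OF p int(2)[OF that]]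
      unfolding eq zero[OF that] linear_0[OF bounded_linear.linear[OF p]] by simp_all
  qed
  from this[OF bounded_linear_Re] this[OF bounded_linear_Im] show ?thesis
    by (auto simp: complex_eq_iff)
qed

text \<open>The parameter map s to 1/(4 s) is an involution of the positive reals and the scalars
  are nonzero. The Gaussian pairings of f and of g therefore determine each other, in both
  directions.\<close>

lemma has_dunkl_transform_L2_gauss:
  assumes s: "s > 0" and fg: "has_dunkl_transform_L2 \<kappa> f g"
  shows "(\<integral>x. g x * gauss s x \<partial>\<mu>)
      = of_real ((2 * s) powr (- \<kappa> - 1)) * (\<integral>x. f x * gauss (1 / (4 * s)) x \<partial>\<mu>)"
    and "(\<integral>x. g x * xgauss s x \<partial>\<mu>)
      = - \<i> * of_real ((2 * s) powr (- \<kappa> - 2)) * (\<integral>x. f x * xgauss (1 / (4 * s)) x \<partial>\<mu>)"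
proof -
  have s4: "1 / (4 * s) > 0" using s by simp
  have scale: "(\<integral>x. f x * (c * h x) \<partial>\<mu>) = c * (\<integral>x. f x * h x \<partial>\<mu>)" for c h
    by (subst integral_mult_right_zero[symmetric]) (simp add: mult.left_commute)
  show "(\<integral>x. g x * gauss s x \<partial>\<mu>)
      = of_real ((2 * s) powr (- \<kappa> - 1)) * (\<integral>x. f x * gauss (1 / (4 * s)) x \<partial>\<mu>)"
    using has_dunkl_transform_L2_duality[OF fg integrable_gauss[OF s] gauss_L2[OF s],
        unfolded dunkl_transform_gauss[OF s], OF Lp_space_2_cmult[OF gauss_L2[OF s4]]]
    unfolding scale .
  show "(\<integral>x. g x * xgauss s x \<partial>\<mu>)
      = - \<i> * of_real ((2 * s) powr (- \<kappa> - 2)) * (\<integral>x. f x * xgauss (1 / (4 * s)) x \<partial>\<mu>)"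
    using has_dunkl_transform_L2_duality[OF fg integrable_xgauss[OF s] xgauss_L2[OF s],
        unfolded dunkl_transform_xgauss[OF s], OF Lp_space_2_cmult[OF xgauss_L2[OF s4]]]
    unfolding scale .
qed

lemma L2_eq_AE:
  assumes f: "f \<in> Lp_space \<mu> 2" "f' \<in> Lp_space \<mu> 2"
    and eq: "\<And>s. s > 0 \<Longrightarrow> (\<integral>x. f x * gauss s x \<partial>\<mu>) = (\<integral>x. f' x * gauss s x \<partial>\<mu>)"
      "\<And>s. s > 0 \<Longrightarrow> (\<integral>x. f x * xgauss s x \<partial>\<mu>) = (\<integral>x. f' x * xgauss s x \<partial>\<mu>)"
  shows "AE x in \<mu>. f x = f' x"
proof -
  have "AE x in \<mu>. f x - f' x = 0"
  proof (intro gaussian_total Lp_space_2_diff f)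
    fix s :: real assume s: "s > 0"
    note int = integrable_L2_mult[OF f(1) gauss_L2[OF s]] integrable_L2_mult[OF f(2) gauss_L2[OF s]]
      integrable_L2_mult[OF f(1) xgauss_L2[OF s]] integrable_L2_mult[OF f(2) xgauss_L2[OF s]]
    show "(\<integral>x. (f x - f' x) * gauss s x \<partial>\<mu>) = 0" "(\<integral>x. (f x - f' x) * xgauss s x \<partial>\<mu>) = 0"
      unfolding left_diff_distrib using int eq[OF s] by simp_all
  qed
  then show ?thesis by simp
qed

text \<open>The pairings of g with the Gaussians are computed from f, and the Gaussians are
  total.\<close>

proposition has_dunkl_transform_L2_unique:
  assumes fg: "has_dunkl_transform_L2 \<kappa> f g" and fg': "has_dunkl_transform_L2 \<kappa> f g'"
  shows "AE x in \<mu>. g x = g' x"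
  using fg fg' by (intro L2_eq_AE)
    (simp_all add: has_dunkl_transform_L2_gauss[OF _ fg] has_dunkl_transform_L2_gauss[OF _ fg'],
     simp_all add: has_dunkl_transform_L2_def)

proposition has_dunkl_transform_L2_inj:
  assumes fg: "has_dunkl_transform_L2 \<kappa> f g" and fg': "has_dunkl_transform_L2 \<kappa> f' g'"
    and eq: "AE x in \<mu>. g x = g' x"
  shows "AE x in \<mu>. f x = f' x"
proof (rule L2_eq_AE)
  have L2: "f \<in> Lp_space \<mu> 2" "f' \<in> Lp_space \<mu> 2"
    "g \<in> Lp_space \<mu> 2" "g' \<in> Lp_space \<mu> 2"
    using fg fg' unfolding has_dunkl_transform_L2_def by auto
  then show "f \<in> Lp_space \<mu> 2" "f' \<in> Lp_space \<mu> 2" by simp_all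
  fix s :: real assume s: "s > 0"
  \<comment> \<open>The parameter whose Gaussian is transformed into the one with parameter
    s.\<close>
  define t where "t = 1 / (4 * s)"
  have t: "t > 0" "1 / (4 * t) = s" using s by (simp_all add: t_def)
  have pos: "(2 * t) powr a \<noteq> 0" for a using t(1) by simp
  have "(\<integral>x. g x * gauss t x \<partial>\<mu>) = (\<integral>x. g' x * gauss t x \<partial>\<mu>)"
    using eq L2 gauss_L2[OF t(1)]
    by (intro integral_cong_AE borel_measurable_times) (auto simp: Lp_space_def)
  then show "(\<integral>x. f x * gauss s x \<partial>\<mu>) = (\<integral>x. f' x * gauss s x \<partial>\<mu>)"
    unfolding has_dunkl_transform_L2_gauss(1)[OF t(1) fg] has_dunkl_transform_L2_gauss(1)[OF t(1) fg'] t(2)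
    using pos by simp
  have "(\<integral>x. g x * xgauss t x \<partial>\<mu>) = (\<integral>x. g' x * xgauss t x \<partial>\<mu>)"
    using eq L2 xgauss_L2[OF t(1)]
    by (intro integral_cong_AE borel_measurable_times) (auto simp: Lp_space_def)
  then show "(\<integral>x. f x * xgauss s x \<partial>\<mu>) = (\<integral>x. f' x * xgauss s x \<partial>\<mu>)"
    unfolding has_dunkl_transform_L2_gauss(2)[OF t(1) fg] has_dunkl_transform_L2_gauss(2)[OF t(1) fg'] t(2)
    using pos by simp
qed

section \<open>The translated ball\<close>

definition ball_translate :: "real \<Rightarrow> real \<Rightarrow> real" where
  "ball_translate y x = measure mehler {t. x\<^sup>2 + y\<^sup>2 - 2 * x * y * t < 1}"

lemma ball_translate_commute: "ball_translate y x = ball_translate x y"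
  by (simp add: ball_translate_def add.commute mult.commute mult.left_commute)

lemma ball_translate_nonneg: "ball_translate y x \<ge> 0"
  by (simp add: ball_translate_def)

lemma ball_translate_le_1: "ball_translate y x \<le> 1"
  using prob_space.prob_le_1[OF prob_space_mehler] by (simp add: ball_translate_def)

lemma ball_translate_eq_integral: "ball_translate y x = (\<integral>t. indicator {..<1} (x\<^sup>2 + y\<^sup>2 - 2 * x * y * t) \<partial>mehler)"
proof -
  have "(\<integral>t. indicator {..<1} (x\<^sup>2 + y\<^sup>2 - 2 * x * y * t) \<partial>mehler)
     = (\<integral>t. indicator {t. x\<^sup>2 + y\<^sup>2 - 2 * x * y * t < 1} t \<partial>mehler)"
    by (intro Bochner_Integration.integral_cong refl) (simp add: indicator_def)
  also have "\<dots> = ball_translate y x"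
    unfolding ball_translate_def by simp
  finally show ?thesis ..
qed

lemma measurable_ball_translate: "(\<lambda>(x, y). ball_translate y x) \<in> borel_measurable (borel \<Otimes>\<^sub>M borel)"
proof -
  interpret prob_space "mehler" by (rule prob_space_mehler)
  have "(\<lambda>z. \<integral>t. indicator {..<1} ((fst z)\<^sup>2 + (snd z)\<^sup>2 - 2 * fst z * snd z * t) \<partial>mehler :: real) \<in> borel_measurable ((borel \<Otimes>\<^sub>M borel) :: (real \<times> real) measure)"
    by (rule borel_measurable_lebesgue_integral) measurable
  then show ?thesis
    by (simp add: ball_translate_eq_integral case_prod_unfold)
qed

lemma measurable_ball_translate_fst: "ball_translate y \<in> borel_measurable borel"
proof -
  have "(\<lambda>x. (x, y)) \<in> measurable borel (borel \<Otimes>\<^sub>M borel)"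
    by measurable
  from measurable_compose[OF this measurable_ball_translate] show ?thesis by simp
qed

lemma ball_translate_eq_0:
  assumes "\<bar>y\<bar> + 1 \<le> \<bar>x\<bar>"
  shows "ball_translate y x = 0"
proof -
  have le: "1\<^sup>2 \<le> (\<bar>x\<bar> - \<bar>y\<bar>)\<^sup>2"
    using assms by (intro power_mono) auto
  have "AE t in mehler. t \<notin> {t. x\<^sup>2 + y\<^sup>2 - 2 * x * y * t < 1}"
    using AE_mehler
  proof eventually_elim
    case (elim t)
    then show ?case using quadratic_form_ge[of t x y] le by simp
  qed
  then have "emeasure mehler {t. x\<^sup>2 + y\<^sup>2 - 2 * x * y * t < 1} = 0"
    by (subst (asm) AE_iff_null_sets[symmetric]) (auto intro: null_setsD1)
  then show ?thesis
    by (simp add: ball_translate_def measure_def)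
qed

text \<open>The function is at most 1 and vanishes for |x| \<ge> |y| + 1. A Gaussian majorant
  expresses both, so that known Gaussian integrals yield integrability.\<close>

lemma ball_translate_le_exp: "ball_translate y x \<le> exp ((\<bar>y\<bar> + 1)\<^sup>2) * exp (- 1 * x\<^sup>2)"
proof (cases "\<bar>y\<bar> + 1 \<le> \<bar>x\<bar>")
  case False
  then have "\<bar>x\<bar>\<^sup>2 \<le> (\<bar>y\<bar> + 1)\<^sup>2" by (intro power_mono) auto
  then have "1 \<le> exp ((\<bar>y\<bar> + 1)\<^sup>2) * exp (- 1 * x\<^sup>2)"
    by (simp flip: exp_add)
  then show ?thesis using ball_translate_le_1[of y x] by linarith
qed (simp add: ball_translate_eq_0)

lemma
  shows integrable_ball_translate: "integrable \<mu> (\<lambda>x. complex_of_real (ball_translate y x))"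
    and ball_translate_L2: "(\<lambda>x. complex_of_real (ball_translate y x)) \<in> Lp_space \<mu> 2"
proof -
  have meas: "(\<lambda>x. complex_of_real (ball_translate y x)) \<in> borel_measurable \<mu>"
  proof (rule measurable_dunkl_measureI)
    note [measurable] = measurable_ball_translate_fst
    show "(\<lambda>x. complex_of_real (ball_translate y x)) \<in> borel_measurable borel" by measurable
  qed
  have int: "integrable \<mu> (\<lambda>x. exp ((\<bar>y\<bar> + 1)\<^sup>2) * exp (- 1 * x\<^sup>2))"
    using \<kappa> by (intro integrable_mult_right integrable_exp_gauss) auto
  show "integrable \<mu> (\<lambda>x. complex_of_real (ball_translate y x))"
  proof (rule Bochner_Integration.integrable_bound[OF int meas])
    show "AE x in \<mu>. norm (complex_of_real (ball_translate y x)) \<le> norm (exp ((\<bar>y\<bar> + 1)\<^sup>2) * exp (- 1 * x\<^sup>2))"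
      using ball_translate_le_exp[of y] ball_translate_nonneg[of y] by (intro AE_I2) simp
  qed
  have "(\<integral>\<^sup>+x. ennreal (norm (complex_of_real (ball_translate y x))) ^ 2 \<partial>\<mu>)
     \<le> (\<integral>\<^sup>+x. ennreal (exp ((\<bar>y\<bar> + 1)\<^sup>2) * exp (- 1 * x\<^sup>2)) \<partial>\<mu>)"
  proof (rule nn_integral_mono)
    fix x
    have "(ball_translate y x)\<^sup>2 \<le> ball_translate y x"
      using ball_translate_le_1[of y x] ball_translate_nonneg[of y x]
      by (auto simp: power2_eq_square intro: mult_left_le_one_le)
    also note ball_translate_le_exp[of y x]
    finally show "ennreal (norm (complex_of_real (ball_translate y x))) ^ 2 \<le> ennreal (exp ((\<bar>y\<bar> + 1)\<^sup>2) * exp (- 1 * x\<^sup>2))"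
      using ball_translate_nonneg[of y x] by (simp add: ennreal_power ennreal_leI)
  qed
  also have "\<dots> < \<infinity>"
    using int by (subst nn_integral_eq_integral) auto
  finally show "(\<lambda>x. complex_of_real (ball_translate y x)) \<in> Lp_space \<mu> 2"
    unfolding Lp_space_2_iff using meas by simp
qed

lemma ball_translate_0: "complex_of_real (ball_translate 0 x) = \<omega> x"
  using prob_space.prob_space[OF prob_space_mehler]
  unfolding indicator_dunkl_ball_0 by (auto simp: ball_translate_def indicator_def)

lemma
  shows integrable_ball: "integrable \<mu> \<omega>"
    and ball_L2: "\<omega> \<in> Lp_space \<mu> 2"
  using integrable_ball_translate[of 0] ball_translate_L2[of 0]
  unfolding ball_translate_0 by simp_all

text \<open>Both sides are linear in the indicator function of the ball, and for a Gaussian in its place the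
  identity is \<open>has_bochner_integral_dunkl_kernel_gaussian\<close>; the uniqueness of Laplace transforms
  carries it over.\<close>

proposition dunkl_transform_ball_translate: "\<F> (\<lambda>x. of_real (ball_translate y x)) l
    = dunkl_character l y * \<F> \<omega> l"
proof -
  let ?e = "dunkl_character l"
  let ?MP = "\<mu> \<Otimes>\<^sub>M mehler"
  let ?u = "\<lambda>x t. x\<^sup>2 + y\<^sup>2 - 2 * x * y * t" and ?U = "\<lambda>z. (fst z)\<^sup>2 + y\<^sup>2 - 2 * fst z * y * snd z"
  interpret M: sigma_finite_measure \<mu> by (rule sigma_finite_dunkl_measure)
  interpret P: prob_space mehler by (rule prob_space_mehler)
  interpret pair_sigma_finite \<mu> mehler ..
  have id: "(\<lambda>x. x) \<in> measurable mehler borel" by simp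
  note pairI = measurable_pair_borelI[OF measurable_ident_dunkl id]
  have meas_u: "?U \<in> borel_measurable ?MP"
    by (rule pairI) measurable
  have meas_e: "?e \<in> borel_measurable \<mu>"
    by (rule measurable_dunkl_character_fst)
  have meas_w: "(\<lambda>z. ?e (fst z)) \<in> borel_measurable ?MP"
    using measurable_compose[OF measurable_fst meas_e] by (simp add: case_prod_unfold)
  have AE_t: "AE z in ?MP. \<bar>snd z\<bar> < 1"
  proof (rule AE_pair_measure)
    have [measurable]: "snd \<in> borel_measurable ?MP"
      by (rule measurable_compose[OF measurable_snd id])
    show "{z \<in> space ?MP. \<bar>snd z\<bar> < 1} \<in> sets ?MP"
      by measurable
  qed (simp add: AE_mehler)
  have u_ge: "(\<bar>x\<bar> - \<bar>y\<bar>)\<^sup>2 \<le> ?u x t" if "\<bar>t\<bar> < 1" for x t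
    using that by (intro quadratic_form_ge) simp
  have AE_u: "AE z in ?MP. 0 \<le> ?U z"
    using AE_t
  proof eventually_elim
    case (elim z)
    have "0 \<le> (\<bar>fst z\<bar> - \<bar>y\<bar>)\<^sup>2" by simp
    also note u_ge[OF elim, of "fst z"]
    finally show ?case by (simp add: case_prod_unfold)
  qed
  have int_g: "integrable ?MP (\<lambda>(x, t). exp (y\<^sup>2) * exp (- (1 / 2) * x\<^sup>2))"
  proof (rule Fubini_integrable)
    show "(\<lambda>(x, t). exp (y\<^sup>2) * exp (- (1 / 2) * x\<^sup>2)) \<in> borel_measurable ?MP"
      by (rule pairI) measurable
    show "integrable \<mu> (\<lambda>x. \<integral>t. norm (case (x, t) of (x, t) \<Rightarrow> exp (y\<^sup>2) * exp (- (1 / 2) * x\<^sup>2)) \<partial>mehler)"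
      using integrable_mult_right[OF integrable_exp_gauss[of "1 / 2"], of "exp (y\<^sup>2)"]
      by (simp add: P.prob_space del: space_mehler)
  qed simp
  have int_u: "integrable ?MP (\<lambda>z. exp (- ?U z) *\<^sub>R ?e (fst z))"
  proof (rule Bochner_Integration.integrable_bound[OF int_g])
    show "(\<lambda>z. exp (- ?U z) *\<^sub>R ?e (fst z)) \<in> borel_measurable ?MP"
      using meas_u meas_w by measurable
    show "AE z in ?MP. norm (exp (- ?U z) *\<^sub>R ?e (fst z))
        \<le> norm (case z of (x, t) \<Rightarrow> exp (y\<^sup>2) * exp (- (1 / 2) * x\<^sup>2))"
      using AE_t
    proof eventually_elim
      case (elim z)
      \<comment> \<open>Equivalent to (|x| - |y|)^2 \<ge> x^2 / 2 - y^2, which leaves half of the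
        Gaussian decay in x at the cost of the constant exp(y^2).\<close>
      have "0 \<le> (\<bar>fst z\<bar> - 2 * \<bar>y\<bar>)\<^sup>2 / 2" by simp
      also have "\<dots> = (\<bar>fst z\<bar> - \<bar>y\<bar>)\<^sup>2 + y\<^sup>2 - (1 / 2) * (fst z)\<^sup>2"
        by (simp add: power2_diff field_simps)
      finally have "- ?U z \<le> y\<^sup>2 + - (1 / 2) * (fst z)\<^sup>2"
        using u_ge[OF elim, of "fst z"] by linarith
      then have "exp (- ?U z) \<le> exp (y\<^sup>2) * exp (- (1 / 2) * (fst z)\<^sup>2)"
        by (simp only: exp_add[symmetric] exp_le_cancel_iff)
      then have "exp (- ?U z) * norm (?e (fst z)) \<le> exp (y\<^sup>2) * exp (- (1 / 2) * (fst z)\<^sup>2) * 1"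
        using norm_dunkl_character_le by (intro mult_mono) auto
      then show ?case by (simp add: case_prod_unfold)
    qed
  qed
  have int_gauss: "integrable \<mu> (\<lambda>x. exp (- s * x\<^sup>2) *\<^sub>R (?e y * ?e x))" if "s > 0" for s
  proof -
    have "integrable \<mu> (\<lambda>x. ?e x * (?e y * gauss s x))"
      using that by (intro integrable_dunkl_character_mult \<kappa> integrable_mult_right integrable_gauss \<kappa>1)
    then show ?thesis
      by (simp add: gauss_def scaleR_conv_of_real mult_ac)
  qed
  \<comment> \<open>Integrating over t produces exp(-n (x^2 + y^2)) times the Dunkl kernel at 2 n x
    y. The Gaussian formula with a = 2 n y and b = - i l then yields the exponent n y^2 - l^2 / (4
    n), whose first term cancels exp(-n y^2), and the kernel argument a b / (2 n) = - i l y.\<close>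
  have eq: "(\<integral>z. exp (- real n * ?U z) *\<^sub>R ?e (fst z) \<partial>?MP)
      = (\<integral>x. exp (- real n * x\<^sup>2) *\<^sub>R (?e y * ?e x) \<partial>\<mu>)" if "n > 0" for n :: nat
  proof -
    have n: "real n > 0" "real n \<ge> 1" using that by auto
    let ?f = "\<lambda>x t. exp (- real n * ?u x t) *\<^sub>R ?e x"
    let ?c = "of_real (exp (- real n * y\<^sup>2)) :: complex"
    have int: "integrable ?MP (\<lambda>(x, t). ?f x t)"
    proof (rule Bochner_Integration.integrable_bound[OF int_u])
      have "(\<lambda>z. exp (- real n * ?U z) *\<^sub>R ?e (fst z)) \<in> borel_measurable ?MP"
        using meas_u meas_w by measurable
      then show "(\<lambda>(x, t). ?f x t) \<in> borel_measurable ?MP"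
        by (simp add: case_prod_unfold)
      show "AE z in ?MP. norm (case z of (x, t) \<Rightarrow> ?f x t) \<le> norm (exp (- ?U z) *\<^sub>R ?e (fst z))"
        using AE_u
      proof eventually_elim
        case (elim z)
        then have "1 * ?U z \<le> real n * ?U z"
          using n by (intro mult_right_mono) (auto simp: case_prod_unfold)
        then have "exp (- real n * ?U z) \<le> exp (- ?U z)"
          by simp
        then show ?case
          by (auto simp: case_prod_unfold intro!: mult_right_mono)
      qed
    qed
    have inner: "(\<integral>t. ?f x t \<partial>mehler) = ?c * (of_real (exp (- real n * x\<^sup>2)) *
        (\<E> (of_real (2 * real n * y) * of_real x) * \<E> (- (\<i> * of_real l) * of_real x)))" for x
    proof -
      have "?f x t = exp (of_real t * (of_real (2 * real n * y) * of_real x)) * (?c * of_real (exp (- real n * x\<^sup>2)) * ?e x)" for t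
      proof -
        have "- real n * ?u x t = t * (2 * real n * y * x) + (- real n * y\<^sup>2 + - real n * x\<^sup>2)"
          by (simp add: algebra_simps)
        then have "complex_of_real (exp (- real n * ?u x t)) = of_real (exp (t * (2 * real n * y * x))) * (?c * of_real (exp (- real n * x\<^sup>2)))"
          by (simp only: exp_add of_real_mult)
        then show ?thesis
          unfolding scaleR_conv_of_real by (simp only: of_real_mult mult.assoc flip: exp_of_real)
      qed
      then have "has_bochner_integral mehler (?f x) (\<E> (of_real (2 * real n * y) * of_real x) * (?c * of_real (exp (- real n * x\<^sup>2)) * ?e x))"
        by (simp only:) (intro has_bochner_integral_mult_left has_bochner_integral_mehler_exp \<kappa>)
      then show ?thesis
        by (simp add: has_bochner_integral_iff mult_ac)
    qed
    have "(\<integral>z. exp (- real n * ?U z) *\<^sub>R ?e (fst z) \<partial>?MP) = (\<integral>x. \<integral>t. ?f x t \<partial>mehler \<partial>\<mu>)"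
      using integral_fst[OF int] by (simp add: case_prod_unfold)
    also have "\<dots> = ?c * (of_real ((2 * real n) powr (- \<kappa> - 1)) *
       (exp (((of_real (2 * real n * y))\<^sup>2 + (- (\<i> * of_real l))\<^sup>2) / of_real (4 * real n)) *
        \<E> (of_real (2 * real n * y) * (- (\<i> * of_real l)) / of_real (2 * real n))))"
      unfolding inner by (intro has_bochner_integral_integral_eq has_bochner_integral_mult_right
          has_bochner_integral_dunkl_kernel_gaussian \<kappa> n)
    also have "of_real (2 * real n * y) * (- (\<i> * of_real l)) / of_real (2 * real n) = - \<i> * of_real l * of_real y"
      using n by simp
    also have "?c * (of_real ((2 * real n) powr (- \<kappa> - 1)) *
       (exp (((of_real (2 * real n * y))\<^sup>2 + (- (\<i> * of_real l))\<^sup>2) / of_real (4 * real n)) * ?e y))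
       = ?e y * (of_real ((2 * real n) powr (- \<kappa> - 1)) * gauss (1 / (4 * real n)) l)"
    proof -
      have "((2 * real n * y)\<^sup>2 + - l\<^sup>2) / (4 * real n) = real n * y\<^sup>2 + - (1 / (4 * real n)) * l\<^sup>2"
        using n by (simp add: field_simps power2_eq_square)
      moreover have "((of_real (2 * real n * y))\<^sup>2 + (- (\<i> * of_real l))\<^sup>2) / of_real (4 * real n)
          = complex_of_real (((2 * real n * y)\<^sup>2 + - l\<^sup>2) / (4 * real n))"
        by (simp add: power_mult_distrib)
      ultimately have "?c * exp (((of_real (2 * real n * y))\<^sup>2 + (- (\<i> * of_real l))\<^sup>2) / of_real (4 * real n))
         = complex_of_real (exp (- real n * y\<^sup>2) * exp (real n * y\<^sup>2 + - (1 / (4 * real n)) * l\<^sup>2))"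
        by (simp only: exp_of_real of_real_mult[of "exp _"])
      also have "\<dots> = gauss (1 / (4 * real n)) l"
        by (simp add: gauss_def flip: exp_add)
      finally have G: "?c * exp (((of_real (2 * real n * y))\<^sup>2 + (- (\<i> * of_real l))\<^sup>2) / of_real (4 * real n)) = gauss (1 / (4 * real n)) l" .
      have "c * (b * (x * e)) = e * (b * (c * x))" for c b x e :: complex
        by (simp only: mult_ac)
      then show ?thesis unfolding G[symmetric] .
    qed
    also have "of_real ((2 * real n) powr (- \<kappa> - 1)) * gauss (1 / (4 * real n)) l = \<F> (gauss (real n)) l"
      unfolding dunkl_transform_gauss[OF n(1)] ..
    also have "?e y * \<F> (gauss (real n)) l = (\<integral>x. exp (- real n * x\<^sup>2) *\<^sub>R (?e y * ?e x) \<partial>\<mu>)"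
      unfolding dunkl_transform_def
      by (subst integral_mult_right_zero[symmetric]) (simp add: gauss_def scaleR_conv_of_real mult_ac)
    finally show ?thesis .
  qed
  have "(\<integral>z. indicator {..<1} (?U z) *\<^sub>R ?e (fst z) \<partial>?MP)
      = (\<integral>x. indicator {..<1} (x\<^sup>2) *\<^sub>R (?e y * ?e x) \<partial>\<mu>)"
  proof (rule laplace_transform_unique_indicator[OF meas_u meas_w AE_u int_u _ _ _ _ eq])
    show "(\<lambda>x. x\<^sup>2) \<in> borel_measurable \<mu>"
      by (intro borel_measurable_power measurable_ident_dunkl)
    show "(\<lambda>x. ?e y * ?e x) \<in> borel_measurable \<mu>"
      by (intro borel_measurable_times borel_measurable_const meas_e)
    show "integrable \<mu> (\<lambda>x. exp (- (x\<^sup>2)) *\<^sub>R (?e y * ?e x))"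
      using int_gauss[of 1] by simp
  qed simp_all
  also have "\<dots> = ?e y * \<F> \<omega> l"
    unfolding dunkl_transform_def indicator_dunkl_ball_0
    by (subst integral_mult_right_zero[symmetric]) (simp add: scaleR_conv_of_real mult_ac)
  also have "(\<integral>z. indicator {..<1} (?U z) *\<^sub>R ?e (fst z) \<partial>?MP)
     = \<F> (\<lambda>x. of_real (ball_translate y x)) l"
  proof -
    have int: "integrable ?MP (\<lambda>(x, t). indicator {..<1} (?u x t) *\<^sub>R ?e x)"
    proof (rule Bochner_Integration.integrable_bound[OF integrable_scaleR_right[OF int_u, of "exp 1"]])
      have "(\<lambda>z. indicator {..<1} (?U z) *\<^sub>R ?e (fst z)) \<in> borel_measurable ?MP"
        using meas_u meas_w by measurable
      then show "(\<lambda>(x, t). indicator {..<1} (?u x t) *\<^sub>R ?e x) \<in> borel_measurable ?MP"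
        by (simp add: case_prod_unfold)
      have "indicator {..<1} v \<le> exp 1 * exp (- v)" for v :: real
        by (simp add: indicator_def flip: exp_add)
      then have ind: "norm (indicator {..<1} v *\<^sub>R w) \<le> norm (exp 1 *\<^sub>R (exp (- v) *\<^sub>R w))" for v :: real and w :: complex
        using mult_right_mono[of "indicator {..<1} v" "exp 1 * exp (- v)" "norm w"] by simp
      show "AE z in ?MP. norm (case z of (x, t) \<Rightarrow> indicator {..<1} (?u x t) *\<^sub>R ?e x)
          \<le> norm (exp 1 *\<^sub>R (exp (- ?U z) *\<^sub>R ?e (fst z)))"
        unfolding case_prod_unfold by (intro AE_I2 ind)
    qed
    have inner: "(\<integral>t. indicator {..<1} (?u x t) *\<^sub>R ?e x \<partial>mehler) = ?e x * of_real (ball_translate y x)" for x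
      unfolding ball_translate_eq_integral
      by (subst integral_scaleR_left) (auto simp: scaleR_conv_of_real mult.commute intro!: P.integrable_const_bound[where B = 1])
    have "(\<integral>z. indicator {..<1} (?U z) *\<^sub>R ?e (fst z) \<partial>?MP)
        = (\<integral>x. \<integral>t. indicator {..<1} (?u x t) *\<^sub>R ?e x \<partial>mehler \<partial>\<mu>)"
      using integral_fst[OF int] by (simp add: case_prod_unfold)
    also have "\<dots> = \<F> (\<lambda>x. of_real (ball_translate y x)) l"
      unfolding inner dunkl_transform_def ..
    finally show ?thesis .
  qed
  finally show ?thesis .
qed

section \<open>Square integrability of the transform of the ball\<close>

lemma cnj_dunkl_kernel: "cnj (\<E> z) = \<E> (cnj z)"
proof -
  have "has_bochner_integral mehler (\<lambda>t. cnj (exp (of_real t * z))) (cnj (\<E> z))"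
    by (rule has_bochner_integral_bounded_linear[OF bounded_linear_cnj has_bochner_integral_mehler_exp])
  then have "has_bochner_integral mehler (\<lambda>t. exp (of_real t * cnj z)) (cnj (\<E> z))"
    by (simp add: exp_cnj)
  then show ?thesis
    using has_bochner_integral_mehler_exp[of "cnj z"] by (rule has_bochner_integral_eq)
qed

text \<open>On the real line the kernel averages the positive functions exp(t r). This makes the
  heat kernel nonnegative, so its L1 norm is its integral.\<close>

lemma dunkl_kernel_of_real: "\<E> (of_real r) = of_real (norm (\<E> (of_real r)))"
proof -
  note E = has_bochner_integral_mehler_exp[of "of_real r"]
  have eq: "exp (complex_of_real t * of_real r) = of_real (exp (t * r))" for t
    by (simp flip: exp_of_real)
  have int: "integrable mehler (\<lambda>t. exp (t * r))"
    using integrable_norm[OF integrable.intros[OF E]] by (simp add: norm_exp_eq_Re)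
  have "\<E> (of_real r) = of_real (\<integral>t. exp (t * r) \<partial>mehler)"
    using has_bochner_integral_integral_eq[OF E] unfolding eq by simp
  moreover have "0 \<le> (\<integral>t. exp (t * r) \<partial>mehler)"
    by simp
  ultimately show ?thesis by simp
qed

text \<open>Conjugating the character amounts to reflecting x, and the ball is symmetric. The
  transform is thus real, and its square is the square of its modulus.\<close>

lemma cnj_dunkl_transform_ball: "cnj (\<F> \<omega> l) = \<F> \<omega> l"
proof -
  let ?F = "\<lambda>x. dunkl_character l x * \<omega> x"
  note [measurable] = measurable_dunkl_kernel
  have meas: "?F \<in> borel_measurable borel"
    unfolding dunkl_ball_0 by measurable
  have "cnj (\<integral>x. ?F x \<partial>\<mu>) = (\<integral>x. cnj (?F x) \<partial>\<mu>)"
    by (rule Bochner_Integration.integral_cnj[symmetric])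
  also have "\<dots> = (\<integral>x. ?F (- x) \<partial>\<mu>)"
    by (intro Bochner_Integration.integral_cong refl)
       (auto simp: cnj_dunkl_kernel dunkl_ball_0 indicator_def)
  also have "\<dots> = (\<integral>x. ?F x \<partial>\<mu>)"
    by (rule integral_dunkl_measure_reflect[OF meas])
  finally show ?thesis unfolding dunkl_transform_def .
qed

text \<open>For fixed \<open>x\<close> the function of \<open>y\<close> is the translate of an approximate identity.\<close>

lemma dunkl_heat_kernel:
  assumes s: "s > 0"
  defines "P \<equiv> \<lambda>x y. \<F> (\<lambda>l. dunkl_character x l * gauss s l) y"
  shows "integrable \<mu> (P x)" and "(\<integral>y. norm (P x y) \<partial>\<mu>) = 1"
proof -
  let ?r = "1 / (4 * s)"
  let ?C = "(2 * s) powr (- \<kappa> - 1)" and ?D = "(2 * ?r) powr (- \<kappa> - 1)"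
  let ?Q = "\<lambda>y. of_real (exp (- ?r * y\<^sup>2)) * (\<E> (of_real (- x / (2 * s)) * of_real y) * \<E> (0 * of_real y))"
  have P: "P x y = of_real (?C * exp (- ?r * x\<^sup>2)) * ?Q y" for y
  proof -
    have E1: "((- (\<i> * of_real y))\<^sup>2 + (- (\<i> * of_real x))\<^sup>2) / of_real (4 * s) = complex_of_real (- ?r * x\<^sup>2 + - ?r * y\<^sup>2)"
      using s by (simp add: power_mult_distrib field_simps)
    have E2: "- (\<i> * of_real y) * - (\<i> * of_real x) / of_real (2 * s) = complex_of_real (- x / (2 * s)) * of_real y"
      using s by (simp add: field_simps)
    have "P x y = (\<integral>l. of_real (exp (- s * l\<^sup>2)) *
        (\<E> (- (\<i> * of_real y) * of_real l) * \<E> (- (\<i> * of_real x) * of_real l)) \<partial>\<mu>)"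
      unfolding P_def dunkl_transform_def
      by (intro Bochner_Integration.integral_cong refl) (simp add: gauss_def mult_ac)
    also have "\<dots> = of_real ?C * (exp (of_real (- ?r * x\<^sup>2 + - ?r * y\<^sup>2)) * \<E> (of_real (- x / (2 * s)) * of_real y))"
      unfolding E1[symmetric] E2[symmetric]
      by (rule has_bochner_integral_integral_eq[OF has_bochner_integral_dunkl_kernel_gaussian[OF s]])
    also have "\<dots> = of_real (?C * exp (- ?r * x\<^sup>2)) * ?Q y"
    proof -
      have E0: "\<E> (0 * of_real y) = 1" using \<kappa>1 by simp
      show ?thesis
        by (simp only: E0 exp_of_real exp_add of_real_mult mult_1_right mult_1_left mult_ac)
    qed
    finally show ?thesis .
  qed
  have Q: "has_bochner_integral \<mu> ?Q (of_real (?D * exp (?r * x\<^sup>2)))"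
  proof -
    have "has_bochner_integral \<mu> ?Q
      (of_real ?D * (exp (((of_real (- x / (2 * s)))\<^sup>2 + 0\<^sup>2) / of_real (4 * ?r)) * \<E> (of_real (- x / (2 * s)) * 0 / of_real (2 * ?r))))"
      using s by (intro has_bochner_integral_dunkl_kernel_gaussian \<kappa>) auto
    also have "((of_real (- x / (2 * s)))\<^sup>2 + 0\<^sup>2) / of_real (4 * ?r) = complex_of_real (?r * x\<^sup>2)"
      using s by (simp add: field_simps power2_eq_square)
    finally show ?thesis
      unfolding exp_of_real using \<kappa>1 by simp
  qed
  \<comment> \<open>The parameters satisfy (2 s) (2 r) = 1 with r = 1/(4 s); hence the mass is 1 for
    every s.\<close>
  have CD: "?C * ?D = 1"
    using s by (simp flip: powr_mult)
  have int: "has_bochner_integral \<mu> (P x) 1"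
  proof -
    have "has_bochner_integral \<mu> (P x) (of_real (?C * exp (- ?r * x\<^sup>2)) * of_real (?D * exp (?r * x\<^sup>2)))"
      unfolding P by (rule has_bochner_integral_mult_right[OF Q])
    also have "of_real (?C * exp (- ?r * x\<^sup>2)) * of_real (?D * exp (?r * x\<^sup>2)) = complex_of_real ((?C * ?D) * exp (- ?r * x\<^sup>2 + ?r * x\<^sup>2))"
      by (simp only: exp_add of_real_mult mult_ac)
    also have "\<dots> = 1"
      unfolding CD by simp
    finally show ?thesis .
  qed
  then show "integrable \<mu> (P x)"
    by (rule integrable.intros)
  have "P x y = of_real (norm (P x y))" for y
    unfolding P using dunkl_kernel_of_real[of "- x / (2 * s) * y"] \<kappa>1
    by (simp add: norm_mult)
  then have "(\<integral>y. of_real (norm (P x y)) \<partial>\<mu>) = (1 :: complex)"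
    using int by (simp add: has_bochner_integral_iff)
  then show "(\<integral>y. norm (P x y) \<partial>\<mu>) = 1"
    by simp
qed

text \<open>A substitute for Plancherel's theorem. By duality, the transform of F\<omega> times a
  Gaussian is \<omega> integrated against a heat kernel of mass 1, so it is bounded by 1. A second
  duality bounds the integral of |F\<omega>|^2 exp(-s l^2) by the L1 norm of \<omega>, uniformly in
  s, and Fatou's lemma lets s tend to 0.\<close>

lemma dunkl_transform_ball_L2: "\<F> \<omega> \<in> Lp_space \<mu> 2"
proof -
  let ?F = "\<F> \<omega>"
  let ?H = "\<lambda>s l. ?F l * gauss s l"
  let ?C = "\<integral>x. norm (\<omega> x) \<partial>\<mu>"
  have \<omega>: "integrable \<mu> \<omega>" by (rule integrable_ball)
  have measF: "?F \<in> borel_measurable \<mu>"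
    by (rule measurable_dunkl_measureI[OF measurable_dunkl_transform[OF borel_measurable_integrable[OF \<omega>]]])
  have le: "(\<integral>\<^sup>+l. ennreal (norm (?F l)) ^ 2 * ennreal (exp (- s * l\<^sup>2)) \<partial>\<mu>) \<le> ennreal ?C" if s: "s > 0" for s
  proof -
    let ?g = "\<lambda>x l. dunkl_character x l * gauss s l"
    have g: "integrable \<mu> (?g x)" for x
      by (intro integrable_dunkl_character_mult \<kappa> integrable_gauss \<kappa>1 s)
    have int: "integrable \<mu> (?H s)"
      by (intro integrable_dunkl_transform_mult \<kappa> \<omega> integrable_gauss \<kappa>1 s)
    have "norm (\<F> (?H s) x) \<le> 1" for x
    proof -
      have "\<F> (?H s) x = (\<integral>l. ?F l * ?g x l \<partial>\<mu>)"
        unfolding dunkl_transform_def[of \<kappa> "\<lambda>l. ?F l * gauss s l"]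
        by (intro Bochner_Integration.integral_cong refl mult.left_commute)
      also have "\<dots> = (\<integral>y. \<omega> y * \<F> (?g x) y \<partial>\<mu>)"
        by (rule dunkl_transform_duality[OF \<omega> g])
      also have "norm \<dots> \<le> (\<integral>y. norm (\<F> (?g x) y) \<partial>\<mu>)"
      proof (rule order_trans[OF integral_norm_bound integral_mono[OF integrable_norm]])
        have "integrable \<mu> (\<lambda>y. \<F> (?g x) y * \<omega> y)"
          by (rule integrable_dunkl_transform_mult[OF g \<omega>])
        then show "integrable \<mu> (\<lambda>y. \<omega> y * \<F> (?g x) y)"
          by (simp add: mult.commute)
        show "integrable \<mu> (\<lambda>y. norm (\<F> (?g x) y))"
          by (intro integrable_norm dunkl_heat_kernel \<kappa> s)
      qed (simp add: indicator_def)
      also have "\<dots> = 1"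
        by (rule dunkl_heat_kernel[OF s])
      finally show ?thesis .
    qed
    note le1 = this
    have "(\<integral>l. ?F l * (?F l * gauss s l) \<partial>\<mu>) = (\<integral>x. \<omega> x * \<F> (?H s) x \<partial>\<mu>)"
      by (rule dunkl_transform_duality[OF \<omega> int])
    also have "norm \<dots> \<le> ?C"
    proof (rule order_trans[OF integral_norm_bound integral_mono[OF integrable_norm]])
      have "integrable \<mu> (\<lambda>x. \<F> (?H s) x * \<omega> x)"
        by (rule integrable_dunkl_transform_mult[OF int \<omega>])
      then show "integrable \<mu> (\<lambda>x. \<omega> x * \<F> (?H s) x)"
        by (simp add: mult.commute)
      show "integrable \<mu> (\<lambda>x. norm (\<omega> x))"
        by (intro integrable_norm \<omega>)
      show "norm (\<omega> x * \<F> (?H s) x) \<le> norm (\<omega> x)" for x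
        using le1[of x] by (simp add: indicator_def)
    qed
    finally have "norm (\<integral>l. ?F l * (?F l * gauss s l) \<partial>\<mu>) \<le> ?C" .
    moreover have sq: "?F l * (?F l * gauss s l) = of_real ((norm (?F l))\<^sup>2 * exp (- s * l\<^sup>2))" for l
    proof -
      have "?F l * ?F l = of_real ((norm (?F l))\<^sup>2)"
        using complex_norm_square[of "?F l"] unfolding cnj_dunkl_transform_ball by simp
      then show ?thesis
        by (simp only: mult.assoc[symmetric] gauss_def of_real_mult)
    qed
    moreover have sq_int: "integrable \<mu> (\<lambda>l. (norm (?F l))\<^sup>2 * exp (- s * l\<^sup>2))"
    proof -
      have "integrable \<mu> (\<lambda>l. ?F l * (?F l * gauss s l))"
        by (rule integrable_dunkl_transform_mult[OF \<omega> int])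
      from integrable_Re[OF this] show ?thesis
        unfolding sq by simp
    qed
    ultimately have "(\<integral>l. (norm (?F l))\<^sup>2 * exp (- s * l\<^sup>2) \<partial>\<mu>) \<le> ?C"
      unfolding sq integral_complex_of_real norm_of_real by linarith
    moreover have "(\<integral>\<^sup>+l. ennreal (norm (?F l)) ^ 2 * ennreal (exp (- s * l\<^sup>2)) \<partial>\<mu>)
        = ennreal (\<integral>l. (norm (?F l))\<^sup>2 * exp (- s * l\<^sup>2) \<partial>\<mu>)"
      by (subst nn_integral_eq_integral[OF sq_int, symmetric]) (auto simp: ennreal_mult ennreal_power)
    ultimately show ?thesis
      by (simp add: ennreal_leI)
  qed
  have "(\<integral>\<^sup>+l. ennreal (norm (?F l)) ^ 2 \<partial>\<mu>)
      = (\<integral>\<^sup>+l. liminf (\<lambda>n. ennreal (norm (?F l)) ^ 2 * ennreal (exp (- (1 / real (Suc n)) * l\<^sup>2))) \<partial>\<mu>)"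
  proof (intro nn_integral_cong)
    fix l :: real
    have "(\<lambda>n. exp (- (1 / real (Suc n)) * l\<^sup>2)) \<longlonglongrightarrow> exp (- 0 * l\<^sup>2)"
      using LIMSEQ_inverse_real_of_nat by (intro tendsto_intros) (simp add: inverse_eq_divide)
    then have "(\<lambda>n. ennreal (norm (?F l)) ^ 2 * ennreal (exp (- (1 / real (Suc n)) * l\<^sup>2)))
        \<longlonglongrightarrow> ennreal (norm (?F l)) ^ 2 * ennreal (exp (- 0 * l\<^sup>2))"
      by (intro tendsto_mult_ennreal tendsto_const tendsto_ennrealI) (auto simp: ennreal_power)
    from lim_imp_Liminf[OF _ this] show "ennreal (norm (?F l)) ^ 2 =
        liminf (\<lambda>n. ennreal (norm (?F l)) ^ 2 * ennreal (exp (- (1 / real (Suc n)) * l\<^sup>2)))"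
      by simp
  qed
  also have "\<dots> \<le> liminf (\<lambda>n. \<integral>\<^sup>+l. ennreal (norm (?F l)) ^ 2 * ennreal (exp (- (1 / real (Suc n)) * l\<^sup>2)) \<partial>\<mu>)"
  proof (rule nn_integral_liminf)
    fix n
    have "(\<lambda>l. ennreal (exp (- (1 / real (Suc n)) * l\<^sup>2))) \<in> borel_measurable \<mu>"
      by (rule measurable_dunkl_measureI) measurable
    then show "(\<lambda>l. ennreal (norm (?F l)) ^ 2 * ennreal (exp (- (1 / real (Suc n)) * l\<^sup>2))) \<in> borel_measurable \<mu>"
      using measF by measurable
  qed
  also have "\<dots> \<le> ennreal ?C"
    by (intro Liminf_le always_eventually allI le) auto
  also have "\<dots> < \<infinity>" by simp
  finally show ?thesis
    unfolding Lp_space_2_iff using measF by simp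
qed

section \<open>The translate of the indicator function of the ball\<close>

text \<open>The constant sequence f is admissible in the L2 limit.\<close>

lemma has_dunkl_transform_L2I:
  assumes f: "integrable \<mu> f" "f \<in> Lp_space \<mu> 2"
    and F: "\<F> f \<in> Lp_space \<mu> 2"
  shows "has_dunkl_transform_L2 \<kappa> f (\<F> f)"
proof -
  have "(Lp_norm M 2 (\<lambda>x. 0)) ^ 2 = 0" for M :: "real measure"
    unfolding Lp_norm_2_power2 by simp
  then have 0: "Lp_norm M 2 (\<lambda>x. 0) = 0" for M :: "real measure"
    by simp
  show ?thesis
    unfolding has_dunkl_transform_L2_def
    by (intro conjI f F exI[of _ "\<lambda>_. f"]) (use f in \<open>simp_all only: diff_self 0 tendsto_const Lp_space_1_iff IntI simp_thms\<close>)
qed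

text \<open>The kernel is a witness, so the chosen function does satisfy the defining relation, with
  some transform g of \<omega>. Uniqueness identifies g with F\<omega> almost everywhere, and
  injectivity then identifies the chosen function with the kernel.\<close>

proposition dunkl_translation_ball: "AE x in \<mu>.
    dunkl_translation \<kappa> (- y) \<omega> x = of_real (ball_translate y x)"
proof -
  let ?F = "\<F> \<omega>" and ?K = "\<lambda>x. complex_of_real (ball_translate y x)"
  let ?e = "\<lambda>x. \<E> (\<i> * of_real x * of_real (- y))"
  let ?P = "\<lambda>h g. has_dunkl_transform_L2 \<kappa> \<omega> g \<and> has_dunkl_transform_L2 \<kappa> h (\<lambda>x. ?e x * g x)"
  have e: "?e x = dunkl_character x y" for x
    by simp
  have F: "has_dunkl_transform_L2 \<kappa> \<omega> ?F"
    by (intro has_dunkl_transform_L2I integrable_ball ball_L2 dunkl_transform_ball_L2 \<kappa>)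
  have FK: "\<F> ?K = (\<lambda>x. ?e x * ?F x)"
    unfolding e using dunkl_transform_ball_translate by (intro ext)
  have "(\<lambda>x. ?e x * ?F x) \<in> Lp_space \<mu> 2"
  proof (rule Lp_space_2_mult_bounded[OF dunkl_transform_ball_L2])
    note [measurable] = measurable_dunkl_kernel
    show "?e \<in> borel_measurable \<mu>"
      by (rule measurable_dunkl_measureI) measurable
    show "norm (?e x) \<le> 1" for x
      unfolding e by (rule norm_dunkl_character_le)
  qed
  then have K: "has_dunkl_transform_L2 \<kappa> ?K (\<lambda>x. ?e x * ?F x)"
    unfolding FK[symmetric] by (intro has_dunkl_transform_L2I integrable_ball_translate ball_translate_L2 \<kappa>)
  have "\<exists>g. ?P (dunkl_translation \<kappa> (- y) \<omega>) g"
    unfolding dunkl_translation_def by (rule someI[of _ ?K]) (use F K in blast)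
  then obtain g where g: "has_dunkl_transform_L2 \<kappa> \<omega> g"
    and h: "has_dunkl_transform_L2 \<kappa> (dunkl_translation \<kappa> (- y) \<omega>) (\<lambda>x. ?e x * g x)"
    by blast
  have "AE x in \<mu>. g x = ?F x"
    by (rule has_dunkl_transform_L2_unique[OF g F])
  then have "AE x in \<mu>. ?e x * g x = ?e x * ?F x"
    by eventually_elim simp
  then show ?thesis
    by (rule has_dunkl_transform_L2_inj[OF h K])
qed

text \<open>The mass of the translate is the value of its transform at frequency 0, where every
  character is 1. Positivity of the ball's measure is shown on (0, 1), where the weight is
  positive.\<close>

lemma emeasure_dunkl_ball:
  shows "emeasure \<mu> (dunkl_ball 0 1) = ennreal (measure \<mu> (dunkl_ball 0 1))"
    and "measure \<mu> (dunkl_ball 0 1) > 0"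
    and "(\<integral>\<^sup>+x. ennreal (ball_translate y x) \<partial>\<mu>) = ennreal (measure \<mu> (dunkl_ball 0 1))"
proof -
  have ball: "dunkl_ball 0 1 \<in> sets \<mu>"
    by (simp add: dunkl_ball_0 sets_dunkl_measure)
  have "emeasure \<mu> (dunkl_ball 0 1) < \<infinity>"
  proof -
    have "integrable \<mu> (\<lambda>x. Re (indicator (dunkl_ball 0 1) x))"
      by (intro integrable_Re integrable_ball \<kappa>)
    also have "(\<lambda>x. Re (indicator (dunkl_ball 0 1) x)) = indicator (dunkl_ball 0 1)"
      by (auto simp: indicator_def)
    finally show ?thesis
      by (simp add: integrable_indicator_iff)
  qed
  then show 1: "emeasure \<mu> (dunkl_ball 0 1) = ennreal (measure \<mu> (dunkl_ball 0 1))"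
    by (simp add: emeasure_eq_ennreal_measure less_top)
  have "complex_of_real (\<integral>x. ball_translate y x \<partial>\<mu>) = \<F> (\<lambda>x. of_real (ball_translate y x)) 0"
    using \<kappa>1 by (simp add: dunkl_transform_def)
  also have "\<dots> = \<F> (indicator (dunkl_ball 0 1)) 0"
    unfolding dunkl_transform_ball_translate using \<kappa>1 by simp
  also have "\<dots> = complex_of_real (measure \<mu> (dunkl_ball 0 1))"
  proof -
    have "(indicator (dunkl_ball 0 1) :: real \<Rightarrow> complex) = (\<lambda>x. of_real (indicator (dunkl_ball 0 1) x))"
      by (auto simp: indicator_def)
    then show ?thesis
      using \<kappa>1 ball 1 by (simp add: dunkl_transform_def)
  qed
  finally have "(\<integral>x. ball_translate y x \<partial>\<mu>) = measure \<mu> (dunkl_ball 0 1)"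
    by (simp only: of_real_eq_iff)
  moreover have "integrable \<mu> (ball_translate y)"
    using integrable_Re[OF integrable_ball_translate[of y]] by simp
  ultimately show "(\<integral>\<^sup>+x. ennreal (ball_translate y x) \<partial>\<mu>) = ennreal (measure \<mu> (dunkl_ball 0 1))"
    by (subst nn_integral_eq_integral) (auto simp: ball_translate_nonneg)
  have "emeasure \<mu> (dunkl_ball 0 1) \<noteq> 0"
  proof
    assume "emeasure \<mu> (dunkl_ball 0 1) = 0"
    then have "(\<integral>\<^sup>+x. ennreal (dunkl_weight x) * indicator {-1<..<1} x \<partial>lborel) = 0"
      using nn_integral_dunkl_measure[of "indicator {-1<..<1}"] ball by (simp add: dunkl_ball_0)
    then have "AE x in lborel. ennreal (dunkl_weight x) * indicator {-1<..<1} x = 0"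
      by (subst (asm) nn_integral_0_iff_AE) auto
    then have "AE x in lborel. x \<notin> {0<..<1::real}"
    proof eventually_elim
      case (elim x)
      have "dunkl_weight x > 0" if "x > 0"
        using that \<kappa>1 by (simp add: dunkl_weight_def Gamma_real_pos)
      then show ?case using elim by (auto simp: indicator_def split: if_splits)
    qed
    then have "emeasure lborel {0<..<1::real} = 0"
      by (subst (asm) AE_iff_null_sets[symmetric]) auto
    then show False by simp
  qed
  then show "measure \<mu> (dunkl_ball 0 1) > 0"
    unfolding 1 by (simp add: zero_less_measure_iff)
qed

section \<open>The amalgam norm\<close>

lemma dunkl_translate_integral_eq: "dunkl_translate_integral \<kappa> 1 y g = (\<integral>\<^sup>+x. g x * ennreal (ball_translate x y) \<partial>\<mu>)"
  unfolding dunkl_translate_integral_def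
proof (rule nn_integral_cong_AE)
  show "AE x in \<mu>. g x * ennreal (Re (dunkl_translation \<kappa> (- y) \<omega> x))
      = g x * ennreal (ball_translate x y)"
    using dunkl_translation_ball[of y]
    by eventually_elim (simp add: ball_translate_commute[of y])
qed

lemma dunkl_amalgam_norm_infinity:
  assumes f: "f \<in> borel_measurable \<mu>"
  shows "dunkl_amalgam_norm \<kappa> \<infinity> \<infinity> f \<le> Lp_norm \<mu> \<infinity> f"
proof -
  let ?H = "\<lambda>y x. ennreal (norm (f x * indicator (dunkl_ball y 1) x))"
  have "(\<lambda>(y, x). indicator (dunkl_ball y 1) x :: complex) \<in> borel_measurable (borel \<Otimes>\<^sub>M borel)"
  proof -
    have "(\<lambda>(y, x). indicator (dunkl_ball y 1) x :: complex) = (\<lambda>z. if fst z = 0 then if - 1 < snd z \<and> snd z < 1 then 1 else 0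
        else if max 0 (\<bar>fst z\<bar> - 1) < \<bar>snd z\<bar> \<and> \<bar>snd z\<bar> < \<bar>fst z\<bar> + 1 then 1 else 0)"
      by (auto simp: dunkl_ball_def indicator_def fun_eq_iff)
    also have "\<dots> \<in> borel_measurable (borel \<Otimes>\<^sub>M borel)"
      by measurable
    finally show ?thesis .
  qed
  then have "(\<lambda>(y, x). indicator (dunkl_ball y 1) x :: complex) \<in> borel_measurable (\<mu> \<Otimes>\<^sub>M \<mu>)"
    by (rule measurable_pair_borelI[OF measurable_ident_dunkl measurable_ident_dunkl])
  moreover have "(\<lambda>(y, x). f x) \<in> borel_measurable (\<mu> \<Otimes>\<^sub>M \<mu>)"
    using measurable_compose[OF measurable_snd f] by (simp add: case_prod_unfold)
  ultimately have H: "(\<lambda>(y, x). ?H y x) \<in> borel_measurable (\<mu> \<Otimes>\<^sub>M \<mu>)"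
    unfolding case_prod_unfold by measurable
  have Hy: "?H y \<in> borel_measurable \<mu>" for y
    by (rule measurable_section1[OF H]) simp
  \<comment> \<open>Measurability in y is essential: \<open>esssup\<close> of a non-measurable
    function is \<top> by convention.\<close>
  have meas: "(\<lambda>y. esssup \<mu> (?H y)) \<in> borel_measurable \<mu>"
    by (rule measurable_esssup[OF sigma_finite_dunkl_measure H])
  have "esssup \<mu> (?H y) \<le> esssup \<mu> (\<lambda>x. ennreal (norm (f x)))" for y
    by (rule esssup_mono[OF Hy]) (auto simp: indicator_def)
  then have "esssup \<mu> (\<lambda>y. esssup \<mu> (?H y)) \<le> esssup \<mu> (\<lambda>x. ennreal (norm (f x)))"
    using meas by (intro esssup_I) auto
  then show ?thesis
    by (simp add: dunkl_amalgam_norm_def Lp_norm_def Lp_norm_nonneg_def)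
qed

text \<open>Since the kernel \<open>ball_translate\<close> takes values in \<open>[0, 1]\<close>, the inequality holds even without the
  factor \<open>4 powr (1 / q)\<close>.\<close>

lemma dunkl_amalgam_norm_le:
  fixes q :: real and s p :: ereal
  assumes q: "1 \<le> q" and qs: "ereal q \<le> s" and sp: "s \<le> p"
    and f: "f \<in> borel_measurable \<mu>"
  shows "dunkl_amalgam_norm \<kappa> (ereal q) p f \<le> Lp_norm \<mu> s f *
    ennreal (measure \<mu> (dunkl_ball 0 1) powr real_of_ereal (1 / p - 1 / s + 1 / ereal q))"
proof -
  define m where "m = measure \<mu> (dunkl_ball 0 1)"
  define k where "k x y = ennreal (ball_translate x y)" for x y
  define F where "F x = ennreal (norm (f x) powr q)" for x
  define T where "T y = (\<integral>\<^sup>+x. F x * k x y \<partial>\<mu>)" for y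
  interpret sigma_finite_measure \<mu> by (rule sigma_finite_dunkl_measure)
  have q0: "q > 0" "q \<noteq> 0" using q by auto
  have m: "m > 0" and kx: "(\<integral>\<^sup>+x. k x y \<partial>\<mu>) \<le> ennreal m" and ky: "(\<integral>\<^sup>+y. k x y \<partial>\<mu>) \<le> ennreal m" for x y
    using emeasure_dunkl_ball(2) emeasure_dunkl_ball(3)
    by (simp_all add: m_def k_def ball_translate_commute[of _ y])
  have k1: "k x y \<le> 1" for x y
    using ball_translate_le_1 by (simp add: k_def)
  have kp: "(\<lambda>(x, y). k x y) \<in> borel_measurable (\<mu> \<Otimes>\<^sub>M \<mu>)"
  proof (rule measurable_pair_borelI[OF measurable_ident_dunkl measurable_ident_dunkl])
    have "(\<lambda>(x, y). k x y) = (\<lambda>z. ennreal (case z of (x, y) \<Rightarrow> ball_translate y x))"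
      using ball_translate_commute by (auto simp: k_def)
    also have "\<dots> \<in> borel_measurable (borel \<Otimes>\<^sub>M borel)"
      using measurable_ball_translate by measurable
    finally show "(\<lambda>(x, y). k x y) \<in> borel_measurable (borel \<Otimes>\<^sub>M borel)" .
  qed
  have kM: "(\<lambda>x. k x y) \<in> borel_measurable \<mu>" for y
    by (rule measurable_section2[OF kp]) simp
  have F: "F \<in> borel_measurable \<mu>"
    using f unfolding F_def by measurable
  have FP: "F x = ennreal_powr (ennreal (norm (f x))) q" for x
    by (simp add: F_def ennreal_powr_ennreal)
  have T: "T \<in> borel_measurable \<mu>"
  proof -
    have "(\<lambda>(y, x). F x * k x y) \<in> borel_measurable (\<mu> \<Otimes>\<^sub>M \<mu>)"
      using measurable_pair_swap[OF kp] unfolding case_prod_unfold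
      by (intro borel_measurable_times_ennreal measurable_compose[OF measurable_snd F]) simp
    then show ?thesis
      unfolding T_def[abs_def] by (rule borel_measurable_nn_integral)
  qed
  have norm: "dunkl_amalgam_norm \<kappa> (ereal q) p f = Lp_norm_nonneg \<mu> p (\<lambda>y. ennreal_powr (T y) (1 / q))" for p
    using q0 by (simp add: dunkl_amalgam_norm_def dunkl_translate_integral_eq T_def F_def k_def one_ereal_def)
  have sup: "dunkl_amalgam_norm \<kappa> (ereal q) \<infinity> f \<le> C" if "\<And>y. ennreal_powr (T y) (1 / q) \<le> C" for C
    using esssup_I[OF measurable_ennreal_powr[OF T] AE_I2[OF that]] by (simp add: norm Lp_norm_nonneg_def)
  show ?thesis
  proof (cases s)
    case (real s')
    then have s: "q \<le> s'" using qs by simp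
    \<comment> \<open>Young's inequality is applied to |f|^q with exponents a = s/q and b = p/q.
      Taking the q-th root turns the power 1 - 1/a + 1/b of the mass into 1/q - 1/s + 1/p.\<close>
    define a where "a = s' / q"
    have a: "a \<ge> 1" "q * a = s'" "s' > 0" using s q0 by (auto simp: a_def)
    let ?N = "\<integral>\<^sup>+x. ennreal_powr (F x) a \<partial>\<mu>"
    have N: "ennreal_powr (ennreal_powr ?N (1 / a)) (1 / q) = Lp_norm \<mu> s f"
      using a q0 real by (simp add: Lp_norm_def Lp_norm_nonneg_def FP ennreal_powr_powr one_ereal_def a_def)
    show ?thesis
    proof (cases p)
      case p: (real p')
      then have sp': "s' \<le> p'" using sp real by simp
      define b where "b = p' / q"
      have b: "b \<ge> a" "q * b = p'" "p' > 0" using sp' s q0 by (auto simp: b_def a_def divide_right_mono)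
      have "dunkl_amalgam_norm \<kappa> (ereal q) p f = ennreal_powr (ennreal_powr (\<integral>\<^sup>+y. ennreal_powr (T y) b \<partial>\<mu>) (1 / b)) (1 / q)"
        unfolding norm using p b q0 by (simp add: Lp_norm_nonneg_def ennreal_powr_powr one_ereal_def b_def)
      also have "\<dots> \<le> ennreal_powr (ennreal_powr ?N (1 / a) * ennreal (m powr (1 - 1 / a + 1 / b))) (1 / q)"
        unfolding T_def using q0
        by (intro ennreal_powr_mono nn_integral_kernel_young sigma_finite_dunkl_measure F kp k1 m kx ky a b) simp
      also have "\<dots> = Lp_norm \<mu> s f * ennreal (m powr ((1 - 1 / a + 1 / b) * (1 / q)))"
        using q0 by (simp add: ennreal_powr_mult N ennreal_powr_ennreal powr_powr)
      also have "(1 - 1 / a + 1 / b) * (1 / q) = real_of_ereal (1 / p - 1 / s + 1 / ereal q)"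
        using q0 a b p real by (simp add: a_def b_def one_ereal_def field_simps)
      finally show ?thesis unfolding m_def .
    next
      case PInf
      \<comment> \<open>For p = \<infinity> no integration in y takes place: Jensen's inequality at
        each y, followed by k \<le> 1, is enough.\<close>
      have "ennreal_powr (T y) (1 / q) \<le> Lp_norm \<mu> s f * ennreal (m powr real_of_ereal (1 / p - 1 / s + 1 / ereal q))" for y
      proof -
        have "T y \<le> ennreal_powr (\<integral>\<^sup>+x. ennreal_powr (F x) a * k x y \<partial>\<mu>) (1 / a) * ennreal (m powr (1 - 1 / a))"
          unfolding T_def by (intro nn_integral_kernel_jensen F kM m kx a)
        also have "\<dots> \<le> ennreal_powr ?N (1 / a) * ennreal (m powr (1 - 1 / a))"
          using a mult_left_mono[OF k1] by (intro mult_right_mono ennreal_powr_mono nn_integral_mono) fastforce+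
        finally have "ennreal_powr (T y) (1 / q) \<le> ennreal_powr (ennreal_powr ?N (1 / a) * ennreal (m powr (1 - 1 / a))) (1 / q)"
          using q0 by (intro ennreal_powr_mono) auto
        also have "\<dots> = Lp_norm \<mu> s f * ennreal (m powr ((1 - 1 / a) * (1 / q)))"
          using q0 by (simp add: ennreal_powr_mult N ennreal_powr_ennreal powr_powr)
        also have "(1 - 1 / a) * (1 / q) = real_of_ereal (1 / p - 1 / s + 1 / ereal q)"
          using q0 a PInf real by (simp add: a_def one_ereal_def field_simps)
        finally show ?thesis .
      qed
      from sup[OF this] show ?thesis unfolding m_def PInf .
    qed (use sp real in simp)
  next
    case PInf
    then have p: "p = \<infinity>" using sp by simp
    let ?S = "Lp_norm \<mu> s f"
    have S: "?S = esssup \<mu> (\<lambda>x. ennreal (norm (f x)))"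
      using PInf by (simp add: Lp_norm_def Lp_norm_nonneg_def)
    have "ennreal_powr (T y) (1 / q) \<le> ?S * ennreal (m powr real_of_ereal (1 / p - 1 / s + 1 / ereal q))" for y
    proof -
      have "T y \<le> (\<integral>\<^sup>+x. ennreal_powr ?S q * k x y \<partial>\<mu>)"
        unfolding T_def
      proof (rule nn_integral_mono_AE)
        show "AE x in \<mu>. F x * k x y \<le> ennreal_powr ?S q * k x y"
          using esssup_AE[where M = \<mu> and f = "\<lambda>x. ennreal (norm (f x))"] unfolding S
          by eventually_elim (auto simp: FP intro!: mult_right_mono ennreal_powr_mono q0)
      qed
      also have "\<dots> = ennreal_powr ?S q * (\<integral>\<^sup>+x. k x y \<partial>\<mu>)"
        by (rule nn_integral_cmult[OF kM])
      also have "\<dots> \<le> ennreal_powr ?S q * ennreal m"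
        by (intro mult_left_mono kx) simp
      finally have "ennreal_powr (T y) (1 / q) \<le> ennreal_powr (ennreal_powr ?S q * ennreal m) (1 / q)"
        using q0 by (intro ennreal_powr_mono) auto
      also have "\<dots> = ?S * ennreal (m powr (1 / q))"
        using q0 m by (simp add: ennreal_powr_mult ennreal_powr_powr ennreal_powr_ennreal)
      finally show ?thesis
        using q0 p PInf by (simp add: one_ereal_def)
    qed
    from sup[OF this] show ?thesis unfolding m_def p .
  qed (use qs in simp)
qed

end

theorem proposition3p4:
  fixes \<kappa> :: real and q s p :: ereal and f :: "real \<Rightarrow> complex"
  assumes "\<kappa> > - 1 / 2"
    and "1 \<le> q" and "q \<le> s" and "s \<le> p" and "p \<le> \<infinity>"
    and "f \<in> borel_measurable (dunkl_measure \<kappa>)"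
  shows "dunkl_amalgam_norm \<kappa> q p f
    \<le> ennreal (4 powr real_of_ereal (1 / q)) * Lp_norm (dunkl_measure \<kappa>) s f *
       ennreal (measure (dunkl_measure \<kappa>) (dunkl_ball 0 1) powr real_of_ereal (1 / p - 1 / s + 1 / q))"
proof -
  interpret dunkl \<kappa> by unfold_locales fact
  show ?thesis
  proof (cases q)
    case (real q')
    then have q: "1 \<le> q'" using assms(2) by (simp add: one_ereal_def)
    let ?R = "Lp_norm (dunkl_measure \<kappa>) s f *
      ennreal (measure (dunkl_measure \<kappa>) (dunkl_ball 0 1) powr real_of_ereal (1 / p - 1 / s + 1 / q))"
    have "dunkl_amalgam_norm \<kappa> q p f \<le> ?R"
      using dunkl_amalgam_norm_le[OF q _ assms(4,6)] assms(3) unfolding real by blast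
    also have "\<dots> = 1 * ?R" by simp
    also have "\<dots> \<le> ennreal (4 powr real_of_ereal (1 / q)) * ?R"
      using real q by (intro mult_right_mono) (auto simp: one_ereal_def ge_one_powr_ge_zero)
    finally show ?thesis by (simp only: mult.assoc)
  next
    case PInf
    then have sp: "s = \<infinity>" "p = \<infinity>" using assms(3,4) by auto
    \<comment> \<open>All exponents are now 0. Since \<open>0 powr 0 = 0\<close>, positivity is what
      makes the factor with the measure of the ball equal to 1.\<close>
    have "measure (dunkl_measure \<kappa>) (dunkl_ball 0 1) > 0"
      by (rule emeasure_dunkl_ball)
    then show ?thesis
      unfolding PInf sp using dunkl_amalgam_norm_infinity[OF assms(6)] by simp
  qed (use assms(2) in simp)
qed

end
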